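(* Let $n\ge 2$, let $A$ be an $n\times n$ matrix with all entries in $\{-1,1\}$, and let $\operatorname{rk} A = r+1$ with $0\le r\le n-1$. Then: (1) If $(n,r)\neq(4,3)$ (that is, in all cases except that of a nonsingular matrix of order $4$), then $|\operatorname{per} A|\le \operatorname{per} D_{(n,r)}$. (2) If $(n,r)=(4,3)$, then the inequality $|\operatorname{per} A|\le \operatorname{per} D_{(4,3)}$ fails if and only if $A$ can be obtained from $D_{(4,4)}$ by standard transformations (so $D_{(4,4)}$ is, up to standard transformations, the unique exception). (3) The equality $|\operatorname{per} A|=\operatorname{per} D_{(n,r)}$ holds if and only if $A$ can be obtained from $D_{(n,r)}$ by standard transformations. In particular, for $n\ge 5$, every $A\in M_n(\pm1)$ with $\operatorname{rk}A=r+1$ satisfies $|\operatorname{per} A|\le \operatorname{per} D_{(n,r)}$, with equality if and only if $A$ can be obtained from $D_{(n,r)}$ by standard transformations.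
   Context: $M_n(\pm1)$ is the set of $n\times n$ matrices with entries in $\{-1,1\}$, regarded over a field of characteristic zero; rank is over this field. The permanent is $\operatorname{per}A=\sum_{\sigma\in S_n}a_{1\sigma(1)}\cdots a_{n\sigma(n)}$. For $0\le l\le n$, $D_{(n,l)}=(d_{ij})\in M_n(\pm1)$ is the matrix with $d_{ii}=-1$ for $1\le i\le l$ and all other entries equal to $1$. Standard transformations are: multiplication of rows or columns by $-1$, permutation of rows, permutation of columns, transposition, and their compositions. *)

theory Defs
  imports
    "Jordan_Normal_Form.DL_Rank"
    "Jordan_Normal_Form.Column_Operations"
begin

(* A matrix over {-1,1} is represented with integer entries, so that the absolute value of its
   permanent makes sense. It is regarded over a field of characteristic zero by mapping its
   entries along of_int; the rank is then taken over that field. *)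
definition pm1_mats :: "nat \<Rightarrow> int mat set" where
  "pm1_mats n = {A \<in> carrier_mat n n. elements_mat A \<subseteq> {-1, 1}}"

(* Set to 0 on non-square matrices, following the convention of det. *)
definition permanent :: "'a :: comm_semiring_1 mat \<Rightarrow> 'a" where
  "permanent A = (if dim_row A = dim_col A
     then (\<Sum>p \<in> {p. p permutes {0..<dim_row A}}. \<Prod>i = 0..<dim_row A. A $$ (i, p i))
     else 0)"

(* Indices start at 0, so the entries -1 occupy the diagonal positions 0, ..., l - 1. *)
definition D_mat :: "nat \<Rightarrow> nat \<Rightarrow> int mat" where
  "D_mat n l = mat n n (\<lambda>(i, j). if i = j \<and> i < l then -1 else 1)"

inductive std_step :: "int mat \<Rightarrow> int mat \<Rightarrow> bool" where
  negate_row: "i < dim_row A \<Longrightarrow> std_step A (multrow i (-1) A)"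
| negate_col: "j < dim_col A \<Longrightarrow> std_step A (multcol j (-1) A)"
| permute_rows: "p permutes {0..<dim_row A} \<Longrightarrow>
    std_step A (mat (dim_row A) (dim_col A) (\<lambda>(i, j). A $$ (p i, j)))"
| permute_cols: "p permutes {0..<dim_col A} \<Longrightarrow>
    std_step A (mat (dim_row A) (dim_col A) (\<lambda>(i, j). A $$ (i, p j)))"
| transpose: "std_step A (transpose_mat A)"

(* std_transform A B: B can be obtained from A by standard transformations. *)
definition std_transform :: "int mat \<Rightarrow> int mat \<Rightarrow> bool" where
  "std_transform = std_step\<^sup>*\<^sup>*"

end

theory Submission
  imports Defs "HOL-Library.Function_Algebras"
begin

text \<open>
  Write p(n,r) for the permanent of D(n,r). Then p(n,r+1) = p(n,r) - 2 p(n-1,r) and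
  p(n,r) = r p(n-1,r-1) + (n-r) p(n-1,r) for r < n. The proof is by induction on the order n.

  If A is singular of rank r+1, delete a row that depends on the others. At most r columns of the
  remaining matrix are coloops, i.e. lower the rank when removed, so the Laplace expansion along the
  deleted row gives |per A| <= r p(n-1,r-1) + (n-r) p(n-1,r) = p(n,r). In case of equality the
  n-r columns that are not coloops are parallel, and likewise for rows; after normalisation the
  minors at the coloops, which are extremal and of equal sign, determine A.

  If A is nonsingular and two rows differ, up to sign, in exactly one column, expand along this
  column: the minors at these two rows cancel, the other n-2 minors have rank n-2, and
  (n-2) p(n-1,n-3) = p(n,n-1). If no two rows and no two columns are that close, then either all
  pairs of rows differ (up to sign) in two places, which forces A to be equivalent to D(n,n), or
  some pair differs in at least three; then so many terms of the expansion along these two rows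
  vanish that the bound is strict. The order 6 needs a closer look at the ranks of
  the minors, and the order 4 yields the exception D(4,4).
\<close>

section \<open>Permanents over finite index sets\<close>

text \<open>Everything is stated for functions on arbitrary finite index sets: a minor is the same
  function on smaller sets, and nothing is ever reindexed. Matrices return only at the end. The
  induction has to carry the equality case, because an extremal matrix is reconstructed from its
  extremal minors; the common sign of their contributions fixes what the minors alone leave open.
  Two small values obstruct a uniform argument. As p(4,4) = 8 exceeds p(4,3) = 4, a minor equivalent
  to D(4,4) breaks the inductive bound; such minors matter in the row expansion of order 5 and the
  two-row expansion of order 6. As p(2,1) = 0, the values p(3,1) and p(3,2) agree, so at (4,2)
  equality does not reveal the number of coloops, and parallel lines are found by orthogonality
  instead. Order 6 is special for two more reasons: 4 = n - 2 allows two rows to differ from a third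
  one in disjoint pairs of columns, and the crude estimate of the two-row expansion at distance 3,
  12 * 12 = 144, exceeds p(6,5) = 128.\<close>

definition bijs :: "'a set \<Rightarrow> 'b set \<Rightarrow> ('a \<Rightarrow> 'b) set" where
  "bijs I J = {f \<in> I \<rightarrow>\<^sub>E J. bij_betw f I J}"

text \<open>Deleting a row and a column is set subtraction in the arguments while \<open>a\<close>
  stays fixed. Without a bijection the sum is empty and the value is 0.\<close>

definition per_on :: "'a set \<Rightarrow> 'b set \<Rightarrow> ('a \<Rightarrow> 'b \<Rightarrow> int) \<Rightarrow> int" where
  "per_on I J a = (\<Sum>f\<in>bijs I J. \<Prod>i\<in>I. a i (f i))"

lemma finite_bijs [simp]: "finite I \<Longrightarrow> finite J \<Longrightarrow> finite (bijs I J)"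
  unfolding bijs_def by (simp add: finite_PiE)

lemma per_on_cong:
  assumes "\<And>i j. i \<in> I \<Longrightarrow> j \<in> J \<Longrightarrow> a i j = b i j"
  shows "per_on I J a = per_on I J b"
  unfolding per_on_def
  by (intro sum.cong prod.cong refl assms) (auto simp: bijs_def)

lemma per_on_empty [simp]: "per_on {} {} a = 1"
  by (auto simp: per_on_def bijs_def bij_betw_def)

lemma per_on_expand_row:
  assumes "finite I" "finite J" "i \<in> I"
  shows "per_on I J a = (\<Sum>j\<in>J. a i j * per_on (I - {i}) (J - {j}) a)"
proof -
  let ?S = "Sigma J (\<lambda>j. bijs (I - {i}) (J - {j}))"
  have "(\<Sum>j\<in>J. a i j * per_on (I - {i}) (J - {j}) a) =
        (\<Sum>j\<in>J. \<Sum>g\<in>bijs (I - {i}) (J - {j}). a i j * (\<Prod>k\<in>I - {i}. a k (g k)))"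
    by (simp add: per_on_def sum_distrib_left)
  also have "\<dots> = (\<Sum>(j, g)\<in>?S. a i j * (\<Prod>k\<in>I - {i}. a k (g k)))"
    using assms by (subst sum.Sigma) auto
  also have "\<dots> = (\<Sum>f\<in>bijs I J. \<Prod>k\<in>I. a k (f k))"
  \<comment> \<open>Resetting the value at \<open>i\<close> to \<open>undefined\<close> keeps the
    restricted bijection extensional.\<close>
  proof (rule sum.reindex_bij_witness[where j = "\<lambda>(j, g). g(i := j)" and i = "\<lambda>f. (f i, f(i := undefined))"])
    fix p assume "p \<in> ?S"
    then obtain j g where p: "p = (j, g)" "j \<in> J" "g \<in> bijs (I - {i}) (J - {j})" by auto
    have g: "g \<in> (I - {i}) \<rightarrow>\<^sub>E (J - {j})" "bij_betw g (I - {i}) (J - {j})"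
      using p by (auto simp: bijs_def)
    show "(case case p of (j, g) \<Rightarrow> g(i := j) of f \<Rightarrow> (f i, f(i := undefined))) = p"
      using PiE_arb[OF g(1), of i] by (simp add: p(1) fun_upd_idem)
    have "bij_betw (g(i := j)) (I - {i}) (J - {j})"
      using g(2) by (rule bij_betw_cong[THEN iffD1, rotated]) auto
    then have "bij_betw (g(i := j)) (I - {i} \<union> {i}) (J - {j} \<union> {(g(i := j)) i})"
      by (intro notIn_Un_bij_betw) auto
    then have b: "bij_betw (g(i := j)) I J"
      using p assms by (simp add: insert_absorb)
    show "(case p of (j, g) \<Rightarrow> g(i := j)) \<in> bijs I J"
      using g p bij_betwE[OF b] b assms by (auto simp: bijs_def intro!: PiE_I dest: PiE_arb)
    show "(\<Prod>k\<in>I. a k ((case p of (j, g) \<Rightarrow> g(i := j)) k)) = (case p of (j, g) \<Rightarrow> a i j * (\<Prod>k\<in>I - {i}. a k (g k)))"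
      using p assms by (simp add: prod.remove[of I i])
  next
    fix f assume f: "f \<in> bijs I J"
    then have f': "f \<in> I \<rightarrow>\<^sub>E J" "bij_betw f I J" by (auto simp: bijs_def)
    show "(case (f i, f(i := undefined)) of (j, g) \<Rightarrow> g(i := j)) = f" by auto
    have "bij_betw f (I - {i}) (J - {f i})"
      using f'(2) assms(3) by (auto simp: bij_betw_def inj_on_def)
    then have "bij_betw (f(i := undefined)) (I - {i}) (J - {f i})"
      by (rule bij_betw_cong[THEN iffD1, rotated]) auto
    moreover have "f(i := undefined) \<in> (I - {i}) \<rightarrow>\<^sub>E (J - {f i})"
    proof (rule PiE_I)
      fix x assume "x \<in> I - {i}"
      then show "(f(i := undefined)) x \<in> J - {f i}"
        using bij_betwE[OF \<open>bij_betw f (I - {i}) (J - {f i})\<close>] by auto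
    next
      fix x assume "x \<notin> I - {i}"
      then show "(f(i := undefined)) x = undefined"
        using PiE_arb[OF f'(1), of x] by (cases "x = i") auto
    qed
    moreover have "f i \<in> J" using f'(1) assms(3) by (rule PiE_mem)
    ultimately show "(f i, f(i := undefined)) \<in> ?S" by (simp add: bijs_def)
  qed
  finally show ?thesis by (simp add: per_on_def)
qed

lemma per_on_transpose:
  assumes "finite I" "finite J"
  shows "per_on J I (\<lambda>j i. a i j) = per_on I J a"
proof -
  have *: "restrict (inv_into A f) B \<in> bijs B A"
    "restrict (inv_into B (restrict (inv_into A f) B)) A = f" if "f \<in> bijs A B" for f :: "'c \<Rightarrow> 'd" and A B
  proof -
    have f: "f \<in> A \<rightarrow>\<^sub>E B" "bij_betw f A B" using that by (auto simp: bijs_def)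
    have b: "bij_betw (restrict (inv_into A f) B) B A"
      using bij_betw_inv_into[OF f(2)] by (simp add: bij_betw_restrict_eq)
    then show "restrict (inv_into A f) B \<in> bijs B A"
      by (auto simp: bijs_def dest: bij_betwE)
    have "inv_into B (restrict (inv_into A f) B) x = f x" if "x \<in> A" for x
    proof -
      have "f x \<in> B" using that f by auto
      moreover have "restrict (inv_into A f) B (f x) = x"
        using that f by (auto simp: bij_betw_def)
      ultimately show ?thesis using b by (metis bij_betw_inv_into_left)
    qed
    then show "restrict (inv_into B (restrict (inv_into A f) B)) A = f"
      using PiE_arb[OF f(1)] by (simp add: fun_eq_iff)
  qed
  show ?thesis
    unfolding per_on_def
  proof (rule sum.reindex_bij_witness[where i = "\<lambda>f. restrict (inv_into I f) J" and j = "\<lambda>f. restrict (inv_into J f) I"])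
    fix f assume f: "f \<in> bijs J I"
    then have b: "bij_betw f J I" by (auto simp: bijs_def)
    have "(\<Prod>i\<in>I. a i (restrict (inv_into J f) I i)) = (\<Prod>j\<in>J. a (f j) (restrict (inv_into J f) I (f j)))"
      using prod.reindex_bij_betw[OF b, of "\<lambda>i. a i (restrict (inv_into J f) I i)"] by simp
    also have "\<dots> = (\<Prod>j\<in>J. a (f j) j)"
      using b by (intro prod.cong refl) (auto simp: bij_betw_def)
    finally show "(\<Prod>i\<in>I. a i (restrict (inv_into J f) I i)) = (\<Prod>j\<in>J. a (f j) j)" .
  next
    fix f assume f: "f \<in> bijs J I"
    show "restrict (inv_into J f) I \<in> bijs I J" "restrict (inv_into I (restrict (inv_into J f) I)) J = f"
      using *[OF f] by blast+
  next
    fix f assume f: "f \<in> bijs I J"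
    show "restrict (inv_into I f) J \<in> bijs J I" "restrict (inv_into J (restrict (inv_into I f) J)) I = f"
      using *[OF f] by blast+
  qed
qed

lemma per_on_expand_col:
  assumes "finite I" "finite J" "j \<in> J"
  shows "per_on I J a = (\<Sum>i\<in>I. a i j * per_on (I - {i}) (J - {j}) a)"
proof -
  have "per_on J I (\<lambda>j i. a i j) = (\<Sum>i\<in>I. a i j * per_on (J - {j}) (I - {i}) (\<lambda>j i. a i j))"
    by (rule per_on_expand_row[OF assms(2,1,3)])
  moreover have "per_on (J - {j}) (I - {i}) (\<lambda>j i. a i j) = per_on (I - {i}) (J - {j}) a" for i
    by (rule per_on_transpose) (use assms in auto)
  ultimately show ?thesis
    using per_on_transpose[OF assms(1,2), of a] by simp
qed

lemma per_on_scale: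
  assumes "finite I" "finite J"
  shows "per_on I J (\<lambda>i j. s i * t j * a i j) = prod s I * prod t J * per_on I J a"
proof -
  have "(\<Prod>i\<in>I. s i * t (f i) * a i (f i)) = prod s I * prod t J * (\<Prod>i\<in>I. a i (f i))" if "f \<in> bijs I J" for f
  proof -
    have "bij_betw f I J" using that by (auto simp: bijs_def)
    then show ?thesis
      using prod.reindex_bij_betw[of f I J t] by (simp add: prod.distrib)
  qed
  then show ?thesis unfolding per_on_def sum_distrib_left by (rule sum.cong[OF refl])
qed

lemma permanent_eq_per_on:
  assumes "A \<in> carrier_mat n n"
  shows "permanent A = per_on {0..<n} {0..<n} (\<lambda>i j. A $$ (i, j))"
proof -
  let ?S = "{0..<n}"
  have "(\<Sum>p | p permutes ?S. \<Prod>i = 0..<n. A $$ (i, p i)) =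
        (\<Sum>f\<in>bijs ?S ?S. \<Prod>i\<in>?S. A $$ (i, f i))"
  \<comment> \<open>A permutation is the identity outside the index set, an element of
    \<open>bijs\<close> is \<open>undefined\<close> there; the witnesses translate between the two
    conventions.\<close>
  proof (rule sum.reindex_bij_witness[where j = "\<lambda>p. restrict p ?S" and i = "\<lambda>f x. if x \<in> ?S then f x else x"])
    fix p assume "p \<in> {p. p permutes ?S}"
    then have p: "p permutes ?S" by simp
    show "(\<lambda>x. if x \<in> ?S then restrict p ?S x else x) = p"
      using permutes_not_in[OF p] by (simp add: fun_eq_iff)
    show "restrict p ?S \<in> bijs ?S ?S"
      using p permutes_imp_bij[OF p] by (simp add: bijs_def bij_betw_restrict_eq permutes_in_image del: atLeastLessThan_iff)
  next
    fix f assume "f \<in> bijs ?S ?S"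
    then have f: "f \<in> ?S \<rightarrow>\<^sub>E ?S" "bij_betw f ?S ?S" by (auto simp: bijs_def)
    show "restrict (\<lambda>x. if x \<in> ?S then f x else x) ?S = f"
      using PiE_arb[OF f(1)] by (simp add: fun_eq_iff)
    have "bij_betw (\<lambda>x. if x \<in> ?S then f x else x) ?S ?S"
      using f(2) by (rule bij_betw_cong[THEN iffD1, rotated]) auto
    then show "(\<lambda>x. if x \<in> ?S then f x else x) \<in> {p. p permutes ?S}"
      using bij_imp_permutes[of "\<lambda>x. if x \<in> ?S then f x else x" ?S] by (simp del: atLeastLessThan_iff)
  qed simp
  then show ?thesis using assms by (simp add: permanent_def per_on_def)
qed

section \<open>The permanents of the matrices D(n,r)\<close>

text \<open>The permanent of \<open>D_mat n r\<close> for \<open>r \<le> n\<close>: the recursion changes the last diagonal entry from 1 to -1.\<close>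

fun dper :: "nat \<Rightarrow> nat \<Rightarrow> int" where
  "dper n 0 = fact n"
| "dper n (Suc r) = dper n r - 2 * dper (n - 1) r"

text \<open>Behind it is the Laplace expansion of \<open>D_mat (Suc n) r\<close> along a row without
  -1, which exists as \<open>r \<le> n\<close>: the \<open>r\<close> columns containing a -1 give
  minors with \<open>r - 1\<close> of them, the other columns keep all. The proof derives it from
  the recursion alone.\<close>

lemma dper_expand:
  "r \<le> n \<Longrightarrow> dper (Suc n) r = int r * dper n (r - 1) + (int (Suc n) - int r) * dper n r"
proof (induction r arbitrary: n)
  case (Suc r)
  then obtain m where n: "n = Suc m" "r \<le> m" by (cases n) auto
  have 1: "dper (Suc n) r = int r * dper n (r - 1) + (int (Suc n) - int r) * dper n r"
    using Suc by simp
  have 2: "dper n r = int r * dper m (r - 1) + (int n - int r) * dper m r"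
    using Suc.IH[of m] n by simp
  \<comment> \<open>The factor \<open>int r\<close> absorbs the case \<open>r = 0\<close>, where
    \<open>r - 1\<close> truncates.\<close>
  have 3: "int r * dper n r = int r * dper n (r - 1) - 2 * int r * dper m (r - 1)"
    using n by (cases r) (auto simp: algebra_simps)
  have 4: "dper (Suc n) (Suc r) = dper (Suc n) r - 2 * dper n r"
    and 5: "dper n (Suc r) = dper n r - 2 * dper m r" using n by simp_all
  show ?case unfolding 4 5 1 using 2 3 by (simp add: algebra_simps)
qed simp

text \<open>The troublesome values are \<open>dper 2 1 = 0\<close>, which makes
  \<open>dper 3 1\<close> and \<open>dper 3 2\<close> equal, the negative \<open>dper 3 3\<close>,
  and \<open>dper 4 4\<close>, which is larger than \<open>dper 4 3\<close>.\<close>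

lemma dper_2_1: "dper 2 1 = 0"
  and dper_3_1: "dper 3 1 = 2"
  and dper_3_2: "dper 3 2 = 2"
  and dper_3_3: "dper 3 3 = - 2"
  and dper_4_1: "dper 4 1 = 12"
  and dper_4_2: "dper 4 2 = 8"
  and dper_4_3: "dper 4 3 = 4"
  and dper_4_4: "dper 4 4 = 8"
  and dper_5_3: "dper 5 3 = 32"
  and dper_6_5: "dper 6 5 = 128"
  by (simp_all add: eval_nat_numeral)

text \<open>The recursions give p(n+1,n) = n p(n,n-1) + p(n,n) and p(n+1,n+1) = n p(n,n-1) - p(n,n).
  The comparison starts at 5 because p(4,4) > p(4,3); it keeps D(n,n) strictly below the bound for
  nonsingular matrices.\<close>

lemma dper_diag: "n \<ge> 4 \<Longrightarrow> dper n n > 0 \<and> (n \<ge> 5 \<longrightarrow> dper n n < dper n (n - 1)) \<and> dper n (n - 1) > 0"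
proof (induction n rule: nat_induct_at_least)
  case base
  then show ?case by (simp add: dper_4_3 dper_4_4)
next
  case (Suc n)
  have 1: "dper (Suc n) n = int n * dper n (n - 1) + dper n n"
    using dper_expand[of n n] by simp
  have 2: "dper (Suc n) (Suc n) = dper (Suc n) n - 2 * dper n n" by simp
  have "int n * dper n (n - 1) > dper n n"
  proof (cases "n = 4")
    case True
    then show ?thesis by (simp add: dper_4_3 dper_4_4)
  next
    case False
    then have "dper n n < dper n (n - 1)" using Suc by simp
    moreover have "1 * dper n (n - 1) \<le> int n * dper n (n - 1)"
      using Suc by (intro mult_right_mono) auto
    ultimately show ?thesis by linarith
  qed
  with 1 2 Suc show ?case by simp
qed

text \<open>In order \<open>Suc n\<close> with \<open>0 < r < n\<close>, both summands of
  \<open>dper_expand\<close> are nonnegative and the first is positive. The case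
  \<open>r = n\<close> comes from \<open>dper_diag\<close> or, for \<open>n < 4\<close>, from the
  explicit values.\<close>

lemma dper_nonneg_pos: "r < n \<Longrightarrow> dper n r \<ge> 0 \<and> ((n, r) \<noteq> (2, 1) \<longrightarrow> dper n r > 0)"
proof (induction n arbitrary: r)
  case (Suc n)
  consider "r = 0" | "r = n" "r > 0" "n \<ge> 4" | "r = n" "r > 0" "n < 4" | "0 < r" "r < n"
    using Suc.prems by linarith
  then show ?case
  proof cases
    case 2
    then show ?thesis using dper_diag[of "Suc n"] by auto
  next
    case 3
    then have "n = 1 \<or> n = 2 \<or> n = 3" by auto
    then show ?thesis using 3 dper_2_1 dper_3_2 dper_4_3 by (auto simp: eval_nat_numeral)
  next
    case 4
    have e: "dper (Suc n) r = int r * dper n (r - 1) + (int (Suc n) - int r) * dper n r"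
      using 4 by (intro dper_expand) simp
    have "dper n r \<ge> 0" "dper n (r - 1) \<ge> 0" using Suc.IH[of r] Suc.IH[of "r - 1"] 4 by auto
    moreover have "dper n (r - 1) > 0"
    proof -
      have "r - 1 < n" "(n, r - 1) \<noteq> (2, 1)" using 4 by auto
      then show ?thesis using Suc.IH by blast
    qed
    ultimately have "int r * dper n (r - 1) > 0" "(int (Suc n) - int r) * dper n r \<ge> 0"
      using 4 by simp_all
    then show ?thesis using e by simp
  qed simp
qed simp

lemma dper_nonneg: "r < n \<Longrightarrow> dper n r \<ge> 0"
  using dper_nonneg_pos by blast

lemma dper_pos: "r < n \<Longrightarrow> (n, r) \<noteq> (2, 1) \<Longrightarrow> dper n r > 0"
  using dper_nonneg_pos by blast

text \<open>Consecutive values differ by \<open>2 * dper (n - 1) s\<close>, which is nonnegative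
  while \<open>s < n - 1\<close>.\<close>

lemma dper_antimono:
  assumes "r \<le> s" "s < n"
  shows "dper n s \<le> dper n r"
  using assms
proof (induction s rule: dec_induct)
  case (step s)
  moreover from step have "dper (n - 1) s \<ge> 0" by (intro dper_nonneg) simp
  ultimately show ?case by simp
qed simp

text \<open>This is the expansion of \<open>D_mat (m + 2) (m + 1)\<close> along two rows that
  contain a -1. They differ in two columns, whose removal leaves \<open>m - 1\<close> entries -1. Of
  the other \<open>m\<close> columns, \<open>m - 1\<close> contain a -1, so a pair of them removes
  two or one. The coefficients count ordered pairs. Having p(n,n-1) in this form allows a comparison
  with two-row minors.\<close>

lemma dper_second_expand:
  assumes "m \<ge> 3"
  shows "dper (m + 2) (m + 1) = (int m - 1) * (int m - 2) * dper m (m - 3) +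
    2 * (int m - 1) * dper m (m - 2) + 2 * dper m (m - 1)"
proof -
  obtain k where m: "m = k + 3" using assms by (metis le_add_diff_inverse2)
  define d c a where "d = dper m k" and "c = dper m (k + 1)" and "a = dper m (k + 2)"
  have a: "dper (k + 5) (k + 4) = dper (k + 5) (k + 2) - 4 * dper (k + 4) (k + 2) + 4 * a"
    by (simp add: a_def m eval_nat_numeral)
  have b: "dper (k + 5) (k + 2) = (int k + 2) * dper (k + 4) (k + 1) + 3 * dper (k + 4) (k + 2)"
    using dper_expand[of "k + 2" "k + 4"] by (simp add: eval_nat_numeral algebra_simps)
  have c: "dper (k + 4) (k + 1) = (int k + 1) * d + 3 * c"
    using dper_expand[of "k + 1" "k + 3"] by (simp add: eval_nat_numeral algebra_simps d_def c_def m)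
  have e: "dper (k + 4) (k + 2) = (int k + 2) * c + 2 * a"
    using dper_expand[of "k + 2" "k + 3"] by (simp add: eval_nat_numeral algebra_simps a_def c_def m)
  have "dper (k + 5) (k + 4) = (int k + 2) * (int k + 1) * d + 2 * (int k + 2) * c + 2 * a"
    unfolding a b c e by (simp add: algebra_simps)
  then show ?thesis by (simp add: m d_def c_def a_def eval_nat_numeral algebra_simps)
qed

text \<open>The factor is the number 3 * 2 + (m - 1)(m - 2) of ordered column pairs that survive
  when two rows of length \<open>m + 2\<close> differ in exactly three places. For
  \<open>m = 4\<close> the inequality fails (144 against 128), hence the separate treatment of order
  6.\<close>

lemma dper_distance_3_bound:
  assumes "m \<ge> 5"
  shows "(6 + (int m - 1) * (int m - 2)) * dper m (m - 3) < dper (m + 2) (m + 1)"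
proof -
  obtain q where m: "m = Suc (Suc (Suc q))" "q \<ge> 2"
    using assms by (intro that[of "m - 3"]) auto
  define c c' a a' where "c = dper m (m - 2)" and "c' = dper (m - 1) (m - 3)"
    and "a = dper m (m - 1)" and "a' = dper (m - 1) (m - 2)"
  have pos: "c' > 0" "a' > 0"
    unfolding c'_def a'_def using assms by (auto intro!: dper_pos)
  have d: "dper m (m - 3) = c + 2 * c'"
    by (simp add: c_def c'_def m)
  have ca: "a = c - 2 * a'"
    by (simp add: c_def a_def a'_def m)
  have c: "c = (int q + 1) * c' + 2 * a'"
    using dper_expand[of "Suc q" "Suc (Suc q)"] by (simp add: c_def c'_def a'_def m del: dper.simps)
  \<comment> \<open>What is left of the claim after cancelling
    \<open>(m - 1) * (m - 2) * dper m (m - 3)\<close> against \<open>dper_second_expand\<close> and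
    halving.\<close>
  have "3 * (c + 2 * c') < (int q + 2) * c + a"
  proof -
    have "6 * c' \<le> (int q * (int q + 1)) * c'"
      using pos m mult_mono[of 2 "int q" 3 "int q + 1"] by (intro mult_right_mono) auto
    moreover have "(int q - 1) * (2 * a') > 0" using pos m by simp
    ultimately have *: "6 * c' < (int q - 1) * ((int q + 1) * c' + 2 * a') + (int q + 1) * c'"
      by (simp add: algebra_simps)
    have "(int q + 2) * c + a - 3 * (c + 2 * c') = (int q - 1) * c + (c - 2 * a') - 6 * c'"
      unfolding ca by (simp add: algebra_simps)
    also have "\<dots> = (int q - 1) * ((int q + 1) * c' + 2 * a') + (int q + 1) * c' - 6 * c'"
      unfolding c by simp
    finally show ?thesis using * by linarith
  qed
  moreover have "dper (m + 2) (m + 1) = (int q + 2) * (int q + 1) * (c + 2 * c') +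
    2 * (int q + 2) * c + 2 * a"
    using dper_second_expand[of m] assms unfolding d c_def[symmetric] a_def[symmetric] by (simp add: m(1) algebra_simps)
  moreover have "(6 + (int m - 1) * (int m - 2)) = 6 + (int q + 2) * (int q + 1)"
    by (simp add: m(1) add.commute)
  ultimately show ?thesis unfolding d by (simp add: algebra_simps)
qed

section \<open>Rank of a matrix over finite index sets\<close>

interpretation fun_vs: vector_space "\<lambda>(c :: 'k :: field) (f :: 'b \<Rightarrow> 'k) x. c * f x"
  by unfold_locales (auto simp: fun_eq_iff algebra_simps)

text \<open>Columns outside \<open>J\<close> are set to 0 rather than dropped, so all column subsets
  share one ambient vector space of functions.\<close>

definition row_on :: "'b set \<Rightarrow> ('a \<Rightarrow> 'b \<Rightarrow> 'k) \<Rightarrow> 'a \<Rightarrow> 'b \<Rightarrow> 'k :: field" where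
  "row_on J a i = (\<lambda>j. if j \<in> J then a i j else 0)"

definition rank_on :: "'a set \<Rightarrow> 'b set \<Rightarrow> ('a \<Rightarrow> 'b \<Rightarrow> 'k :: field) \<Rightarrow> nat" where
  "rank_on I J a = fun_vs.dim (row_on J a ` I)"

context vector_space
begin

lemma dim_insert_if:
  assumes "finite S"
  shows "dim (insert x S) = (if x \<in> span S then dim S else Suc (dim S))"
proof (cases "x \<in> span S")
  case True
  then show ?thesis using span_eq_dim[OF span_redundant[OF True]] by simp
next
  case False
  obtain B where B: "B \<subseteq> S" "independent B" "S \<subseteq> span B" "card B = dim S"
    using basis_exists by blast
  have fB: "finite B" using B(1) assms finite_subset by blast
  have sp: "span B = span S"
    using span_minimal[OF B(3) subspace_span] span_mono[OF B(1)] by blast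
  have "independent (insert x B)"
    using B(2) False sp by (simp add: independent_insert)
  moreover have "span (insert x B) = span (insert x S)"
    using sp by (simp add: span_insert)
  ultimately have "dim (insert x S) = card (insert x B)"
    by (metis dim_eq_card)
  moreover have "x \<notin> B" using False B(1) span_base by blast
  ultimately show ?thesis using False fB B(4) by simp
qed

end

lemma rank_on_empty [simp]: "rank_on {} J a = 0"
  by (simp add: rank_on_def fun_vs.dim_eq_card_independent fun_vs.independent_empty)

lemma rank_on_insert:
  assumes "finite I"
  shows "rank_on (insert i I) J a =
    (if row_on J a i \<in> fun_vs.span (row_on J a ` I) then rank_on I J a else Suc (rank_on I J a))"
  unfolding rank_on_def image_insert by (rule fun_vs.dim_insert_if) (use assms in simp)

lemma rank_on_remove:
  assumes "finite I" "i \<in> I"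
  shows "rank_on I J a = (if row_on J a i \<in> fun_vs.span (row_on J a ` (I - {i}))
    then rank_on (I - {i}) J a else Suc (rank_on (I - {i}) J a))"
  using rank_on_insert[of "I - {i}" i J a] assms by (simp add: insert_absorb)

lemma rank_on_remove_le:
  assumes "finite I"
  shows "rank_on (I - {i}) J a \<le> rank_on I J a" "rank_on I J a \<le> Suc (rank_on (I - {i}) J a)"
  using rank_on_remove[OF assms, of i J a] by (cases "i \<in> I"; auto)+

lemma rank_on_le_card: "finite I \<Longrightarrow> rank_on I J a \<le> card I"
  by (induction I rule: finite_induct) (auto simp: rank_on_insert)

lemma rank_on_mono:
  assumes "finite I" "K \<subseteq> I"
  shows "rank_on K J a \<le> rank_on I J a"
proof -
  have "finite (I - K)" using assms by simp
  moreover have "rank_on K J a \<le> rank_on (K \<union> M) J a" if "finite M" for M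
    using that
  proof (induction M rule: finite_induct)
    case (insert x M)
    then show ?case using rank_on_insert[of "K \<union> M" x J a] assms finite_subset by fastforce
  qed simp
  ultimately show ?thesis using assms by (metis Un_Diff_cancel sup.absorb2)
qed

text \<open>If every row lay outside the span of the others, adding the rows one at a time would
  raise the rank each time, up to \<open>card I\<close>.\<close>

lemma ex_redundant_row:
  assumes "finite I" "rank_on I J a < card I"
  shows "\<exists>i\<in>I. rank_on (I - {i}) J a = rank_on I J a"
proof (rule ccontr)
  assume *: "\<not> ?thesis"
  have out: "row_on J a i \<notin> fun_vs.span (row_on J a ` (I - {i}))" if "i \<in> I" for i
    using * that rank_on_remove[OF assms(1) that, of J a] by auto
  have "rank_on K J a = card K" if "K \<subseteq> I" for K
    using finite_subset[OF that assms(1)] that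
  proof (induction K rule: finite_induct)
    case (insert x K)
    have "fun_vs.span (row_on J a ` K) \<subseteq> fun_vs.span (row_on J a ` (I - {x}))"
      using insert by (intro fun_vs.span_mono image_mono) auto
    then show ?case using insert out[of x] rank_on_insert[of K x J a] by auto
  qed simp
  then show False using assms by simp
qed

text \<open>A row outside the span of all others is outside the span of any part of them, so
  removing the rows of \<open>T\<close> one after another costs 1 each time.\<close>

lemma rank_on_essential_rows:
  assumes "finite I" "T \<subseteq> I" "\<And>t. t \<in> T \<Longrightarrow> rank_on (I - {t}) J a < rank_on I J a"
  shows "rank_on I J a = card T + rank_on (I - T) J a"
  using finite_subset[OF assms(2,1)] assms(2,3)
proof (induction T rule: finite_induct)
  case (insert t T)
  then have "t \<in> I" by auto
  then have "row_on J a t \<notin> fun_vs.span (row_on J a ` (I - {t}))"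
    using rank_on_remove[OF assms(1), of t J a] insert.prems(2)[of t] by auto
  moreover have "fun_vs.span (row_on J a ` (I - T - {t})) \<subseteq> fun_vs.span (row_on J a ` (I - {t}))"
    by (intro fun_vs.span_mono image_mono) auto
  ultimately have "rank_on (I - T) J a = Suc (rank_on (I - T - {t}) J a)"
    using rank_on_remove[of "I - T" t J a] assms(1) insert by auto
  moreover have "I - insert t T = I - T - {t}" by auto
  ultimately show ?case using insert by simp
qed simp

lemma sum_fun_apply: "(\<Sum>v\<in>S. f v) x = (\<Sum>v\<in>S. f v x)"
  by (induction S rule: infinite_finite_induct) auto

text \<open>Rank factorisation: a basis of the columns together with the coefficients of all columns
  in it also yields a spanning set of the rows with as many members.\<close>

lemma rank_on_le_transpose:
  assumes "finite J"
  shows "rank_on I J a \<le> rank_on J I (\<lambda>j i. a i j)"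
proof -
  let ?S = "row_on I (\<lambda>j i. a i j) ` J"
  obtain C where C: "C \<subseteq> ?S" "fun_vs.independent C" "?S \<subseteq> fun_vs.span C" "card C = fun_vs.dim ?S"
    by (rule fun_vs.basis_exists)
  have fC: "finite C" using C(1) assms finite_subset by blast
  have "\<exists>u. row_on I (\<lambda>j i. a i j) j = (\<Sum>v\<in>C. (\<lambda>x. u v * v x))" if "j \<in> J" for j
  proof -
    have "row_on I (\<lambda>j i. a i j) j \<in> fun_vs.span C" using C(3) that by blast
    then show ?thesis unfolding fun_vs.span_finite[OF fC] by blast
  qed
  then obtain u where u: "\<And>j. j \<in> J \<Longrightarrow> row_on I (\<lambda>j i. a i j) j = (\<Sum>v\<in>C. (\<lambda>x. u j v * v x))"
    using bchoice[of J "\<lambda>j u. row_on I (\<lambda>j i. a i j) j = (\<Sum>v\<in>C. (\<lambda>x. u v * v x))"] by blast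
  \<comment> \<open>The row of coefficients of the basis column \<open>v\<close>; row
    \<open>i\<close> of the matrix is the combination of these with weights
    \<open>v i\<close>.\<close>
  define w where "w v = (\<lambda>j. if j \<in> J then u j v else 0)" for v
  have "row_on J a i = (\<Sum>v\<in>C. (\<lambda>x. v i * w v x))" if "i \<in> I" for i
  proof
    fix j
    have "a i j = (\<Sum>v\<in>C. u j v * v i)" if "j \<in> J"
      using fun_cong[OF u[OF that], of i] \<open>i \<in> I\<close> by (simp add: row_on_def sum_fun_apply)
    then show "row_on J a i j = (\<Sum>v\<in>C. (\<lambda>x. v i * w v x)) j"
      by (cases "j \<in> J") (simp_all add: row_on_def sum_fun_apply w_def mult.commute)
  qed
  moreover have "(\<Sum>v\<in>C. (\<lambda>x. v i * w v x)) \<in> fun_vs.span (w ` C)" for i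
    by (intro fun_vs.span_sum fun_vs.span_scale fun_vs.span_base imageI)
  ultimately have "row_on J a ` I \<subseteq> fun_vs.span (w ` C)" by (simp add: image_subset_iff)
  then have "fun_vs.dim (row_on J a ` I) \<le> card (w ` C)"
    by (rule fun_vs.dim_le_card) (use fC in simp)
  also have "\<dots> \<le> card C" by (rule card_image_le[OF fC])
  finally show ?thesis using C(4) by (simp add: rank_on_def)
qed

lemma rank_on_transpose:
  assumes "finite I" "finite J"
  shows "rank_on J I (\<lambda>j i. a i j) = rank_on I J a"
  using rank_on_le_transpose[OF assms(2), of I a] rank_on_le_transpose[OF assms(1), of J "\<lambda>j i. a i j"]
  by simp

lemma rank_on_remove_col_le:
  assumes "finite I" "finite J"
  shows "rank_on I (J - {j}) a \<le> rank_on I J a" "rank_on I J a \<le> Suc (rank_on I (J - {j}) a)"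
proof -
  have "rank_on (J - {j}) I (\<lambda>j i. a i j) = rank_on I (J - {j}) a"
    "rank_on J I (\<lambda>j i. a i j) = rank_on I J a"
    by (rule rank_on_transpose; use assms in simp)+
  then show "rank_on I (J - {j}) a \<le> rank_on I J a" "rank_on I J a \<le> Suc (rank_on I (J - {j}) a)"
    using rank_on_remove_le[OF assms(2), where i = j and J = I and a = "\<lambda>j i. a i j"] by simp_all
qed

text \<open>The redundant row lies in the span of the others, and the kernel of the functional
  \<open>w\<close> is a subspace.\<close>

lemma rank_on_redundant_functional:
  assumes "finite I" "finite J" "i \<in> I" "rank_on (I - {i}) J a = rank_on I J a"
    and "\<And>i'. i' \<in> I - {i} \<Longrightarrow> (\<Sum>j\<in>J. w j * a i' j) = 0"
  shows "(\<Sum>j\<in>J. w j * a i j) = 0"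
proof -
  let ?V = "{v. (\<Sum>j\<in>J. w j * v j) = 0}"
  have sub: "fun_vs.subspace ?V"
    by (auto simp: fun_vs.subspace_def algebra_simps sum.distrib simp flip: sum_distrib_left)
  have e: "(\<Sum>j\<in>J. w j * row_on J a k j) = (\<Sum>j\<in>J. w j * a k j)" for k
    by (intro sum.cong) (auto simp: row_on_def)
  have "row_on J a i \<in> fun_vs.span (row_on J a ` (I - {i}))"
    using rank_on_remove[OF assms(1,3), of J a] assms(4) by (auto split: if_splits)
  moreover have "row_on J a ` (I - {i}) \<subseteq> ?V" using assms(5) by (auto simp: e)
  ultimately have "row_on J a i \<in> ?V" using fun_vs.span_minimal[OF _ sub] by blast
  then show ?thesis by (simp add: e)
qed

lemma rank_on_redundant_parallel:
  assumes "finite I" "i \<in> I" "i' \<in> I" "i \<noteq> i'" "\<And>j. j \<in> J \<Longrightarrow> a i j = c * a i' j"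
  shows "rank_on (I - {i}) J a = rank_on I J a"
proof -
  have "row_on J a i = (\<lambda>x. c * row_on J a i' x)" using assms(5) by (auto simp: row_on_def)
  moreover have "(\<lambda>x. c * row_on J a i' x) \<in> fun_vs.span (row_on J a ` (I - {i}))"
    using assms by (intro fun_vs.span_scale fun_vs.span_base) auto
  ultimately show ?thesis using rank_on_remove[OF assms(1,2), of J a] by simp
qed

lemma rank_on_singleton:
  assumes "j \<in> J" "a i j \<noteq> 0"
  shows "rank_on {i} J a = 1"
proof -
  have "row_on J a i \<noteq> 0" using assms by (auto simp: row_on_def fun_eq_iff)
  then show ?thesis using rank_on_insert[of "{}" i J a] by simp
qed

lemma rank_on_pos:
  assumes "finite I" "i \<in> I" "j \<in> J" "a i j \<noteq> 0"
  shows "rank_on I J a \<ge> 1"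
  using rank_on_mono[of I "{i}" J a] rank_on_singleton[of j J a i] assms by simp

lemma rank_on_1_parallel:
  assumes "finite I" "rank_on I J a = 1" "i \<in> I" "i' \<in> I" "j \<in> J" "a i j \<noteq> 0"
  shows "\<exists>c. \<forall>k\<in>J. a i' k = c * a i k"
proof -
  have "rank_on {i', i} J a \<le> 1" using rank_on_mono[of I "{i', i}" J a] assms by simp
  then have "row_on J a i' \<in> fun_vs.span {row_on J a i}"
    using rank_on_insert[of "{i}" i' J a] rank_on_singleton[of j J a i] assms by (auto split: if_splits)
  then obtain c where "row_on J a i' = (\<lambda>x. c * row_on J a i x)"
    unfolding fun_vs.span_singleton by auto
  then have "\<forall>k\<in>J. a i' k = c * a i k" by (metis row_on_def)
  then show ?thesis ..
qed

section \<open>Sign matrices\<close>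

definition pm_on :: "'a set \<Rightarrow> 'b set \<Rightarrow> ('a \<Rightarrow> 'b \<Rightarrow> int) \<Rightarrow> bool" where
  "pm_on I J a \<longleftrightarrow> (\<forall>i\<in>I. \<forall>j\<in>J. a i j = 1 \<or> a i j = -1)"

definition flip :: "('a \<times> 'b) set \<Rightarrow> 'a \<Rightarrow> 'b \<Rightarrow> int" where
  "flip F i j = (if (i, j) \<in> F then -1 else 1)"

text \<open>
  Equivalence to \<open>D_mat n r\<close> under standard transformations: up to signs of the rows and columns, the
  entries -1 form a partial permutation matrix of size \<open>r\<close>.
\<close>

definition is_star :: "'a set \<Rightarrow> 'b set \<Rightarrow> nat \<Rightarrow> ('a \<Rightarrow> 'b \<Rightarrow> int) \<Rightarrow> bool" where
  "is_star I J r a \<longleftrightarrow> (\<exists>s t F. (\<forall>i\<in>I. s i = 1 \<or> s i = -1) \<and> (\<forall>j\<in>J. t j = 1 \<or> t j = -1) \<and>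
     F \<subseteq> I \<times> J \<and> card F = r \<and> inj_on fst F \<and> inj_on snd F \<and>
     (\<forall>i\<in>I. \<forall>j\<in>J. a i j = s i * t j * flip F i j))"

text \<open>Negating one of two sign rows complements this set, so closeness up to sign appears as
  size \<open>d\<close> or \<open>card J - d\<close>.\<close>

definition diff_on :: "'b set \<Rightarrow> ('a \<Rightarrow> 'b \<Rightarrow> int) \<Rightarrow> 'a \<Rightarrow> 'a \<Rightarrow> 'b set" where
  "diff_on J a x y = {j \<in> J. a x j \<noteq> a y j}"

lemma is_starI:
  assumes "\<And>i. i \<in> I \<Longrightarrow> s i = 1 \<or> s i = -1" "\<And>j. j \<in> J \<Longrightarrow> t j = 1 \<or> t j = -1"
    and "F \<subseteq> I \<times> J" "card F = r" "inj_on fst F" "inj_on snd F"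
    and "\<And>i j. i \<in> I \<Longrightarrow> j \<in> J \<Longrightarrow> a i j = s i * t j * flip F i j"
  shows "is_star I J r a"
  unfolding is_star_def using assms by (intro exI[of _ s] exI[of _ t] exI[of _ F]) simp

lemma is_starE:
  assumes "is_star I J r a"
  obtains s t F where "\<And>i. i \<in> I \<Longrightarrow> s i = 1 \<or> s i = -1" "\<And>j. j \<in> J \<Longrightarrow> t j = 1 \<or> t j = -1"
    and "F \<subseteq> I \<times> J" "card F = r" "inj_on fst F" "inj_on snd F"
    and "\<And>i j. i \<in> I \<Longrightarrow> j \<in> J \<Longrightarrow> a i j = s i * t j * flip F i j"
proof -
  from assms obtain s t F where "(\<forall>i\<in>I. s i = 1 \<or> s i = -1) \<and> (\<forall>j\<in>J. t j = 1 \<or> t j = -1) \<and>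
     F \<subseteq> I \<times> J \<and> card F = r \<and> inj_on fst F \<and> inj_on snd F \<and>
     (\<forall>i\<in>I. \<forall>j\<in>J. a i j = s i * t j * flip F i j)"
    unfolding is_star_def by (elim exE)
  then show thesis by (intro that[of s t F]) simp_all
qed

lemma inj_on_fst_iff: "inj_on fst F \<longleftrightarrow> (\<forall>i j l. (i, j) \<in> F \<longrightarrow> (i, l) \<in> F \<longrightarrow> j = l)"
  by (fastforce simp: inj_on_def)

lemma inj_on_snd_iff: "inj_on snd F \<longleftrightarrow> (\<forall>i j l. (i, l) \<in> F \<longrightarrow> (j, l) \<in> F \<longrightarrow> i = j)"
  by (fastforce simp: inj_on_def)

lemma pm_on_subset: "pm_on I J a \<Longrightarrow> I' \<subseteq> I \<Longrightarrow> J' \<subseteq> J \<Longrightarrow> pm_on I' J' a"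
  unfolding pm_on_def by blast

lemma pm_on_transpose: "pm_on I J a \<Longrightarrow> pm_on J I (\<lambda>j i. a i j)"
  unfolding pm_on_def by blast

lemma pm_onD: "pm_on I J a \<Longrightarrow> i \<in> I \<Longrightarrow> j \<in> J \<Longrightarrow> a i j = 1 \<or> a i j = -1"
  unfolding pm_on_def by blast

lemma pm_on_sq: "pm_on I J a \<Longrightarrow> i \<in> I \<Longrightarrow> j \<in> J \<Longrightarrow> a i j * a i j = 1"
  unfolding pm_on_def by force

lemma abs_prod_pm: "(\<And>i. i \<in> I \<Longrightarrow> s i = 1 \<or> s i = -1) \<Longrightarrow> \<bar>prod s I\<bar> = (1 :: int)"
  unfolding abs_prod by (intro prod.neutral) fastforce

lemma per_on_ones:
  assumes "finite I" "finite J" "card I = card J"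
  shows "per_on I J (\<lambda>_ _. 1) = fact (card I)"
  using assms
proof (induction "card I" arbitrary: I J)
  case (Suc n)
  then obtain i where i: "i \<in> I" by fastforce
  have "per_on I J (\<lambda>_ _. 1) = (\<Sum>j\<in>J. 1 * per_on (I - {i}) (J - {j}) (\<lambda>_ _. 1))"
    by (rule per_on_expand_row) (use Suc i in auto)
  also have "\<dots> = (\<Sum>j\<in>J. fact n)"
  proof (intro sum.cong refl)
    fix j assume "j \<in> J"
    then have "per_on (I - {i}) (J - {j}) (\<lambda>_ _. 1) = fact (card (I - {i}))"
      by (intro Suc(1)) (use Suc i in auto)
    moreover have "card (I - {i}) = n" using Suc.hyps(2) Suc.prems(1) i by simp
    ultimately show "1 * per_on (I - {i}) (J - {j}) (\<lambda>_ _. 1) = fact n" by simp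
  qed
  also have "\<dots> = fact (card I)" using Suc by (metis fact_Suc of_nat_id sum_constant)
  finally show ?case .
qed simp

text \<open>By linearity in a row, turning an entry 1 into -1 subtracts twice its minor, and no
  other flip lies in the deleted row or column. This is the recursion of
  \<open>dper\<close>.\<close>

lemma per_on_flip:
  assumes "finite F" "finite I" "finite J" "card I = card J" "F \<subseteq> I \<times> J" "inj_on fst F" "inj_on snd F"
  shows "per_on I J (flip F) = dper (card I) (card F)"
  using assms
proof (induction F arbitrary: I J rule: finite_induct)
  case empty
  then show ?case using per_on_ones[of I J] by (simp add: flip_def[abs_def])
next
  case (insert p F)
  obtain i j where p: "p = (i, j)" by fastforce
  have ij: "i \<in> I" "j \<in> J" and F: "F \<subseteq> I \<times> J" "inj_on fst F" "inj_on snd F"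
    using insert p by auto
  have ni: "(i, l) \<notin> F" for l
    using insert.prems(5) insert.hyps(2) p by (force simp: inj_on_def)
  have nj: "(l, j) \<notin> F" for l
    using insert.prems(6) insert.hyps(2) p by (force simp: inj_on_def)
  have F': "F \<subseteq> (I - {i}) \<times> (J - {j})" using F(1) ni nj by blast
  have c: "per_on (I - {i}) (J - {l}) (flip (insert p F)) = per_on (I - {i}) (J - {l}) (flip F)" for l
    by (rule per_on_cong) (auto simp: flip_def p)
  have "per_on I J (flip (insert p F)) = (\<Sum>l\<in>J. flip (insert p F) i l * per_on (I - {i}) (J - {l}) (flip F))"
    using per_on_expand_row[of I J i "flip (insert p F)"] insert ij c by simp
  also have "\<dots> = (\<Sum>l\<in>J. flip F i l * per_on (I - {i}) (J - {l}) (flip F)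
      + (if l = j then - 2 * per_on (I - {i}) (J - {l}) (flip F) else 0))"
    by (intro sum.cong refl) (auto simp: flip_def p ni)
  also have "\<dots> = per_on I J (flip F) - 2 * per_on (I - {i}) (J - {j}) (flip F)"
    using per_on_expand_row[of I J i "flip F"] insert ij by (simp add: sum.distrib)
  also have "\<dots> = dper (card I) (card F) - 2 * dper (card I - 1) (card F)"
    using insert.IH[of I J] insert.IH[of "I - {i}" "J - {j}"] insert.prems F F' ij by simp
  finally show ?case using insert.hyps by simp
qed

text \<open>The version that keeps the sign: in the equality cases the sign of an extremal minor
  determines further entries.\<close>

lemma per_on_signed_flip:
  assumes "finite I" "finite J" "card I = card J" "F \<subseteq> I \<times> J" "inj_on fst F" "inj_on snd F"
    and "\<And>i j. i \<in> I \<Longrightarrow> j \<in> J \<Longrightarrow> a i j = s i * t j * flip F i j"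
  shows "per_on I J a = prod s I * prod t J * dper (card I) (card F)"
proof -
  have "per_on I J a = per_on I J (\<lambda>i j. s i * t j * flip F i j)"
    by (rule per_on_cong) (rule assms(7))
  also have "finite F" using assms finite_subset by blast
  then have "per_on I J (\<lambda>i j. s i * t j * flip F i j) = prod s I * prod t J * dper (card I) (card F)"
    using per_on_scale[of I J s t "flip F"] per_on_flip[of F I J] assms by simp
  finally show ?thesis .
qed

lemma abs_per_on_star:
  assumes "finite I" "finite J" "card I = card J" "is_star I J r a"
  shows "\<bar>per_on I J a\<bar> = \<bar>dper (card I) r\<bar>"
  using assms(4)
proof (rule is_starE)
  fix s t F
  assume *: "\<And>i. i \<in> I \<Longrightarrow> s i = 1 \<or> s i = -1" "\<And>j. j \<in> J \<Longrightarrow> t j = 1 \<or> t j = -1"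
     "F \<subseteq> I \<times> J" "card F = r" "inj_on fst F" "inj_on snd F"
     "\<And>i j. i \<in> I \<Longrightarrow> j \<in> J \<Longrightarrow> a i j = s i * t j * flip F i j"
  have "per_on I J a = prod s I * prod t J * dper (card I) (card F)"
    by (rule per_on_signed_flip) (use assms * in auto)
  then show ?thesis using abs_prod_pm[of I s] abs_prod_pm[of J t] * by (simp add: abs_mult)
qed

lemma is_star_transpose:
  assumes "is_star I J r a"
  shows "is_star J I r (\<lambda>j i. a i j)"
  using assms
proof (rule is_starE)
  fix s t F
  assume *: "\<And>i. i \<in> I \<Longrightarrow> s i = 1 \<or> s i = -1" "\<And>j. j \<in> J \<Longrightarrow> t j = 1 \<or> t j = -1"
     "F \<subseteq> I \<times> J" "card F = r" "inj_on fst F" "inj_on snd F"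
     "\<And>i j. i \<in> I \<Longrightarrow> j \<in> J \<Longrightarrow> a i j = s i * t j * flip F i j"
  have inj: "inj_on fst (F\<inverse>)" "inj_on snd (F\<inverse>)"
    using *(5,6) unfolding inj_on_fst_iff inj_on_snd_iff by blast+
  show ?thesis
    by (rule is_starI[where s = t and t = s and F = "F\<inverse>", OF _ _ _ _ inj])
      (use * in \<open>auto simp: flip_def\<close>)
qed

text \<open>In the expansion along column \<open>l\<close>, the minor at \<open>x\<close> contains
  row \<open>y\<close> and vice versa; these minors differ by the factor \<open>e\<close> and their
  coefficients by \<open>- e\<close>, so the two terms cancel.\<close>

lemma per_on_near_rows:
  assumes "finite I" "finite J" "x \<in> I" "y \<in> I" "x \<noteq> y" "l \<in> J" "e = 1 \<or> e = -1"
    and "\<And>j. j \<in> J - {l} \<Longrightarrow> a y j = e * a x j" and "a y l = - e * a x l"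
  shows "per_on I J a = (\<Sum>m\<in>I - {x, y}. a m l * per_on (I - {m}) (J - {l}) a)"
proof -
  let ?R = "I - {x, y}"
  have R: "I - {x} - {y} = ?R" "I - {y} - {x} = ?R" by auto
  have "per_on (I - {x}) (J - {l}) a = (\<Sum>j\<in>J - {l}. a y j * per_on ?R (J - {l} - {j}) a)"
    using per_on_expand_row[of "I - {x}" "J - {l}" y a] assms R by simp
  also have "\<dots> = (\<Sum>j\<in>J - {l}. e * (a x j * per_on ?R (J - {l} - {j}) a))"
    using assms(8) by (intro sum.cong refl) simp
  also have "\<dots> = e * per_on (I - {y}) (J - {l}) a"
    using per_on_expand_row[of "I - {y}" "J - {l}" x a] assms R by (simp add: sum_distrib_left)
  finally have 1: "per_on (I - {x}) (J - {l}) a = e * per_on (I - {y}) (J - {l}) a" .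
  have "per_on I J a = (\<Sum>m\<in>I. a m l * per_on (I - {m}) (J - {l}) a)"
    by (rule per_on_expand_col) (use assms in auto)
  also have "\<dots> = a x l * per_on (I - {x}) (J - {l}) a + a y l * per_on (I - {y}) (J - {l}) a +
     (\<Sum>m\<in>?R. a m l * per_on (I - {m}) (J - {l}) a)"
    using assms R by (simp add: sum.remove[of I x] sum.remove[of "I - {x}" y])
  finally show ?thesis using 1 assms(7,9) by auto
qed

text \<open>Pairs are ordered: an unordered pair counts twice, which matches the absolute value 2 of
  its 2 x 2 permanent.\<close>

definition same_class :: "'b set \<Rightarrow> 'b set \<Rightarrow> ('b \<times> 'b) set" where
  "same_class J D = {(j, l) \<in> J \<times> J. j \<noteq> l \<and> (j \<in> D \<longleftrightarrow> l \<in> D)}"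

lemma card_same_class:
  assumes "finite J" "D \<subseteq> J"
  shows "int (card (same_class J D)) = int (card D) * (int (card D) - 1) +
    (int (card J) - int (card D)) * (int (card J) - int (card D) - 1)"
proof -
  have off: "int (card (X \<times> X - Id_on X)) = int (card X) * (int (card X) - 1)" if "finite X" for X :: "'b set"
  proof -
    have "card (X \<times> X - Id_on X) = card X * card X - card X"
    proof -
      have "card (Id_on X) = card X"
        by (simp add: Id_on_eqI card_image inj_on_def Id_on_def UNION_singleton_eq_range)
      moreover have "Id_on X \<subseteq> X \<times> X" by auto
      ultimately show ?thesis using that by (simp add: card_Diff_subset finite_subset card_cartesian_product)
    qed
    moreover have "card X \<le> card X * card X" by (cases "card X") auto
    ultimately show ?thesis by (simp add: of_nat_diff algebra_simps)
  qed
  have fD: "finite D" using assms finite_subset by blast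
  have "same_class J D = (D \<times> D - Id_on D) \<union> ((J - D) \<times> (J - D) - Id_on (J - D))"
    using assms(2) by (auto simp: same_class_def)
  moreover have "card ((D \<times> D - Id_on D) \<union> ((J - D) \<times> (J - D) - Id_on (J - D))) =
    card (D \<times> D - Id_on D) + card ((J - D) \<times> (J - D) - Id_on (J - D))"
    by (rule card_Un_disjoint) (use assms fD in auto)
  moreover have "int (card (J - D)) = int (card J) - int (card D)"
    using assms fD card_mono[OF assms] by (simp add: card_Diff_subset of_nat_diff)
  ultimately show ?thesis using off[of D] off[of "J - D"] assms fD by simp
qed

text \<open>
  In the expansion along two rows, the 2 x 2 permanent in the columns j, l is 0 unless the rows agree
  in both columns or in none, and is 2 or -2 otherwise.
\<close>

lemma abs_per_on_le_same_class:
  assumes "finite I" "finite J" "x \<in> I" "y \<in> I" "x \<noteq> y" "pm_on I J a"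
  shows "\<bar>per_on I J a\<bar> \<le> (\<Sum>(j, l)\<in>same_class J (diff_on J a x y). \<bar>per_on (I - {x, y}) (J - {j, l}) a\<bar>)"
proof -
  define P where "P = Sigma J (\<lambda>j. J - {j})"
  define q where "q j l = per_on (I - {x, y}) (J - {j, l}) a" for j l
  have fP: "finite P" using assms by (simp add: P_def)
  have q_sym: "q j l = q l j" for j l by (simp add: q_def insert_commute)
  have R: "I - {x} - {y} = I - {x, y}" "J - {j} - {l} = J - {j, l}" for j l by auto
  have "per_on I J a = (\<Sum>j\<in>J. a x j * (\<Sum>l\<in>J - {j}. a y l * q j l))"
    using assms R by (subst per_on_expand_row[of I J x], simp_all)
      (intro sum.cong refl, subst per_on_expand_row[of "I - {x}" _ y], auto simp: q_def)
  also have "\<dots> = (\<Sum>(j, l)\<in>P. a x j * a y l * q j l)"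
    using assms by (simp add: P_def sum.Sigma[symmetric] sum_distrib_left mult.assoc)
  finally have 1: "per_on I J a = (\<Sum>(j, l)\<in>P. a x j * a y l * q j l)" .
  \<comment> \<open>Exchanging the two columns leaves the minor unchanged; adding both forms of the
    sum produces the 2 x 2 permanents.\<close>
  also have "\<dots> = (\<Sum>(j, l)\<in>P. a x l * a y j * q j l)"
    by (rule sum.reindex_bij_witness[where i = "\<lambda>(j, l). (l, j)" and j = "\<lambda>(j, l). (l, j)"])
      (auto simp: P_def q_sym)
  finally have "2 * per_on I J a = (\<Sum>(j, l)\<in>P. (a x j * a y l + a x l * a y j) * q j l)"
    using 1 by (simp add: case_prod_unfold distrib_right sum.distrib)
  then have "2 * \<bar>per_on I J a\<bar> \<le> (\<Sum>p\<in>P. \<bar>case p of (j, l) \<Rightarrow> (a x j * a y l + a x l * a y j) * q j l\<bar>)"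
    using sum_abs[of "\<lambda>(j, l). (a x j * a y l + a x l * a y j) * q j l" P] by linarith
  also have "\<dots> \<le> (\<Sum>p\<in>P. if p \<in> same_class J (diff_on J a x y) then 2 * (case p of (j, l) \<Rightarrow> \<bar>q j l\<bar>) else 0)"
  proof (rule sum_mono)
    fix p assume "p \<in> P"
    then obtain j l where p: "p = (j, l)" "j \<in> J" "l \<in> J" "j \<noteq> l" by (auto simp: P_def)
    have "a x j = 1 \<or> a x j = -1" "a x l = 1 \<or> a x l = -1" "a y j = 1 \<or> a y j = -1" "a y l = 1 \<or> a y l = -1"
      using pm_onD[OF assms(6)] assms p by blast+
    then show "\<bar>case p of (j, l) \<Rightarrow> (a x j * a y l + a x l * a y j) * q j l\<bar>
        \<le> (if p \<in> same_class J (diff_on J a x y) then 2 * (case p of (j, l) \<Rightarrow> \<bar>q j l\<bar>) else 0)"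
      using p by (auto simp: same_class_def diff_on_def abs_mult)
  qed
  also have "\<dots> = (\<Sum>p\<in>same_class J (diff_on J a x y). 2 * (case p of (j, l) \<Rightarrow> \<bar>q j l\<bar>))"
  proof -
    have "P \<inter> same_class J (diff_on J a x y) = same_class J (diff_on J a x y)"
      by (auto simp: P_def same_class_def)
    then show ?thesis using fP by (simp add: sum.inter_restrict[symmetric])
  qed
  also have "\<dots> = 2 * (\<Sum>(j, l)\<in>same_class J (diff_on J a x y). \<bar>q j l\<bar>)"
    by (simp add: sum_distrib_left case_prod_unfold)
  finally show ?thesis by (simp add: q_def)
qed

section \<open>The rank of sign matrices and the statement proved by induction\<close>

definition rk :: "'k :: field_char_0 itself \<Rightarrow> 'a set \<Rightarrow> 'b set \<Rightarrow> ('a \<Rightarrow> 'b \<Rightarrow> int) \<Rightarrow> nat" where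
  "rk K I J a = rank_on I J (\<lambda>i j. of_int (a i j) :: 'k)"

definition sq :: "nat \<Rightarrow> 'a set \<Rightarrow> 'b set \<Rightarrow> ('a \<Rightarrow> 'b \<Rightarrow> int) \<Rightarrow> bool" where
  "sq n I J a \<longleftrightarrow> finite I \<and> finite J \<and> card I = n \<and> card J = n \<and> pm_on I J a"

text \<open>All finite sets of naturals are allowed as index sets so that the hypothesis applies to
  minors directly. For \<open>r \<ge> n\<close> the statement is vacuous, hence it can be assumed
  for every \<open>r\<close>. At (4,3) the bound is weakened by its exception. Only the implication
  from equality to the star form is carried; the converse is a computation.\<close>

definition kraeuter :: "'k :: field_char_0 itself \<Rightarrow> nat \<Rightarrow> nat \<Rightarrow> bool" where
  "kraeuter K n r \<longleftrightarrow> (\<forall>(I :: nat set) (J :: nat set) a. sq n I J a \<longrightarrow> rk K I J a = Suc r \<longrightarrow>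
     ((n, r) \<noteq> (4, 3) \<longrightarrow> \<bar>per_on I J a\<bar> \<le> dper n r) \<and>
     ((n, r) = (4, 3) \<longrightarrow> \<bar>per_on I J a\<bar> \<le> dper 4 3 \<or> is_star I J 4 a) \<and>
     (\<bar>per_on I J a\<bar> = dper n r \<longrightarrow> is_star I J r a))"

lemma sqD:
  assumes "sq n I J a"
  shows "finite I" "finite J" "card I = n" "card J = n" "pm_on I J a"
  using assms by (auto simp: sq_def)

lemma sq_transpose: "sq n I J a \<Longrightarrow> sq n J I (\<lambda>j i. a i j)"
  by (auto simp: sq_def pm_on_def)

lemma sq_minor: "sq n I J a \<Longrightarrow> i \<in> I \<Longrightarrow> j \<in> J \<Longrightarrow> sq (n - 1) (I - {i}) (J - {j}) a"
  by (auto simp: sq_def pm_on_def)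

lemma rk_transpose: "finite I \<Longrightarrow> finite J \<Longrightarrow> rk K J I (\<lambda>j i. a i j) = rk K I J a"
  unfolding rk_def by (rule rank_on_transpose)

lemma rk_remove_row:
  assumes "finite I"
  shows "rk K (I - {i}) J a \<le> rk K I J a" "rk K I J a \<le> Suc (rk K (I - {i}) J a)"
  unfolding rk_def by (rule rank_on_remove_le[OF assms])+

lemma rk_remove_col:
  assumes "finite I" "finite J"
  shows "rk K I (J - {j}) a \<le> rk K I J a" "rk K I J a \<le> Suc (rk K I (J - {j}) a)"
  unfolding rk_def by (rule rank_on_remove_col_le[OF assms])+

lemma rk_le_card: "finite I \<Longrightarrow> rk K I J a \<le> card I"
  unfolding rk_def by (rule rank_on_le_card)

lemma rk_ex_redundant_row:
  "finite I \<Longrightarrow> rk K I J a < card I \<Longrightarrow> \<exists>i\<in>I. rk K (I - {i}) J a = rk K I J a"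
  unfolding rk_def by (rule ex_redundant_row)

lemma rk_essential_cols:
  fixes K :: "'k :: field_char_0 itself"
  assumes "finite I" "finite J" "T \<subseteq> J" "\<And>t. t \<in> T \<Longrightarrow> rk K I (J - {t}) a < rk K I J a"
  shows "rk K I J a = card T + rk K I (J - T) a"
proof -
  have "rk K J' I (\<lambda>j i. a i j) = rk K I J' a" if "J' \<subseteq> J" for J'
    by (rule rk_transpose) (use assms that finite_subset in auto)
  then show ?thesis
    using rank_on_essential_rows[OF assms(2,3), of I "\<lambda>j i. of_int (a i j) :: 'k"] assms(4)
    unfolding rk_def by simp
qed

text \<open>A proportionality of two columns that holds off a redundant row extends to that row,
  being a linear functional of the rows.\<close>

lemma rk_redundant_parallel:
  fixes K :: "'k :: field_char_0 itself"
  assumes "finite I" "finite J" "i \<in> I" "rk K (I - {i}) J a = rk K I J a" "u \<in> J" "v \<in> J"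
    and "\<And>i'. i' \<in> I - {i} \<Longrightarrow> a i' u = e * a i' v"
  shows "a i u = e * a i v"
proof -
  \<comment> \<open>The functional takes the entry at \<open>u\<close> minus \<open>e\<close> times
    the entry at \<open>v\<close>; writing it as a difference also covers
    \<open>u = v\<close>.\<close>
  define w :: "'b \<Rightarrow> 'k" where "w j = (if j = u then 1 else 0) - (if j = v then of_int e else 0)" for j
  have e: "(\<Sum>j\<in>J. w j * of_int (a k j)) = of_int (a k u - e * a k v)" for k
  proof -
    have "(\<Sum>j\<in>J. w j * of_int (a k j)) =
      (\<Sum>j\<in>J. (if j = u then of_int (a k j) else 0) - (if j = v then of_int e * of_int (a k j) else 0))"
      by (intro sum.cong) (auto simp: w_def algebra_simps)
    then show ?thesis using assms by (simp add: sum_subtractf)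
  qed
  have "(\<Sum>j\<in>J. w j * of_int (a i j)) = 0"
    by (rule rank_on_redundant_functional[OF assms(1-3) assms(4)[unfolded rk_def]])
      (simp add: e assms(7))
  then have "a i u - e * a i v = 0" unfolding e by (simp only: of_int_eq_0_iff)
  then show ?thesis by simp
qed

lemma rk_parallel_row:
  assumes "finite I" "x \<in> I" "y \<in> I" "x \<noteq> y" "\<And>j. j \<in> J \<Longrightarrow> a x j = e * a y j"
  shows "rk K (I - {x}) J a = rk K I J a"
  unfolding rk_def
  by (rule rank_on_redundant_parallel[OF assms(1-4), of _ _ "of_int e"]) (simp add: assms(5))

lemma rk_parallel_col:
  assumes "finite I" "finite J" "u \<in> J" "v \<in> J" "u \<noteq> v" "\<And>i. i \<in> I \<Longrightarrow> a i u = e * a i v"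
  shows "rk K I (J - {u}) a = rk K I J a"
  using rk_parallel_row[of J u v I "\<lambda>j i. a i j" e K] assms
    rk_transpose[of I J K a] rk_transpose[of I "J - {u}" K a] by simp

lemma rk_pos:
  assumes "finite I" "i \<in> I" "j \<in> J" "pm_on I J a"
  shows "rk K I J a \<ge> 1"
  unfolding rk_def using pm_onD[OF assms(4,2,3)]
  by (intro rank_on_pos[OF assms(1-3)]) auto

lemma rk_1_parallel_row:
  fixes K :: "'k :: field_char_0 itself"
  assumes "finite I" "rk K I J a = 1" "pm_on I J a" "x \<in> I" "y \<in> I"
  shows "\<exists>e. (e = 1 \<or> e = -1) \<and> (\<forall>j\<in>J. a y j = e * a x j)"
proof (cases "J = {}")
  case False
  then obtain l where l: "l \<in> J" by auto
  have s: "a x l = 1 \<or> a x l = -1" "a y l = 1 \<or> a y l = -1" using pm_onD[OF assms(3) _ l] assms(4,5) by simp_all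
  have "of_int (a x l) \<noteq> (0 :: 'k)" using s(1) by auto
  then have "\<exists>c. \<forall>k\<in>J. of_int (a y k) = c * (of_int (a x k) :: 'k)"
    by (rule rank_on_1_parallel[OF assms(1) assms(2)[unfolded rk_def] assms(4,5) l])
  then obtain c where c: "\<forall>k\<in>J. of_int (a y k) = c * (of_int (a x k) :: 'k)" ..
  \<comment> \<open>A sign is its own inverse, so the quotient of the entries in column
    \<open>l\<close> is their product; hence the factor \<open>c\<close> is an integer sign.\<close>
  define e where "e = a y l * a x l"
  have e: "e = 1 \<or> e = -1" using s by (auto simp: e_def)
  have "(of_int (a x l) :: 'k) * of_int (a x l) = 1" using s(1) by auto
  then have ce: "c = of_int e"
    using bspec[OF c l] by (simp add: e_def mult.assoc)
  have "a y k = e * a x k" if "k \<in> J" for k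
  proof -
    have "(of_int (a y k) :: 'k) = of_int (e * a x k)" using bspec[OF c that] by (simp add: ce)
    then show ?thesis by (simp only: of_int_eq_iff)
  qed
  with e show ?thesis by (intro exI[of _ e]) simp
qed (auto intro: exI[of _ 1])

text \<open>Equality in the triangle inequality: with \<open>s\<close> the sign of the total, the
  differences \<open>g m - s * f m\<close> are nonnegative and sum to 0.\<close>

lemma sum_abs_extremal:
  fixes f g :: "'a \<Rightarrow> int"
  assumes "finite S" "\<And>m. m \<in> S \<Longrightarrow> \<bar>f m\<bar> \<le> g m" "\<bar>sum f S\<bar> = sum g S"
  shows "\<exists>s. (s = 1 \<or> s = -1) \<and> (\<forall>m\<in>S. f m = s * g m)"
proof -
  define s :: int where "s = (if sum f S \<ge> 0 then 1 else -1)"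
  have "sum (\<lambda>m. g m - s * f m) S = 0"
  proof -
    have "sum (\<lambda>m. g m - s * f m) S = sum g S - s * sum f S"
      by (simp add: sum_subtractf sum_distrib_left)
    then show ?thesis using assms(3) by (auto simp: s_def)
  qed
  moreover have "g m - s * f m \<ge> 0" if "m \<in> S" for m
    using assms(2)[OF that] by (auto simp: s_def)
  ultimately have "\<forall>m\<in>S. g m - s * f m = 0"
    using sum_nonneg_eq_0_iff[OF assms(1), of "\<lambda>m. g m - s * f m"] by blast
  then have "\<forall>m\<in>S. f m = s * g m" by (auto simp: s_def)
  moreover have "s = 1 \<or> s = -1" by (simp add: s_def)
  ultimately show ?thesis by (intro exI[of _ s] conjI)
qed

text \<open>For D(n,n-1) the row without -1 and any other row are close in the sense of
  \<open>per_on_near_rows\<close>; each of the \<open>n - 2\<close> remaining rows gives a minor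
  D(n-1,n-3). The proof uses only the recursions.\<close>

lemma dper_near:
  assumes "n \<ge> 3"
  shows "dper n (n - 1) = (int n - 2) * dper (n - 1) (n - 3)"
proof -
  obtain q where n: "n = Suc (Suc (Suc q))" using assms by (intro that[of "n - 3"]) auto
  have 1: "dper n (n - 1) = (int q + 2) * dper (Suc (Suc q)) (Suc q) + dper (Suc (Suc q)) (Suc (Suc q))"
    using dper_expand[of "Suc (Suc q)" "Suc (Suc q)"] by (simp add: n del: dper.simps)
  have 2: "dper (Suc (Suc q)) (Suc q) = (int q + 1) * dper (Suc q) q + dper (Suc q) (Suc q)"
    using dper_expand[of "Suc q" "Suc q"] by (simp add: del: dper.simps)
  have 3: "dper (Suc (Suc q)) (Suc (Suc q)) = dper (Suc (Suc q)) (Suc q) - 2 * dper (Suc q) (Suc q)"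
    "dper (Suc (Suc q)) q = dper (Suc (Suc q)) (Suc q) + 2 * dper (Suc q) q"
    by simp_all
  have "n - 1 = Suc (Suc q)" "n - 3 = q" "int n - 2 = int q + 1" using n by simp_all
  then show ?thesis unfolding 1 3 using 2 by (simp add: algebra_simps)
qed

text \<open>The flip patterns of two parallel rows agree or are opposite in all columns. If row
  \<open>x\<close> had a flip at \<open>p\<close>, agreement would put a second flip into column
  \<open>p\<close>, and opposition would put flips of \<open>y\<close> into at least two other
  columns.\<close>

lemma star_parallel_unflipped:
  assumes "finite J" "card J \<ge> 3" "x \<noteq> y" "inj_on fst F" "inj_on snd F"
    and s: "s x = 1 \<or> s x = -1" "s y = 1 \<or> s y = -1" and t: "\<And>j. j \<in> J \<Longrightarrow> t j = 1 \<or> t j = -1"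
    and ax: "\<And>j. j \<in> J \<Longrightarrow> a x j = s x * t j * flip F x j"
    and ay: "\<And>j. j \<in> J \<Longrightarrow> a y j = s y * t j * flip F y j"
    and e: "e = 1 \<or> e = -1" and par: "\<And>j. j \<in> J \<Longrightarrow> a y j = e * a x j"
    and p: "p \<in> J"
  shows "(x, p) \<notin> F"
proof
  assume xp: "(x, p) \<in> F"
  have c: "flip F y j = (s x * s y * e) * flip F x j" if "j \<in> J" for j
  proof -
    have eq: "s y * t j * flip F y j = e * (s x * t j * flip F x j)"
      using par[OF that] unfolding ax[OF that] ay[OF that] .
    have sq: "s y * s y = 1" "t j * t j = 1" using s t[OF that] by auto
    have "flip F y j = (s y * s y) * (t j * t j) * flip F y j" by (simp only: sq mult_1)
    also have "\<dots> = s y * t j * (s y * t j * flip F y j)" by (simp only: ac_simps)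
    also have "\<dots> = (t j * t j) * (s x * s y * e) * flip F x j" unfolding eq by (simp only: ac_simps)
    finally show ?thesis by (simp only: sq mult_1)
  qed
  have "card (J - {p}) \<ge> 2" using assms(1,2) p by simp
  then obtain B where "B \<subseteq> J - {p}" "card B = 2" by (rule obtain_subset_with_card_n)
  then obtain u v where uv: "u \<in> J - {p}" "v \<in> J - {p}" "u \<noteq> v"
    by (auto simp: card_2_iff)
  have xu: "(x, j) \<in> F \<longleftrightarrow> j = p" for j
    using assms(4) xp unfolding inj_on_fst_iff by blast
  have "s x * s y * e = 1 \<or> s x * s y * e = -1" using s e by (elim disjE) simp_all
  then show False
  proof
    assume "s x * s y * e = 1"
    then have "flip F y p = -1" using c[OF p] xp by (simp add: flip_def)
    then have "(y, p) \<in> F" by (simp add: flip_def split: if_splits)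
    then show False using assms(3,5) xp unfolding inj_on_snd_iff by blast
  next
    assume "s x * s y * e = -1"
    then have "flip F y u = -1" "flip F y v = -1" using c[of u] c[of v] uv xu by (simp_all add: flip_def)
    then have "(y, u) \<in> F" "(y, v) \<in> F" by (simp_all add: flip_def split: if_splits)
    then show False using assms(4) uv(3) unfolding inj_on_fst_iff by blast
  qed
qed

section \<open>Nonsingular matrices\<close>

lemma kraeuterD:
  fixes I J :: "nat set"
  assumes "kraeuter K n r" "sq n I J a" "rk K I J a = Suc r"
  shows "(n, r) \<noteq> (4, 3) \<Longrightarrow> \<bar>per_on I J a\<bar> \<le> dper n r"
    "(n, r) = (4, 3) \<Longrightarrow> \<bar>per_on I J a\<bar> \<le> dper 4 3 \<or> is_star I J 4 a"
    "\<bar>per_on I J a\<bar> = dper n r \<Longrightarrow> is_star I J r a"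
  using assms unfolding kraeuter_def by simp_all

lemma sign_cancel:
  assumes "s * s = (1 :: int)"
  shows "u * s * (s * v) * c = u * v * c"
proof -
  have "u * s * (s * v) * c = s * s * (u * v * c)" by (simp only: ac_simps)
  then show ?thesis by (simp add: assms)
qed

text \<open>In case of equality all \<open>n - 2\<close> minors are extremal. Their star form shows
  that off column \<open>l\<close> each other row is, up to sign, row \<open>x\<close> with one
  entry flipped, in distinct columns for distinct rows. The common sign of the terms then fixes
  column \<open>l\<close>.\<close>

lemma near_rows_star:
  fixes I J :: "nat set"
  assumes sq: "sq n I J a" and n: "n \<ge> 3" and rk: "rk K I J a = n"
    and IH: "kraeuter K (n - 1) (n - 3)"
    and xy: "x \<in> I" "y \<in> I" "x \<noteq> y" and l: "l \<in> J" and e: "e = 1 \<or> e = -1"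
    and near: "\<And>j. j \<in> J - {l} \<Longrightarrow> a y j = e * a x j" "a y l = - e * a x l"
  shows "\<bar>per_on I J a\<bar> \<le> dper n (n - 1) \<and> (\<bar>per_on I J a\<bar> = dper n (n - 1) \<longrightarrow> is_star I J (n - 1) a)"
proof -
  note fin = sqD(1,2)[OF sq] and cards = sqD(3,4)[OF sq] and pm = sqD(5)[OF sq]
  define R where "R = I - {x, y}"
  define P where "P m = per_on (I - {m}) (J - {l}) a" for m
  define C where "C = dper (n - 1) (n - 3)"
  have ee: "e * e = 1" using e by auto
  have near': "a x j = e * a y j" if "j \<in> J - {l}" for j
    using near(1)[OF that] ee by (simp flip: mult.assoc)
  have finR: "finite R" and cardR: "card R = n - 2" and RI: "\<And>m. m \<in> R \<Longrightarrow> m \<in> I \<and> m \<noteq> x \<and> m \<noteq> y"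
    using fin cards xy by (auto simp: R_def card_Diff_subset)
  have Cpos: "C > 0" unfolding C_def by (rule dper_pos) (use n in auto)
  have rkJ: "rk K I (J - {l}) a \<ge> n - 1"
    using rk_remove_col(2)[OF fin, of K a l] rk by simp
  have rkJx: "rk K (I - {x}) (J - {l}) a = rk K I (J - {l}) a"
    by (rule rk_parallel_row[OF fin(1) xy near'])
  have sqm: "sq (n - 1) (I - {m}) (J - {l}) a" if "m \<in> R" for m
    by (rule sq_minor[OF sq]) (use RI that l in auto)
  \<comment> \<open>The rank is at least \<open>n - 2\<close> since two lines were deleted, and at
    most \<open>n - 2\<close> since \<open>x\<close> and \<open>y\<close> are parallel off
    \<open>l\<close>; \<open>Suc (n - 3)\<close> is \<open>n - 2\<close>.\<close>
  have rkm: "rk K (I - {m}) (J - {l}) a = Suc (n - 3)" if "m \<in> R" for m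
  proof -
    have "rk K (I - {m}) (J - {l}) a \<ge> n - 2"
      using rk_remove_row(2)[OF fin(1), of K "J - {l}" a m] rkJ by simp
    moreover have "rk K (I - {m} - {x}) (J - {l}) a = rk K (I - {m}) (J - {l}) a"
      by (rule rk_parallel_row[where y = y and e = e]) (use fin xy RI[OF that] near' in auto)
    moreover have "rk K (I - {m} - {x}) (J - {l}) a \<le> card (I - {m} - {x})"
      by (rule rk_le_card) (use fin in simp)
    moreover have "card (I - {m} - {x}) = n - 2"
      using RI[OF that] fin cards xy by simp
    ultimately show ?thesis using n by simp
  qed
  \<comment> \<open>Order 4 of the minor means rank 3, so the exception of order 4 never occurs
    here.\<close>
  have ne: "(n - 1, n - 3) \<noteq> (4 :: nat, 3 :: nat)" by auto
  have Pb: "\<bar>P m\<bar> \<le> C" if "m \<in> R" for m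
    unfolding P_def C_def by (rule kraeuterD(1)[OF IH sqm[OF that] rkm[OF that] ne])
  have per: "per_on I J a = (\<Sum>m\<in>R. a m l * P m)"
    unfolding R_def P_def by (rule per_on_near_rows[OF fin xy l e]) (rule near | assumption)+
  have aP: "\<bar>a m l * P m\<bar> \<le> C" if "m \<in> R" for m
    using Pb[OF that] pm_onD[OF pm _ l, of m] RI[OF that] by (auto simp: abs_mult)
  have tot: "(\<Sum>m\<in>R. C) = dper n (n - 1)"
    using dper_near[OF n] cardR n by (simp add: C_def of_nat_diff)
  have le: "\<bar>per_on I J a\<bar> \<le> dper n (n - 1)"
    unfolding per tot[symmetric] by (rule order_trans[OF sum_abs sum_mono]) (rule aP)
  have "is_star I J (n - 1) a" if eq: "\<bar>per_on I J a\<bar> = dper n (n - 1)"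
  proof -
    have "\<exists>s. (s = 1 \<or> s = -1) \<and> (\<forall>m\<in>R. a m l * P m = s * C)"
      by (rule sum_abs_extremal[OF finR aP]) (use eq per tot in simp_all)
    then obtain s where s: "s = 1 \<or> s = -1" and aPs: "\<And>m. m \<in> R \<Longrightarrow> a m l * P m = s * C"
      by auto
    have absP: "\<bar>P m\<bar> = C" if "m \<in> R" for m
      using arg_cong[OF aPs[OF that], of abs] s Cpos pm_onD[OF pm _ l, of m] RI[OF that]
      by (auto simp: abs_mult)
    have starm: "is_star (I - {m}) (J - {l}) (n - 3) a" if "m \<in> R" for m
      by (rule kraeuterD(3)[OF IH sqm[OF that] rkm[OF that]]) (use absP[OF that] in \<open>simp add: P_def C_def\<close>)
    have cardJ: "card (J - {l}) = n - 1" using cards fin l by simp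
    \<comment> \<open>The pair \<open>q\<close> consists of the sign of row \<open>z\<close>
      relative to row \<open>x\<close> and the column of its flipped entry.\<close>
    have ex: "\<exists>q. (fst q = 1 \<or> fst q = -1) \<and> snd q \<in> J - {l} \<and>
        (\<forall>j\<in>J - {l}. a z j = fst q * a x j * (if j = snd q then -1 else 1))" if z: "z \<in> R" for z
    proof (cases "n = 3")
      case False
      then have n4: "n \<ge> 4" using n by simp
      have "card (R - {z}) \<noteq> 0" using z finR cardR n4 by simp
      then have "R - {z} \<noteq> {}" by (metis card.empty)
      then obtain m where m: "m \<in> R" "m \<noteq> z" by auto
      from starm[OF m(1)] show ?thesis
      proof (rule is_starE)
        fix s t F
        assume *: "\<And>i. i \<in> I - {m} \<Longrightarrow> s i = 1 \<or> s i = -1" "\<And>j. j \<in> J - {l} \<Longrightarrow> t j = 1 \<or> t j = -1"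
          "F \<subseteq> (I - {m}) \<times> (J - {l})" "card F = n - 3" "inj_on fst F" "inj_on snd F"
          "\<And>i j. i \<in> I - {m} \<Longrightarrow> j \<in> J - {l} \<Longrightarrow> a i j = s i * t j * flip F i j"
        have mem: "x \<in> I - {m}" "y \<in> I - {m}" "z \<in> I - {m}" using xy RI[OF m(1)] RI[OF z] m(2) by auto
        have xF: "(x, p) \<notin> F" if "p \<in> J - {l}" for p
          by (rule star_parallel_unflipped[where y = y and e = e and a = a and J = "J - {l}" and s = s and t = t])
            (use * mem fin cardJ n4 xy e near(1) that in auto)
        have yF: "(y, p) \<notin> F" if "p \<in> J - {l}" for p
          by (rule star_parallel_unflipped[where y = x and e = e and a = a and J = "J - {l}" and s = s and t = t])
            (use * mem fin cardJ n4 xy e near' that in auto)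
        \<comment> \<open>Rows \<open>x\<close> and \<open>y\<close> carry no flips, so the
          \<open>n - 3\<close> flips occupy distinct rows among the \<open>n - 3\<close> rows of
          \<open>R - {m}\<close>; hence each of these rows, in particular \<open>z\<close>, has
          one.\<close>
        have FR: "i \<in> R - {m}" if "(i, j) \<in> F" for i j
          using *(3) that xF[of j] yF[of j] unfolding R_def by blast
        have "fst ` F \<subseteq> R - {m}"
        proof (rule image_subsetI)
          fix q assume "q \<in> F"
          then show "fst q \<in> R - {m}" using FR[of "fst q" "snd q"] by simp
        qed
        moreover have "card (fst ` F) = n - 3" using *(4,5) by (simp add: card_image)
        moreover have "card (R - {m}) = n - 3" using m cardR finR by simp
        ultimately have "fst ` F = R - {m}" using finR by (simp add: card_subset_eq)
        then have "z \<in> fst ` F" using z m by simp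
        then obtain p where p: "(z, p) \<in> F" by auto
        have pJ: "p \<in> J - {l}" using p *(3) by auto
        have zF: "(z, j) \<in> F \<longleftrightarrow> j = p" for j using p *(5) unfolding inj_on_fst_iff by blast
        have "a z j = (s z * s x) * a x j * (if j = p then -1 else 1)" if "j \<in> J - {l}" for j
        proof -
          have "s x * s x = 1" using *(1)[OF mem(1)] by auto
          moreover have "a x j = s x * t j" using *(7)[OF mem(1) that] xF[OF that] by (simp add: flip_def)
          moreover have "a z j = s z * t j * (if j = p then -1 else 1)"
            using *(7)[OF mem(3) that] by (simp add: flip_def zF)
          ultimately show ?thesis by (simp only: sign_cancel)
        qed
        moreover have "s z * s x = 1 \<or> s z * s x = -1" using *(1)[OF mem(1)] *(1)[OF mem(3)] by auto
        ultimately show ?thesis using pJ by (intro exI[of _ "(s z * s x, p)"]) simp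
      qed
    next
      \<comment> \<open>Here \<open>R = {z}\<close>, and there is no second row \<open>m\<close>
        whose minor contains \<open>z\<close>. Instead, on the two remaining columns
        \<open>z\<close> cannot be parallel to \<open>x\<close>, as the rank there is 2; taking the
        sign at \<open>p\<close> puts the flip at \<open>q\<close>.\<close>
      case True
      then obtain p q where pq: "J - {l} = {p, q}" "p \<noteq> q" using cardJ by (auto simp: card_2_iff)
      define \<tau> where "\<tau> = a z p * a x p"
      have pqJ: "p \<in> J" "q \<in> J" using pq by auto
      have zI: "z \<in> I" "z \<noteq> x" "z \<noteq> y" using RI[OF z] by auto
      have sgn: "a x p = 1 \<or> a x p = -1" "a x q = 1 \<or> a x q = -1" "a z p = 1 \<or> a z p = -1" "a z q = 1 \<or> a z q = -1"
        using pm_onD[OF pm] xy(1) zI(1) pqJ by simp_all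
      have "a z q \<noteq> \<tau> * a x q"
      proof
        assume "a z q = \<tau> * a x q"
        moreover have "a z p = \<tau> * a x p" using sgn(1) by (auto simp: \<tau>_def)
        ultimately have zx: "a z j = \<tau> * a x j" if "j \<in> J - {l}" for j
          using that pq(1) by auto
        have par: "a z j = (\<tau> * e) * a y j" if "j \<in> J - {l}" for j
          unfolding zx[OF that] near'[OF that] by (rule mult.assoc[symmetric])
        have "rk K (I - {x} - {z}) (J - {l}) a = rk K (I - {x}) (J - {l}) a"
          by (rule rk_parallel_row[where y = y and e = "\<tau> * e"]) (use fin xy zI par in auto)
        moreover have "rk K (I - {x} - {z}) (J - {l}) a \<le> card (I - {x} - {z})"
          by (rule rk_le_card) (use fin in simp)
        moreover have "card (I - {x} - {z}) = 1" using fin cards xy zI True by simp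
        ultimately show False using rkJ rkJx True by simp
      qed
      then have "a z q = - \<tau> * a x q" "a z p = \<tau> * a x p" "\<tau> = 1 \<or> \<tau> = -1"
        using sgn by (auto simp: \<tau>_def)
      then show ?thesis using pq by (intro exI[of _ "(\<tau>, q)"]) auto
    qed
    have "\<forall>z\<in>R. \<exists>q. (fst q = 1 \<or> fst q = -1) \<and> snd q \<in> J - {l} \<and>
        (\<forall>j\<in>J - {l}. a z j = fst q * a x j * (if j = snd q then -1 else 1))"
      by (rule ballI) (rule ex)
    from bchoice[OF this] obtain h where h: "\<forall>z\<in>R. (fst (h z) = 1 \<or> fst (h z) = -1) \<and> snd (h z) \<in> J - {l} \<and>
        (\<forall>j\<in>J - {l}. a z j = fst (h z) * a x j * (if j = snd (h z) then -1 else 1))" ..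
    define \<tau> f where "\<tau> z = fst (h z)" and "f z = snd (h z)" for z
    have \<tau>: "\<tau> z = 1 \<or> \<tau> z = -1" and f: "f z \<in> J - {l}"
      and az: "\<And>j. j \<in> J - {l} \<Longrightarrow> a z j = \<tau> z * a x j * (if j = f z then -1 else 1)" if "z \<in> R" for z
      using bspec[OF h that] by (simp_all add: \<tau>_def f_def)
    \<comment> \<open>Two rows flipped in the same column would be parallel off \<open>l\<close>,
      and \<open>x\<close>, \<open>y\<close> already are; the rank off \<open>l\<close> would fall
      below \<open>n - 1\<close>.\<close>
    have finj: "inj_on f R"
    proof (rule inj_onI, rule ccontr)
      fix z w assume zw: "z \<in> R" "w \<in> R" "f z = f w" "z \<noteq> w"
      have ww: "\<tau> w * \<tau> w = 1" using \<tau>[OF zw(2)] by auto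
      have par: "a z j = (\<tau> z * \<tau> w) * a w j" if "j \<in> J - {l}" for j
      proof -
        have "\<tau> z * \<tau> w * (\<tau> w * a x j) * (if j = f w then -1 else 1) = \<tau> z * a x j * (if j = f w then -1 else 1)"
          by (rule sign_cancel[OF ww])
        then show ?thesis
          unfolding az[OF zw(1) that] az[OF zw(2) that] zw(3) by (simp only: mult.assoc)
      qed
      have "rk K (I - {x} - {z}) (J - {l}) a = rk K (I - {x}) (J - {l}) a"
        by (rule rk_parallel_row[where y = w and e = "\<tau> z * \<tau> w"])
          (use fin xy RI[OF zw(1)] RI[OF zw(2)] zw(4) par in auto)
      moreover have "rk K (I - {x} - {z}) (J - {l}) a \<le> card (I - {x} - {z})"
        by (rule rk_le_card) (use fin in simp)
      moreover have "card (I - {x} - {z}) = n - 2" using fin cards xy RI[OF zw(1)] by simp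
      ultimately show False using rkJ rkJx n by simp
    qed
    define \<sigma> where "\<sigma> i = (if i = x then 1 else if i = y then e else \<tau> i)" for i
    define G where "G = (\<lambda>z. (z, f z)) ` R"
    have \<sigma>: "\<sigma> i = 1 \<or> \<sigma> i = -1" if "i \<in> I" for i
      using \<tau>[of i] that e by (auto simp: \<sigma>_def R_def)
    have G: "(i, j) \<in> G \<longleftrightarrow> i \<in> R \<and> j = f i" for i j by (auto simp: G_def)
    have xyR: "x \<notin> R" "y \<notin> R" by (auto simp: R_def)
    have aI: "a i j = \<sigma> i * a x j * flip G i j" if "i \<in> I" "j \<in> J - {l}" for i j
    proof (cases "i \<in> R")
      case True
      then show ?thesis using az[OF True that(2)] RI[OF True] by (simp add: \<sigma>_def flip_def G)
    next
      case False
      then have "i = x \<or> i = y" using that by (auto simp: R_def)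
      then show ?thesis using near(1)[OF that(2)] False xy(3) by (auto simp: \<sigma>_def flip_def G)
    qed
    have ax: "a x j = 1 \<or> a x j = -1" if "j \<in> J" for j using pm_onD[OF pm xy(1) that] .
    define S where "S = prod \<sigma> I * prod (a x) (J - {l})"
    \<comment> \<open>The sign that column \<open>l\<close> will have in the star form of the whole
      matrix.\<close>
    define \<delta> where "\<delta> = s * S"
    have S1: "S = 1 \<or> S = -1"
    proof -
      have "\<bar>prod \<sigma> I\<bar> = 1" "\<bar>prod (a x) (J - {l})\<bar> = 1"
        by (rule abs_prod_pm; use \<sigma> ax in simp)+
      then have "\<bar>S\<bar> = 1" by (simp add: S_def abs_mult)
      then show ?thesis by linarith
    qed
    have \<delta>1: "\<delta> = 1 \<or> \<delta> = -1" using S1 s by (auto simp: \<delta>_def)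
    \<comment> \<open>The minor at \<open>m\<close> lacks row \<open>m\<close>, so its sign is the
      total sign \<open>S\<close> times \<open>\<tau> m\<close>. All terms
      \<open>a m l * P m\<close> having the sign \<open>s\<close> leaves one value for
      \<open>a m l\<close>.\<close>
    have aml: "a m l = \<tau> m * \<delta>" if m: "m \<in> R" for m
    proof -
      have "per_on (I - {m}) (J - {l}) a =
          prod \<sigma> (I - {m}) * prod (a x) (J - {l}) * dper (card (I - {m})) (card (G - {(m, f m)}))"
      proof (rule per_on_signed_flip)
        show "G - {(m, f m)} \<subseteq> (I - {m}) \<times> (J - {l})" using f by (auto simp: G_def R_def)
        show "inj_on fst (G - {(m, f m)})" by (auto simp: inj_on_def G_def)
        show "inj_on snd (G - {(m, f m)})" using finj by (auto simp: inj_on_def G_def)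
        show "card (I - {m}) = card (J - {l})" using RI[OF m] cards fin l by simp
        fix i j assume "i \<in> I - {m}" "j \<in> J - {l}"
        then show "a i j = \<sigma> i * a x j * flip (G - {(m, f m)}) i j"
          using aI[of i j] by (auto simp: flip_def)
      qed (use fin in auto)
      moreover have "card (G - {(m, f m)}) = n - 3"
      proof -
        have "card G = n - 2" using cardR by (simp add: G_def card_image inj_on_def)
        then show ?thesis using m finR by (simp add: G_def)
      qed
      moreover have "card (I - {m}) = n - 1" using RI[OF m] cards fin by simp
      moreover have "prod \<sigma> I = \<tau> m * prod \<sigma> (I - {m})"
      proof -
        have "prod \<sigma> I = \<sigma> m * prod \<sigma> (I - {m})" by (rule prod.remove) (use RI[OF m] fin in auto)
        then show ?thesis using RI[OF m] by (simp add: \<sigma>_def[of m])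
      qed
      ultimately have "\<tau> m * P m = S * C" by (simp add: P_def C_def S_def)
      then have "a m l * (S * C) = a m l * (\<tau> m * P m)" by simp
      also have "\<dots> = \<tau> m * (a m l * P m)" by (simp only: mult.left_commute)
      also have "\<dots> = \<tau> m * (s * C)" by (simp only: aPs[OF m])
      finally have "a m l * (S * C) = \<tau> m * (s * C)" .
      then have "a m l * S * C = \<tau> m * s * C" by (simp add: mult.assoc)
      then have "a m l * S = \<tau> m * s" using Cpos by simp
      then show ?thesis using S1 by (auto simp: \<delta>_def)
    qed
    \<comment> \<open>Relative to their row signs, \<open>x\<close> and \<open>y\<close> have
      opposite entries in column \<open>l\<close>; exactly one of them deviates from \<delta>, and
      this gives the last flip.\<close>
    define w where "w = (if a x l = \<delta> then y else x)"
    define t where "t j = (if j = l then \<delta> else a x j)" for j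
    show ?thesis
    proof (rule is_starI[where s = \<sigma> and t = t and F = "insert (w, l) G"])
      show "\<sigma> i = 1 \<or> \<sigma> i = -1" if "i \<in> I" for i by (rule \<sigma>[OF that])
      show "t j = 1 \<or> t j = -1" if "j \<in> J" for j using ax[OF that] \<delta>1 by (simp add: t_def)
      show "insert (w, l) G \<subseteq> I \<times> J" using f l xy by (auto simp: G_def R_def w_def)
      have wR: "w \<notin> R" using xyR by (simp add: w_def)
      have lf: "l \<noteq> f z" if "z \<in> R" for z using f[OF that] by auto
      have "card G = n - 2" using cardR by (simp add: G_def card_image inj_on_def)
      moreover have "(w, l) \<notin> G" using wR by (simp add: G)
      ultimately show "card (insert (w, l) G) = n - 1" using finR n by (simp add: G_def)
      show "inj_on fst (insert (w, l) G)" unfolding inj_on_fst_iff using wR by (simp add: G)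
      show "inj_on snd (insert (w, l) G)" unfolding inj_on_snd_iff using lf finj
        by (auto simp: G dest: inj_onD)
      fix i j assume ij: "i \<in> I" "j \<in> J"
      show "a i j = \<sigma> i * t j * flip (insert (w, l) G) i j"
      proof (cases "j = l")
        case False
        then show ?thesis using aI[of i j] ij by (simp add: t_def flip_def)
      next
        case True
        have wl: "flip (insert (w, l) G) i l = (if i = w then -1 else 1)"
          using lf by (auto simp: flip_def G)
        show ?thesis
        proof (cases "i \<in> R")
          case True
          then show ?thesis using wl aml[OF True] \<open>j = l\<close> RI[OF True] wR by (auto simp: t_def \<sigma>_def)
        next
          case False
          then have i: "i = x \<or> i = y" using ij by (auto simp: R_def)
          have "a x l = \<delta> \<or> a x l = - \<delta>" using ax[OF l] \<delta>1 by auto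
          then show ?thesis
          proof
            assume "a x l = \<delta>"
            then show ?thesis using i \<open>j = l\<close> wl near(2) xy(3) by (auto simp: t_def \<sigma>_def w_def)
          next
            assume d: "a x l = - \<delta>"
            then have "a x l \<noteq> \<delta>" using \<delta>1 by auto
            then show ?thesis using d i \<open>j = l\<close> wl near(2) xy(3) by (auto simp: t_def \<sigma>_def w_def)
          qed
        qed
      qed
    qed
  qed
  with le show ?thesis by blast
qed

section \<open>Distances between the rows of a nonsingular matrix\<close>

lemma diff_on_subset: "diff_on J a x y \<subseteq> J"
  by (auto simp: diff_on_def)

text \<open>Size \<open>n - 1\<close> means that \<open>x\<close> and the negative of
  \<open>y\<close> differ in one column, which is the case \<open>e = -1\<close>.\<close>

lemma near_rowsE:
  assumes sq: "sq n I J a" and xy: "x \<in> I" "y \<in> I"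
    and c: "card (diff_on J a x y) = 1 \<or> card (diff_on J a x y) = n - 1" and n: "n \<ge> 2"
  obtains l e where "l \<in> J" "e = 1 \<or> e = -1" "\<And>j. j \<in> J - {l} \<Longrightarrow> a y j = e * a x j" "a y l = - e * a x l"
proof -
  note fin = sqD(1,2)[OF sq] and cards = sqD(3,4)[OF sq] and pm = sqD(5)[OF sq]
  have neq: "a y j = - a x j" if "j \<in> J" "a x j \<noteq> a y j" for j
    using pm_onD[OF pm xy(1) that(1)] pm_onD[OF pm xy(2) that(1)] that(2) by auto
  show thesis
  proof (cases "card (diff_on J a x y) = 1")
    case True
    then obtain l where l: "diff_on J a x y = {l}" by (auto simp: card_1_singleton_iff)
    then have lD: "l \<in> diff_on J a x y" by simp
    then have "l \<in> J" by (simp add: diff_on_def)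
    moreover have "a y l = - a x l" by (rule neq) (use lD in \<open>simp_all add: diff_on_def\<close>)
    moreover have "a y j = a x j" if "j \<in> J - {l}" for j
    proof -
      have "j \<notin> diff_on J a x y" using that l by simp
      then show ?thesis using that by (simp add: diff_on_def)
    qed
    ultimately show thesis by (intro that[of l 1]) simp_all
  next
    case False
    with c have "card (diff_on J a x y) = n - 1" by blast
    then have "card (J - diff_on J a x y) = 1"
      using fin cards n diff_on_subset[of J a x y] by (simp add: card_Diff_subset finite_subset)
    then obtain l where l: "J - diff_on J a x y = {l}" by (auto simp: card_1_singleton_iff)
    then have lD: "l \<in> J - diff_on J a x y" by simp
    then have "l \<in> J" "a y l = a x l" by (auto simp: diff_on_def)
    moreover have "a y j = - a x j" if "j \<in> J - {l}" for j
    proof -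
      have "j \<in> diff_on J a x y" using that l by blast
      then show ?thesis by (intro neq) (simp_all add: diff_on_def)
    qed
    ultimately show thesis by (intro that[of l "-1"]) simp_all
  qed
qed

text \<open>Sizes 0 and \<open>n\<close> are those of parallel rows, one of which could be deleted
  without lowering the rank.\<close>

lemma card_diff_on_nonsingular:
  assumes sq: "sq n I J a" and rk: "rk K I J a = n" and xy: "x \<in> I" "y \<in> I" "x \<noteq> y"
  shows "0 < card (diff_on J a x y)" "card (diff_on J a x y) < n"
proof -
  note fin = sqD(1,2)[OF sq] and cards = sqD(3,4)[OF sq] and pm = sqD(5)[OF sq]
  have np: False if e: "e = 1 \<or> e = -1" and par: "\<And>j. j \<in> J \<Longrightarrow> a x j = e * a y j" for e
  proof -
    have "rk K (I - {x}) J a = rk K I J a" by (rule rk_parallel_row[OF fin(1) xy par])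
    moreover have "rk K (I - {x}) J a \<le> card (I - {x})" by (rule rk_le_card) (use fin in simp)
    moreover have "card (I - {x}) < n" using card_Diff1_less[OF fin(1) xy(1)] cards by simp
    ultimately show False using rk by simp
  qed
  have finD: "finite (diff_on J a x y)" using fin diff_on_subset finite_subset by metis
  show "0 < card (diff_on J a x y)"
  proof (rule ccontr)
    assume "\<not> ?thesis"
    then have "diff_on J a x y = {}" using finD by simp
    then have "a x j = 1 * a y j" if "j \<in> J" for j using that by (auto simp: diff_on_def)
    then show False using np[of 1] by blast
  qed
  show "card (diff_on J a x y) < n"
  proof (rule ccontr)
    assume "\<not> ?thesis"
    then have "diff_on J a x y = J"
      using card_subset_eq[OF fin(2) diff_on_subset] card_mono[OF fin(2) diff_on_subset, of a x y] cards by simp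
    then have D: "a x j \<noteq> a y j" if "j \<in> J" for j using that by (auto simp: diff_on_def)
    have "a x j = -1 * a y j" if "j \<in> J" for j
      using D[OF that] pm_onD[OF pm xy(1) that] pm_onD[OF pm xy(2) that] by auto
    then show False using np[of "-1"] by blast
  qed
qed

lemma card_2_containing:
  assumes "card S = 2" "u \<in> S"
  shows "\<exists>v. v \<noteq> u \<and> S = {u, v}"
proof -
  have "finite S" using assms(1) card.infinite by fastforce
  then have "card (S - {u}) = 1" using assms by simp
  then obtain v where "S - {u} = {v}" by (auto simp: card_1_singleton_iff)
  then have "v \<noteq> u" "S = {u, v}" using assms(2) by auto
  then show ?thesis by blast
qed

text \<open>Edges of a graph that pairwise share a vertex form a star or a triangle, and a triangle
  has only three edges.\<close>

lemma intersecting_pairs_common_point: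
  assumes "finite I" "card I \<ge> 4" "\<And>i. i \<in> I \<Longrightarrow> card (S i) = 2"
    and int: "\<And>i k. i \<in> I \<Longrightarrow> k \<in> I \<Longrightarrow> i \<noteq> k \<Longrightarrow> card (S i \<inter> S k) = 1"
  shows "\<exists>u. \<forall>i\<in>I. u \<in> S i"
proof -
  obtain B where B: "B \<subseteq> I" "card B = 2"
    using assms(2) obtain_subset_with_card_n[of 2 I] by auto
  then obtain i k where ik: "i \<in> I" "k \<in> I" "i \<noteq> k" by (auto simp: card_2_iff)
  obtain u where u: "S i \<inter> S k = {u}" using int[OF ik] by (auto simp: card_1_singleton_iff)
  obtain v where v: "S i = {u, v}" "v \<noteq> u"
    using card_2_containing[OF assms(3)[OF ik(1)], of u] u by auto
  obtain w where w: "S k = {u, w}" "w \<noteq> u"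
    using card_2_containing[OF assms(3)[OF ik(2)], of u] u by auto
  have vw: "v \<noteq> w" using u v w by auto
  have ne: "S p \<noteq> S q" "S p \<inter> S q \<noteq> {}" if "p \<in> I" "q \<in> I" "p \<noteq> q" for p q
    using int[OF that] assms(3)[OF that(1)] by auto
  \<comment> \<open>A pair missing \<open>u\<close> has to meet \<open>{u, v}\<close> and
    \<open>{u, w}\<close> in their other points, so it closes the triangle.\<close>
  have out: "S m = {v, w}" if m: "m \<in> I" "u \<notin> S m" for m
  proof -
    have "m \<noteq> i" "m \<noteq> k" using m v w by auto
    then have "v \<in> S m" "w \<in> S m" using ne(2)[OF m(1) ik(1)] ne(2)[OF m(1) ik(2)] m(2) v w by auto
    moreover have "finite (S m)" using assms(3)[OF m(1)] card.infinite by fastforce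
    ultimately show ?thesis using assms(3)[OF m(1)] vw card_subset_eq[of "S m" "{v, w}"] by auto
  qed
  have "u \<in> S m" if m: "m \<in> I" for m
  proof (rule ccontr)
    assume um: "u \<notin> S m"
    have Sm: "S m = {v, w}" by (rule out[OF m um])
    \<comment> \<open>A fourth pair would contain \<open>u\<close>, being different from
      \<open>{v, w}\<close>, and meet \<open>{v, w}\<close>; so it would repeat one of the first two
      pairs.\<close>
    have "card {i, k, m} \<le> 3" by (simp add: card_insert_if)
    then have "\<not> I \<subseteq> {i, k, m}" using assms(2) card_mono[of "{i, k, m}" I] by auto
    then obtain p where p: "p \<in> I" "p \<noteq> i" "p \<noteq> k" "p \<noteq> m" by auto
    have "u \<in> S p"
      using out[OF p(1)] ne(1)[OF p(1) m p(4)] Sm by auto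
    moreover have "v \<in> S p \<or> w \<in> S p" using ne(2)[OF p(1) m p(4)] Sm by auto
    moreover have "finite (S p)" using assms(3)[OF p(1)] card.infinite by fastforce
    ultimately have "S p = {u, v} \<or> S p = {u, w}"
      using assms(3)[OF p(1)] card_subset_eq[of "S p" "{u, v}"] card_subset_eq[of "S p" "{u, w}"] v(2) w(2) by auto
    then show False using ne(1)[OF p(1) ik(1) p(2)] ne(1)[OF p(1) ik(2) p(3)] v w by auto
  qed
  then show ?thesis by blast
qed

text \<open>Up to sign, each row differs from the row \<open>o'\<close> in a pair of columns, and
  these pairs have a common point \<open>u\<close>. Negating column \<open>u\<close> leaves one flip
  in each row, that of \<open>o'\<close> being at \<open>u\<close>.\<close>

lemma distance_2_star:
  assumes sq: "sq n I J a" and n: "n = 4 \<or> n = 5 \<or> n \<ge> 7"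
    and two: "\<And>x y. x \<in> I \<Longrightarrow> y \<in> I \<Longrightarrow> x \<noteq> y \<Longrightarrow>
      card (diff_on J a x y) = 2 \<or> card (diff_on J a x y) = n - 2"
  shows "is_star I J n a"
proof -
  note fin = sqD(1,2)[OF sq] and cards = sqD(3,4)[OF sq] and pm = sqD(5)[OF sq]
  have "I \<noteq> {}" "J \<noteq> {}" using cards n by auto
  then obtain o' l where o: "o' \<in> I" and l: "l \<in> J" by auto
  define I' where "I' = I - {o'}"
  have finI': "finite I'" "card I' = n - 1" using fin cards o by (auto simp: I'_def)
  \<comment> \<open>For \<open>n = 4\<close> the sizes 2 and \<open>n - 2\<close> coincide, so the
    sign of the row is free. It is chosen to put the fixed column \<open>l\<close> into every pair,
    since three pairs alone could form a triangle.\<close>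
  have ex: "\<exists>q. (fst q = 1 \<or> fst q = -1) \<and> snd q \<subseteq> J \<and> card (snd q) = 2 \<and> (n = 4 \<longrightarrow> l \<in> snd q) \<and>
      (\<forall>j\<in>J. a i j = fst q * a o' j * (if j \<in> snd q then -1 else 1))" if i: "i \<in> I'" for i
  proof -
    have i': "i \<in> I" "i \<noteq> o'" using i by (auto simp: I'_def)
    define D where "D = diff_on J a o' i"
    have DJ: "D \<subseteq> J" unfolding D_def by (rule diff_on_subset)
    have aD: "a i j = a o' j * (if j \<in> D then -1 else 1)" if "j \<in> J" for j
      using pm_onD[OF pm o that] pm_onD[OF pm i'(1) that] that by (auto simp: D_def diff_on_def)
    have cD: "card D = 2 \<or> card D = n - 2" unfolding D_def by (rule two) (use o i' in auto)
    have cDc: "card (J - D) = n - card D" using fin cards DJ by (simp add: card_Diff_subset finite_subset)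
    show ?thesis
    proof (cases "card D = 2 \<and> (n = 4 \<longrightarrow> l \<in> D)")
      case True
      then show ?thesis using DJ aD by (intro exI[of _ "(1, D)"]) simp
    next
      case False
      then have "card (J - D) = 2" "n = 4 \<longrightarrow> l \<in> J - D" using cD cDc n l by auto
      moreover have "a i j = - a o' j * (if j \<in> J - D then -1 else 1)" if "j \<in> J" for j
        using aD[OF that] that by simp
      ultimately show ?thesis by (intro exI[of _ "(-1, J - D)"]) simp
    qed
  qed
  then have "\<forall>i\<in>I'. \<exists>q. (fst q = 1 \<or> fst q = -1) \<and> snd q \<subseteq> J \<and> card (snd q) = 2 \<and> (n = 4 \<longrightarrow> l \<in> snd q) \<and>
      (\<forall>j\<in>J. a i j = fst q * a o' j * (if j \<in> snd q then -1 else 1))" by (intro ballI)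
  from bchoice[OF this] obtain h where h: "\<forall>i\<in>I'. (fst (h i) = 1 \<or> fst (h i) = -1) \<and> snd (h i) \<subseteq> J \<and>
      card (snd (h i)) = 2 \<and> (n = 4 \<longrightarrow> l \<in> snd (h i)) \<and>
      (\<forall>j\<in>J. a i j = fst (h i) * a o' j * (if j \<in> snd (h i) then -1 else 1))" ..
  define \<sigma> S where "\<sigma> i = fst (h i)" and "S i = snd (h i)" for i
  have \<sigma>: "\<sigma> i = 1 \<or> \<sigma> i = -1" and SJ: "S i \<subseteq> J" and S2: "card (S i) = 2" and S4: "n = 4 \<Longrightarrow> l \<in> S i"
    and aS: "\<And>j. j \<in> J \<Longrightarrow> a i j = \<sigma> i * a o' j * (if j \<in> S i then -1 else 1)" if "i \<in> I'" for i
    using bspec[OF h that] by (simp_all add: \<sigma>_def S_def)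
  have ao: "a o' j = 1 \<or> a o' j = -1" if "j \<in> J" for j by (rule pm_onD[OF pm o that])
  have finS: "finite (S i)" if "i \<in> I'" for i using SJ[OF that] fin finite_subset by blast
  \<comment> \<open>The symmetric difference \<open>X\<close> of two pairs has size 4, 2 or 0, and
    must have size 2 or \<open>n - 2\<close>. Disjoint pairs give 4, which is \<open>n - 2\<close>
    exactly for the excluded order 6.\<close>
  have int: "card (S i \<inter> S k) = 1" if ik: "i \<in> I'" "k \<in> I'" "i \<noteq> k" for i k
  proof -
    define X where "X = (S i - S k) \<union> (S k - S i)"
    have XJ: "X \<subseteq> J" using SJ ik by (auto simp: X_def)
    have cX: "card X = 4 - 2 * card (S i \<inter> S k)"
    proof -
      have "card X = card (S i - S k) + card (S k - S i)"
        unfolding X_def by (rule card_Un_disjoint) (use finS ik in auto)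
      moreover have "card (S i - S k) = 2 - card (S i \<inter> S k)" "card (S k - S i) = 2 - card (S i \<inter> S k)"
        using S2[OF ik(1)] S2[OF ik(2)] finS[OF ik(1)] finS[OF ik(2)]
        by (simp_all add: card_Diff_subset_Int Int_commute)
      ultimately show ?thesis by simp
    qed
    have "card X = 2 \<or> card X = n - 2"
    proof (cases "\<sigma> i = \<sigma> k")
      case True
      have "a i j \<noteq> a k j \<longleftrightarrow> j \<in> X" if j: "j \<in> J" for j
        unfolding aS[OF ik(1) j] aS[OF ik(2) j] True X_def using \<sigma>[OF ik(2)] ao[OF j] by (elim disjE) simp_all
      then have "diff_on J a i k = X" using XJ unfolding diff_on_def by blast
      then show ?thesis using two[of i k] ik by (auto simp: I'_def)
    next
      case False
      then have neg: "\<sigma> i = - \<sigma> k" using \<sigma>[OF ik(1)] \<sigma>[OF ik(2)] by auto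
      have "a i j \<noteq> a k j \<longleftrightarrow> j \<notin> X" if j: "j \<in> J" for j
        unfolding aS[OF ik(1) j] aS[OF ik(2) j] neg X_def using \<sigma>[OF ik(2)] ao[OF j] by (elim disjE) simp_all
      then have "diff_on J a i k = J - X" unfolding diff_on_def by blast
      moreover have "card (J - X) = n - card X" "card X \<le> n"
        using XJ fin cards card_mono[OF fin(2) XJ] by (simp_all add: card_Diff_subset finite_subset)
      moreover have "card (diff_on J a i k) = 2 \<or> card (diff_on J a i k) = n - 2"
        using two[of i k] ik by (auto simp: I'_def)
      ultimately show ?thesis using n by auto
    qed
    moreover have "card (S i \<inter> S k) \<le> 2"
      using card_mono[OF finS[OF ik(1)], of "S i \<inter> S k"] S2[OF ik(1)] by simp
    ultimately show ?thesis using cX n by linarith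
  qed
  have "\<exists>u. \<forall>i\<in>I'. u \<in> S i"
  proof (cases "n = 4")
    case True
    then show ?thesis using S4 by blast
  next
    case False
    then show ?thesis using n finI' int S2 by (intro intersecting_pairs_common_point) auto
  qed
  then obtain u where u: "\<And>i. i \<in> I' \<Longrightarrow> u \<in> S i" by blast
  have "\<forall>i\<in>I'. \<exists>f. f \<noteq> u \<and> S i = {u, f}"
  proof
    fix i assume i: "i \<in> I'"
    show "\<exists>f. f \<noteq> u \<and> S i = {u, f}" by (rule card_2_containing[OF S2[OF i] u[OF i]])
  qed
  from bchoice[OF this] obtain f where f': "\<forall>i\<in>I'. f i \<noteq> u \<and> S i = {u, f i}" ..
  have f: "f i \<noteq> u" "S i = {u, f i}" "f i \<in> J" if "i \<in> I'" for i
    using bspec[OF f' that] SJ[OF that] by auto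
  have finj: "inj_on f I'"
  proof (rule inj_onI, rule ccontr)
    fix i k assume *: "i \<in> I'" "k \<in> I'" "f i = f k" "i \<noteq> k"
    then have "S i = S k" using f(2) by simp
    then show False using int[OF *(1,2,4)] S2[OF *(2)] by simp
  qed
  have "I' \<noteq> {}" using finI' n by auto
  then have uJ: "u \<in> J" using u SJ by blast
  define F where "F = insert (o', u) ((\<lambda>i. (i, f i)) ` I')"
  have F: "(i, j) \<in> F \<longleftrightarrow> (i = o' \<and> j = u) \<or> (i \<in> I' \<and> j = f i)" for i j
    by (auto simp: F_def)
  have oI': "o' \<notin> I'" by (simp add: I'_def)
  define s where "s i = (if i = o' then 1 else \<sigma> i)" for i
  define t where "t j = a o' j * (if j = u then -1 else 1)" for j
  show ?thesis
  proof (rule is_starI[where s = s and t = t and F = F])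
    show "s i = 1 \<or> s i = -1" if "i \<in> I" for i using \<sigma>[of i] that by (auto simp: s_def I'_def)
    show "t j = 1 \<or> t j = -1" if "j \<in> J" for j using ao[OF that] by (auto simp: t_def)
    show "F \<subseteq> I \<times> J" using f(3) o uJ by (auto simp: F_def I'_def)
    have "card ((\<lambda>i. (i, f i)) ` I') = n - 1" using finI' by (simp add: card_image inj_on_def)
    moreover have "(o', u) \<notin> (\<lambda>i. (i, f i)) ` I'" using oI' by auto
    moreover have "n \<ge> 1" using n by auto
    ultimately show "card F = n" using finI' by (simp add: F_def)
    show "inj_on fst F" unfolding inj_on_fst_iff using oI' by (auto simp: F)
    show "inj_on snd F" unfolding inj_on_snd_iff using f(1) finj by (auto simp: F dest: inj_onD)
    fix i j assume ij: "i \<in> I" "j \<in> J"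
    show "a i j = s i * t j * flip F i j"
    proof (cases "i = o'")
      case True
      then show ?thesis using oI' by (simp add: s_def t_def flip_def F)
    next
      case False
      then have i: "i \<in> I'" using ij by (simp add: I'_def)
      show ?thesis using aS[OF i ij(2)] f(1,2)[OF i] False i by (simp add: s_def t_def flip_def F)
    qed
  qed
qed

text \<open>Deleting two rows and two columns costs at most 4 of the rank, so every minor has rank
  at least \<open>Suc (n - 5)\<close> and is bounded by \<open>dper (n - 2) (n - 5)\<close>. As
  \<open>n - 2 \<ge> 5\<close>, the exception of order 4 does not interfere.\<close>

lemma distance_3_bound:
  fixes I J :: "nat set"
  assumes sq: "sq n I J a" and n: "n \<ge> 7" and rk: "rk K I J a = n"
    and IH: "\<And>r. kraeuter K (n - 2) r"
    and xy: "x \<in> I" "y \<in> I" "x \<noteq> y"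
    and d: "3 \<le> card (diff_on J a x y)" "card (diff_on J a x y) \<le> n - 3"
  shows "\<bar>per_on I J a\<bar> < dper n (n - 1)"
proof -
  note fin = sqD(1,2)[OF sq] and cards = sqD(3,4)[OF sq] and pm = sqD(5)[OF sq]
  define D where "D = diff_on J a x y"
  define s where "s = card D"
  have DJ: "D \<subseteq> J" unfolding D_def by (rule diff_on_subset)
  have minor: "\<bar>per_on (I - {x, y}) (J - {j, l}) a\<bar> \<le> dper (n - 2) (n - 5)" if jl: "(j, l) \<in> same_class J D" for j l
  proof -
    have jl': "j \<in> J" "l \<in> J" "j \<noteq> l" using jl by (auto simp: same_class_def)
    have I2: "I - {x} - {y} = I - {x, y}" "J - {j} - {l} = J - {j, l}" by auto
    have "sq (n - 1 - 1) (I - {x} - {y}) (J - {j} - {l}) a"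
      by (intro sq_minor sq) (use xy jl' in auto)
    then have sq2: "sq (n - 2) (I - {x, y}) (J - {j, l}) a" by (simp add: I2 numeral_2_eq_2)
    have "n \<le> Suc (rk K (I - {x}) J a)" using rk_remove_row(2)[OF fin(1), of K J a x] rk by simp
    moreover have "rk K (I - {x}) J a \<le> Suc (rk K (I - {x, y}) J a)"
      using rk_remove_row(2)[of "I - {x}" K J a y] fin by (simp add: I2)
    moreover have "rk K (I - {x, y}) J a \<le> Suc (rk K (I - {x, y}) (J - {j}) a)"
      by (rule rk_remove_col(2)) (use fin in auto)
    moreover have "rk K (I - {x, y}) (J - {j}) a \<le> Suc (rk K (I - {x, y}) (J - {j, l}) a)"
      using rk_remove_col(2)[of "I - {x, y}" "J - {j}" K a l] fin by (simp add: I2)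
    ultimately have lo: "n - 4 \<le> rk K (I - {x, y}) (J - {j, l}) a" by simp
    have hi: "rk K (I - {x, y}) (J - {j, l}) a \<le> n - 2"
      using rk_le_card[OF sqD(1)[OF sq2], of K "J - {j, l}" a] sqD(3)[OF sq2] by simp
    define r where "r = rk K (I - {x, y}) (J - {j, l}) a - 1"
    have r: "rk K (I - {x, y}) (J - {j, l}) a = Suc r" "n - 5 \<le> r" "r < n - 2"
      using lo hi n by (auto simp: r_def)
    have "\<bar>per_on (I - {x, y}) (J - {j, l}) a\<bar> \<le> dper (n - 2) r"
      by (rule kraeuterD(1)[OF IH sq2 r(1)]) (use n in auto)
    also have "\<dots> \<le> dper (n - 2) (n - 5)" by (rule dper_antimono) (use r in auto)
    finally show ?thesis .
  qed
  have fs: "finite (same_class J D)"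
    by (rule finite_subset[of _ "J \<times> J"]) (use fin in \<open>auto simp: same_class_def\<close>)
  have "\<bar>per_on I J a\<bar> \<le> (\<Sum>(j, l)\<in>same_class J D. \<bar>per_on (I - {x, y}) (J - {j, l}) a\<bar>)"
    unfolding D_def by (rule abs_per_on_le_same_class[OF fin xy pm])
  also have "\<dots> \<le> (\<Sum>p\<in>same_class J D. dper (n - 2) (n - 5))"
    by (rule sum_mono) (use minor in auto)
  also have "\<dots> = int (card (same_class J D)) * dper (n - 2) (n - 5)" by simp
  also have "\<dots> \<le> (6 + (int (n - 2) - 1) * (int (n - 2) - 2)) * dper (n - 2) (n - 5)"
  proof (rule mult_right_mono)
    have "int (card (same_class J D)) = int s * (int s - 1) + (int n - int s) * (int n - int s - 1)"
      using card_same_class[OF fin(2) DJ] cards by (simp add: s_def)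
    \<comment> \<open>The number of surviving column pairs is convex in the distance
      \<open>s\<close>, so on the range from 3 to \<open>n - 3\<close> it is largest at the
      ends.\<close>
    moreover have "(int s - 3) * (int n - 3 - int s) \<ge> 0"
      using d n by (intro mult_nonneg_nonneg) (auto simp: s_def D_def)
    ultimately show "int (card (same_class J D)) \<le> 6 + (int (n - 2) - 1) * (int (n - 2) - 2)"
      using n by (simp add: of_nat_diff algebra_simps)
    show "0 \<le> dper (n - 2) (n - 5)" by (rule dper_nonneg) (use n in auto)
  qed
  also have "\<dots> < dper n (n - 1)"
  proof -
    have "n - 2 - 3 = n - 5" "n - 2 + 2 = n" "n - 2 + 1 = n - 1" using n by simp_all
    then show ?thesis using dper_distance_3_bound[of "n - 2"] n by simp
  qed
  finally show ?thesis .
qed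

lemma sign_cancel2:
  assumes "s * s = (1 :: int)"
  shows "u * s * (s * v) = u * v" "u * s * (- s * v) = - u * v"
proof -
  have "u * s * (s * v) = s * s * (u * v)" by (simp only: ac_simps)
  then show "u * s * (s * v) = u * v" by (simp add: assms)
  then show "u * s * (- s * v) = - u * v" by simp
qed

lemma obtain_two_elements:
  assumes "card I \<ge> 2"
  obtains x y where "x \<in> I" "y \<in> I" "x \<noteq> y"
proof -
  from assms obtain B where B: "B \<subseteq> I" "card B = 2" by (rule obtain_subset_with_card_n)
  from B(2) obtain x y where "B = {x, y}" "x \<noteq> y" unfolding card_2_iff by (elim exE conjE) (rule that)
  then show thesis using B(1) by (intro that[of x y]) simp_all
qed

text \<open>A minor of order 4 and rank at least 2 exceeds 8 only if its rank is 2, when it may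
  reach 12; D(4,4) itself gives 8. Rank 2 requires both deleted columns to be coloops of the four
  rows \<open>R\<close>. There are at most two coloops, so at most two ordered pairs are large, and
  8 * 14 + 4 * 2 = 120 is below 128.\<close>

lemma order_6_bound:
  fixes I J :: "nat set"
  assumes sq: "sq 6 I J a" and rk: "rk K I J a = 6"
    and IH: "\<And>r. kraeuter K 4 r"
    and rows: "\<And>x y. x \<in> I \<Longrightarrow> y \<in> I \<Longrightarrow> x \<noteq> y \<Longrightarrow>
      2 \<le> card (diff_on J a x y) \<and> card (diff_on J a x y) \<le> 4"
    and cols: "\<And>p q. p \<in> J \<Longrightarrow> q \<in> J \<Longrightarrow> p \<noteq> q \<Longrightarrow>
      2 \<le> card (diff_on I (\<lambda>j i. a i j) p q) \<and> card (diff_on I (\<lambda>j i. a i j) p q) \<le> 4"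
  shows "\<bar>per_on I J a\<bar> < dper 6 5"
proof -
  note fin = sqD(1,2)[OF sq] and cards = sqD(3,4)[OF sq] and pm = sqD(5)[OF sq]
  obtain x y where xy: "x \<in> I" "y \<in> I" "x \<noteq> y"
    by (rule obtain_two_elements[of I]) (use cards in simp)
  define R where "R = I - {x, y}"
  define T where "T = {j \<in> J. rk K R (J - {j}) a < rk K R J a}"
  define D where "D = diff_on J a x y"
  have R: "I - {x} - {y} = R" "finite R" "R \<subseteq> I" "card R = 4"
    using fin cards xy by (auto simp: R_def card_Diff_subset)
  have DJ: "D \<subseteq> J" unfolding D_def by (rule diff_on_subset)
  have TJ: "T \<subseteq> J" and finT: "finite T" using fin by (auto simp: T_def)
  have "6 \<le> Suc (rk K (I - {x}) J a)" using rk_remove_row(2)[OF fin(1), of K J a x] rk by simp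
  moreover have "rk K (I - {x}) J a \<le> Suc (rk K R J a)"
    using rk_remove_row(2)[of "I - {x}" K J a y] fin by (simp add: R)
  moreover have "rk K R J a \<le> 4" using rk_le_card[OF R(2), of K J a] R by simp
  ultimately have rkR: "rk K R J a = 4" by simp
  have pmR: "pm_on R (J - T) a" by (rule pm_on_subset[OF pm R(3)]) simp
  have cT: "card T + rk K R (J - T) a = 4"
    using rk_essential_cols[OF R(2) fin(2) TJ, of K a] rkR by (simp add: T_def)
  have cJT: "card (J - T) = 6 - card T" using TJ fin cards by (simp add: card_Diff_subset finT)
  \<comment> \<open>A third coloop would leave three columns that are pairwise parallel on
    \<open>R\<close>, and the minimal distance of columns excludes this.\<close>
  have "card T \<le> 2"
  proof (rule ccontr)
    assume "\<not> card T \<le> 2"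
    moreover have "rk K R (J - T) a \<ge> 1"
    proof -
      have "card (J - T) \<noteq> 0" "card R \<noteq> 0" using cJT cT R(4) by simp_all
      then have "J - T \<noteq> {}" "R \<noteq> {}" by (metis card.empty)+
      then obtain i j where "i \<in> R" "j \<in> J - T" by auto
      then show ?thesis by (rule rk_pos[OF R(2) _ _ pmR])
    qed
    ultimately have c3: "card T = 3" and r1: "rk K R (J - T) a = 1" using cT by auto
    have par: "\<exists>e. (e = 1 \<or> e = -1) \<and> (\<forall>i\<in>R. a i q = e * a i p)" if "p \<in> J - T" "q \<in> J - T" for p q
    proof -
      have "rk K (J - T) R (\<lambda>j i. a i j) = 1"
        using rk_transpose[OF R(2), of "J - T" K a] fin r1 by simp
      then show ?thesis
        using rk_1_parallel_row[of "J - T" K R "\<lambda>j i. a i j" p q] that fin pm_on_transpose[OF pmR] by simp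
    qed
    \<comment> \<open>If the parallelism of \<open>p\<close> and \<open>q\<close> on
      \<open>R\<close> extended to \<open>x\<close> or to \<open>y\<close>, these columns would have
      distance at most 1 up to sign, contrary to \<open>cols\<close>. So it is violated in both
      rows.\<close>
    have opp: "a x q = - e * a x p \<and> a y q = - e * a y p"
      if p: "p \<in> J" and q: "q \<in> J" and pq: "p \<noteq> q" and e: "e = 1 \<or> e = -1" and Re: "\<forall>i\<in>R. a i q = e * a i p" for p q e
    proof (rule ccontr)
      assume no: "\<not> ?thesis"
      have sgn: "a x p = 1 \<or> a x p = -1" "a x q = 1 \<or> a x q = -1" "a y p = 1 \<or> a y p = -1" "a y q = 1 \<or> a y q = -1"
        using pm_onD[OF pm] xy p q by simp_all
      define E where "E = {i \<in> I. a i q \<noteq> e * a i p}"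
      have "E \<subseteq> {x, y}" using Re unfolding E_def R_def by auto
      moreover have "x \<notin> E \<or> y \<notin> E"
        using no sgn e by (auto simp: E_def)
      ultimately have "E \<subseteq> {x} \<or> E \<subseteq> {y}" by blast
      then have cE: "card E \<le> 1" using card_mono[of "{x}" E] card_mono[of "{y}" E] by fastforce
      have EI: "E \<subseteq> I" by (auto simp: E_def)
      from e show False
      proof
        assume "e = 1"
        then have "diff_on I (\<lambda>j i. a i j) p q = E" by (auto simp: diff_on_def E_def)
        then show False using cols[OF p q pq] cE by simp
      next
        assume e: "e = -1"
        have "a i p \<noteq> a i q \<longleftrightarrow> i \<notin> E" if i: "i \<in> I" for i
        proof -
          have "i \<in> E \<longleftrightarrow> a i q \<noteq> - a i p" using i by (simp add: E_def e)
          then show ?thesis using pm_onD[OF pm i p] pm_onD[OF pm i q] by (elim disjE) simp_all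
        qed
        then have "diff_on I (\<lambda>j i. a i j) p q = I - E" by (auto simp: diff_on_def)
        moreover have "card (I - E) = 6 - card E"
          using EI fin cards by (simp add: card_Diff_subset finite_subset)
        ultimately have "card (diff_on I (\<lambda>j i. a i j) p q) = 6 - card E" by simp
        then show False using cols[OF p q pq] cE by linarith
      qed
    qed
    have "card (J - T) = 3" using cJT c3 by simp
    then obtain p q w where pqw: "J - T = {p, q, w}" "p \<noteq> q" "p \<noteq> w" "q \<noteq> w"
      unfolding card_3_iff by (elim exE conjE) (rule that; simp)
    have JT: "p \<in> J - T" "q \<in> J - T" "w \<in> J - T" unfolding pqw(1) by simp_all
    then have J3: "p \<in> J" "q \<in> J" "w \<in> J" by simp_all
    obtain e where e: "e = 1 \<or> e = -1" "\<forall>i\<in>R. a i q = e * a i p"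
      using par[OF JT(1,2)] by (elim exE conjE) (rule that)
    obtain e' where e': "e' = 1 \<or> e' = -1" "\<forall>i\<in>R. a i w = e' * a i p"
      using par[OF JT(1,3)] by (elim exE conjE) (rule that)
    have opq: "a x q = - e * a x p" "a y q = - e * a y p"
      using opp[OF J3(1,2) pqw(2) e] by simp_all
    have opw: "a x w = - e' * a x p" "a y w = - e' * a y p"
      using opp[OF J3(1,3) pqw(3) e'] by simp_all
    have ee: "e * e = 1" using e(1) by auto
    have c1: "e' * e = 1 \<or> e' * e = -1" using e(1) e'(1) by auto
    have Rqw: "\<forall>i\<in>R. a i w = (e' * e) * a i q"
    proof
      fix i assume i: "i \<in> R"
      show "a i w = (e' * e) * a i q"
        unfolding bspec[OF e(2) i] bspec[OF e'(2) i] by (rule sign_cancel2(1)[OF ee, symmetric])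
    qed
    \<comment> \<open>Going from \<open>q\<close> to \<open>w\<close> by way of \<open>p\<close>
      reverses the sign twice, the direct comparison only once.\<close>
    have "a x w = (e' * e) * a x q" unfolding opq opw by (rule sign_cancel2(2)[OF ee, symmetric])
    moreover have "a x w = - (e' * e) * a x q" using opp[OF J3(2,3) pqw(4) c1 Rqw] by simp
    ultimately have "(e' * e) * a x q = 0" by simp
    then show False using c1 pm_onD[OF pm xy(1) J3(2)] by auto
  qed
  \<comment> \<open>12 is \<open>dper 4 1\<close>, the bound in rank 2; 8 is the common value of
    \<open>dper 4 2\<close> and \<open>dper 4 4\<close>, covering ranks 3 and 4.\<close>
  define g where "g j l = (if j \<in> T \<and> l \<in> T then 12 else 8 :: int)" for j l
  have minor: "\<bar>per_on R (J - {j, l}) a\<bar> \<le> g j l" if jl: "(j, l) \<in> same_class J D" for j l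
  proof -
    have jl': "j \<in> J" "l \<in> J" "j \<noteq> l" using jl by (auto simp: same_class_def)
    have J2: "J - {j} - {l} = J - {j, l}" "J - {l} - {j} = J - {j, l}" by auto
    have "sq (6 - 1 - 1) (I - {x} - {y}) (J - {j} - {l}) a"
      by (intro sq_minor sq) (use xy jl' in auto)
    then have sq4: "sq 4 R (J - {j, l}) a" by (simp add: J2 R)
    have st: "rk K R J a \<le> Suc (rk K R (J - {j}) a)" "rk K R (J - {j}) a \<le> Suc (rk K R (J - {j, l}) a)"
      "rk K R (J - {l}) a \<le> Suc (rk K R (J - {j, l}) a)"
      using rk_remove_col(2)[OF R(2) fin(2), of K a j] rk_remove_col(2)[OF R(2), of "J - {j}" K a l]
        rk_remove_col(2)[OF R(2), of "J - {l}" K a j] fin by (simp_all add: J2)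
    have hi: "rk K R (J - {j, l}) a \<le> 4"
      using rk_le_card[OF R(2), of K "J - {j, l}" a] R by simp
    have lo: "2 \<le> rk K R (J - {j, l}) a" using st(1,2) rkR by linarith
    then have "rk K R (J - {j, l}) a = Suc 1 \<or> rk K R (J - {j, l}) a = Suc 2 \<or> rk K R (J - {j, l}) a = Suc 3"
      using hi by arith
    then show ?thesis
    proof (elim disjE)
      assume 1: "rk K R (J - {j, l}) a = Suc 1"
      then have "j \<in> T" "l \<in> T" using st rkR jl' by (auto simp: T_def)
      then show ?thesis using kraeuterD(1)[OF IH sq4 1] unfolding dper_4_1 by (simp add: g_def)
    next
      assume 2: "rk K R (J - {j, l}) a = Suc 2"
      have "\<bar>per_on R (J - {j, l}) a\<bar> \<le> 8" using kraeuterD(1)[OF IH sq4 2] unfolding dper_4_2 by simp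
      then show ?thesis by (simp add: g_def)
    next
      assume 3: "rk K R (J - {j, l}) a = Suc 3"
      have "\<bar>per_on R (J - {j, l}) a\<bar> \<le> dper 4 3 \<or> is_star R (J - {j, l}) 4 a"
        by (rule kraeuterD(2)[OF IH sq4 3]) simp
      then have "\<bar>per_on R (J - {j, l}) a\<bar> \<le> 8"
      proof
        assume "is_star R (J - {j, l}) 4 a"
        then have "\<bar>per_on R (J - {j, l}) a\<bar> = \<bar>dper 4 4\<bar>"
          using abs_per_on_star[of R "J - {j, l}" 4 a] sqD[OF sq4] by simp
        then show ?thesis unfolding dper_4_4 by simp
      qed (simp only: dper_4_3)
      then show ?thesis by (simp add: g_def)
    qed
  qed
  have fs: "finite (same_class J D)"
    by (rule finite_subset[of _ "J \<times> J"]) (use fin in \<open>auto simp: same_class_def\<close>)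
  have "\<bar>per_on I J a\<bar> \<le> (\<Sum>(j, l)\<in>same_class J D. \<bar>per_on R (J - {j, l}) a\<bar>)"
    unfolding D_def R_def by (rule abs_per_on_le_same_class[OF fin xy pm])
  also have "\<dots> \<le> (\<Sum>(j, l)\<in>same_class J D. g j l)"
    by (rule sum_mono) (use minor in auto)
  also have "\<dots> = (\<Sum>p\<in>same_class J D. 8 + (if p \<in> T \<times> T then 4 else 0))"
    by (rule sum.cong) (auto simp: g_def split: if_splits)
  also have "\<dots> = 8 * int (card (same_class J D)) + 4 * int (card (same_class J D \<inter> T \<times> T))"
    using fs by (simp add: sum.distrib sum.inter_restrict[symmetric])
  \<comment> \<open>At distance 2 or 4 there are 2 * 1 + 4 * 3 = 14 surviving ordered pairs, at
    distance 3 only 12.\<close>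
  also have "\<dots> \<le> 8 * 14 + 4 * 2"
  proof (intro add_mono mult_left_mono)
    have "card D = 2 \<or> card D = 3 \<or> card D = 4" using rows[OF xy] by (auto simp: D_def)
    then show "int (card (same_class J D)) \<le> 14"
      using card_same_class[OF fin(2) DJ] cards by auto
    have "same_class J D \<inter> T \<times> T \<subseteq> same_class T T" by (auto simp: same_class_def)
    moreover have "finite (same_class T T)"
      by (rule finite_subset[of _ "T \<times> T"]) (use finT in \<open>auto simp: same_class_def\<close>)
    ultimately have "card (same_class J D \<inter> T \<times> T) \<le> card (same_class T T)" by (rule card_mono[rotated])
    moreover have "int (card (same_class T T)) \<le> 2"
    proof -
      have "card T = 0 \<or> card T = 1 \<or> card T = 2" using \<open>card T \<le> 2\<close> by auto
      then show ?thesis using card_same_class[OF finT subset_refl] by auto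
    qed
    ultimately show "int (card (same_class J D \<inter> T \<times> T)) \<le> 2" by linarith
  qed simp_all
  finally show ?thesis by (simp add: dper_6_5)
qed

text \<open>Close columns are handled by transposing. Once close rows and columns are excluded, the
  bound is strict except in order 4, where only D(4,4) is left.\<close>

lemma kraeuter_nonsingular:
  fixes I J :: "nat set"
  assumes sq: "sq n I J a" and n: "n \<ge> 3" and rk: "rk K I J a = n"
    and IH: "\<And>m r. 1 \<le> m \<Longrightarrow> m < n \<Longrightarrow> kraeuter K m r"
  shows "(n \<noteq> 4 \<longrightarrow> \<bar>per_on I J a\<bar> \<le> dper n (n - 1)) \<and>
    (n = 4 \<longrightarrow> \<bar>per_on I J a\<bar> \<le> dper 4 3 \<or> is_star I J 4 a) \<and>
    (\<bar>per_on I J a\<bar> = dper n (n - 1) \<longrightarrow> is_star I J (n - 1) a)"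
proof -
  note fin = sqD(1,2)[OF sq] and cards = sqD(3,4)[OF sq] and pm = sqD(5)[OF sq]
  let ?at = "\<lambda>j i. a i j"
  have sqt: "sq n J I ?at" by (rule sq_transpose[OF sq])
  have rkt: "rk K J I ?at = n" using rk_transpose[OF fin, of K a] rk by simp
  have IHn: "kraeuter K (n - 1) (n - 3)" by (rule IH) (use n in auto)
  have near: "(n \<noteq> 4 \<longrightarrow> \<bar>per_on A B b\<bar> \<le> dper n (n - 1)) \<and>
    (n = 4 \<longrightarrow> \<bar>per_on A B b\<bar> \<le> dper 4 3 \<or> is_star A B 4 b) \<and>
    (\<bar>per_on A B b\<bar> = dper n (n - 1) \<longrightarrow> is_star A B (n - 1) b)"
    if sqb: "sq n A B b" and rkb: "rk K A B b = n" and xy: "x \<in> A" "y \<in> A" "x \<noteq> y"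
      and c: "card (diff_on B b x y) = 1 \<or> card (diff_on B b x y) = n - 1" for A B :: "nat set" and b x y
  proof -
    have n2: "n \<ge> 2" using n by simp
    obtain l e where le: "l \<in> B" "e = 1 \<or> e = -1"
      "\<And>j. j \<in> B - {l} \<Longrightarrow> b y j = e * b x j" "b y l = - e * b x l"
      by (rule near_rowsE[OF sqb xy(1,2) c n2]) (rule that)
    have "\<bar>per_on A B b\<bar> \<le> dper n (n - 1) \<and> (\<bar>per_on A B b\<bar> = dper n (n - 1) \<longrightarrow> is_star A B (n - 1) b)"
      by (rule near_rows_star[OF sqb n rkb IHn xy le])
    then show ?thesis by auto
  qed
  show ?thesis
  proof (cases "\<exists>x y. x \<in> I \<and> y \<in> I \<and> x \<noteq> y \<and> (card (diff_on J a x y) = 1 \<or> card (diff_on J a x y) = n - 1)")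
    case True
    then show ?thesis by (elim exE conjE) (rule near[OF sq rk])
  next
    case no_rows: False
    show ?thesis
    proof (cases "\<exists>x y. x \<in> J \<and> y \<in> J \<and> x \<noteq> y \<and> (card (diff_on I ?at x y) = 1 \<or> card (diff_on I ?at x y) = n - 1)")
      case True
      have p: "per_on J I ?at = per_on I J a" by (rule per_on_transpose[OF fin])
      have s: "is_star J I m ?at \<Longrightarrow> is_star I J m a" for m
        using is_star_transpose[of J I m ?at] by simp
      have "(n \<noteq> 4 \<longrightarrow> \<bar>per_on J I ?at\<bar> \<le> dper n (n - 1)) \<and>
          (n = 4 \<longrightarrow> \<bar>per_on J I ?at\<bar> \<le> dper 4 3 \<or> is_star J I 4 ?at) \<and>
          (\<bar>per_on J I ?at\<bar> = dper n (n - 1) \<longrightarrow> is_star J I (n - 1) ?at)"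
        using True by (elim exE conjE) (rule near[OF sqt rkt])
      then show ?thesis using s unfolding p by (intro conjI impI) auto
    next
      case no_cols: False
    have rows: "2 \<le> card (diff_on J a x y) \<and> card (diff_on J a x y) \<le> n - 2"
      if "x \<in> I" "y \<in> I" "x \<noteq> y" for x y
    proof -
      have "card (diff_on J a x y) \<noteq> 1" "card (diff_on J a x y) \<noteq> n - 1" using no_rows that by blast+
      then show ?thesis using card_diff_on_nonsingular[OF sq rk that] by linarith
    qed
    have cols: "2 \<le> card (diff_on I ?at x y) \<and> card (diff_on I ?at x y) \<le> n - 2"
      if "x \<in> J" "y \<in> J" "x \<noteq> y" for x y
    proof -
      have "card (diff_on I ?at x y) \<noteq> 1" "card (diff_on I ?at x y) \<noteq> n - 1" using no_cols that by blast+
      then show ?thesis using card_diff_on_nonsingular[OF sqt rkt that] by linarith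
    qed
    have strict: ?thesis if "\<bar>per_on I J a\<bar> < dper n (n - 1)" "n \<noteq> 4"
      using that by simp
    show ?thesis
    proof (cases "n = 6")
      case True
      have n42: "n - 2 = 4" using True by simp
      have "kraeuter K 4 r" for r by (rule IH) (use True in auto)
      then have "\<bar>per_on I J a\<bar> < dper 6 5"
        by (rule order_6_bound[OF sq[unfolded True] rk[unfolded True] _ rows[unfolded n42] cols[unfolded n42]])
      then show ?thesis by (intro strict) (use True in auto)
    next
      case n6: False
      obtain x0 y0 where xy0: "x0 \<in> I" "y0 \<in> I" "x0 \<noteq> y0"
        by (rule obtain_two_elements[of I]) (use cards n in simp)
      \<comment> \<open>In order 3 the bounds 2 and \<open>n - 2\<close> on the distance contradict
        each other, so close rows had to exist.\<close>
      have n3: "n \<noteq> 3" using rows[OF xy0] by auto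
      have n': "n = 4 \<or> n = 5 \<or> n \<ge> 7" using n n6 n3 by linarith
      show ?thesis
      proof (cases "\<exists>x\<in>I. \<exists>y\<in>I. x \<noteq> y \<and> card (diff_on J a x y) \<noteq> 2 \<and> card (diff_on J a x y) \<noteq> n - 2")
        case True
        have distant: ?thesis
          if xy: "x \<in> I" "y \<in> I" "x \<noteq> y" and d: "card (diff_on J a x y) \<noteq> 2" "card (diff_on J a x y) \<noteq> n - 2" for x y
        proof -
          have d': "3 \<le> card (diff_on J a x y)" "card (diff_on J a x y) \<le> n - 3"
            using rows[OF xy] d by auto
          then have n7: "n \<ge> 7" using n6 by linarith
          have "\<bar>per_on I J a\<bar> < dper n (n - 1)"
            by (rule distance_3_bound[OF sq n7 rk _ xy d']) (rule IH, use n7 in auto)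
          then show ?thesis by (rule strict) (use n7 in simp)
        qed
        from True show ?thesis by (elim bexE conjE) (rule distant)
      next
        case False
        have st: "is_star I J n a" by (rule distance_2_star[OF sq n']) (use False in blast)
        then have p: "\<bar>per_on I J a\<bar> = \<bar>dper n n\<bar>"
          using abs_per_on_star[OF fin] cards by simp
        have n4: "n \<ge> 4" using n n3 by simp
        show ?thesis
        proof (cases "n = 4")
          case True
          then show ?thesis using st p by (simp add: dper_4_4 dper_4_3 del: dper.simps)
        next
          case False
          then show ?thesis using p dper_diag[OF n4] n4 by (intro strict) auto
        qed
      qed
    qed
  qed
  qed
qed

section \<open>Singular matrices\<close>

text \<open>
  Minors equivalent to \<open>D_mat 4 4\<close> violate the bound used in the induction; in order 5 the other minors
  along the row make up for it.
\<close>

lemma Hadamard_minor_bound: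
  fixes I J :: "nat set"
  assumes fin: "finite I" "finite J" and cI: "card I = 4" and cJ: "card J = 5" and pm: "pm_on I J a"
    and h: "h \<in> J" and star: "is_star I (J - {h}) 4 a"
  shows "(\<Sum>j\<in>J. \<bar>per_on I (J - {j}) a\<bar>) \<le> 24"
  using star
proof (rule is_starE)
  fix s t F
  assume s: "\<And>i. i \<in> I \<Longrightarrow> s i = 1 \<or> s i = -1" and t: "\<And>j. j \<in> J - {h} \<Longrightarrow> t j = 1 \<or> t j = -1"
    and F: "F \<subseteq> I \<times> (J - {h})" "card F = 4" "inj_on fst F" "inj_on snd F"
    and a: "\<And>i j. i \<in> I \<Longrightarrow> j \<in> J - {h} \<Longrightarrow> a i j = s i * t j * flip F i j"
  have cJh: "card (J - {h}) = 4" using fin cJ h by simp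
  have finF: "finite F" using F(2) card.infinite by fastforce
  have "fst ` F \<subseteq> I" "snd ` F \<subseteq> J - {h}" using F(1) by auto
  moreover have "card (fst ` F) = 4" "card (snd ` F) = 4" using F by (simp_all add: card_image)
  ultimately have fstF: "fst ` F = I" and sndF: "snd ` F = J - {h}"
    using fin cI cJh by (simp_all add: card_subset_eq)
  \<comment> \<open>The extra column \<open>h\<close>, relative to the row signs of the
    star.\<close>
  define g where "g i = a i h * s i" for i
  define G where "G = sum g I"
  have g: "g i = 1 \<or> g i = -1" if "i \<in> I" for i
    using s[OF that] pm_onD[OF pm that h] unfolding g_def by (elim disjE) simp_all
  have minor: "\<bar>per_on I (J - {j}) a\<bar> = 2 * \<bar>G - 2 * g i\<bar>" if ij: "(i, j) \<in> F" for i j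
  proof -
    have iI: "i \<in> I" and jJ: "j \<in> J" "j \<noteq> h" using ij F(1) by auto
    define X where "X = prod s I * prod t (J - {j} - {h})"
    \<comment> \<open>Removing row \<open>k\<close> and column \<open>j\<close> takes out the flip
      of row \<open>k\<close> and the flip \<open>(i, j)\<close>. These coincide if
      \<open>k = i\<close>, which leaves three flips and \<open>dper 3 3 = -2\<close>; otherwise two
      remain and \<open>dper 3 2 = 2\<close>.\<close>
    have m: "per_on (I - {k}) (J - {j} - {h}) a = X * s k * (if k = i then - 2 else 2)" if k: "k \<in> I" for k
    proof -
      obtain q where q: "(k, q) \<in> F" using fstF k by (metis imageE prod.collapse)
      let ?F' = "F - {(k, q), (i, j)}"
      have F'sub: "?F' \<subseteq> (I - {k}) \<times> (J - {j} - {h})"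
      proof
        fix p assume p: "p \<in> ?F'"
        obtain k' j' where p': "p = (k', j')" by fastforce
        have "(k', j') \<in> F" using p p' by simp
        moreover have "k' \<noteq> k" using F(3) q p p' unfolding inj_on_fst_iff by blast
        moreover have "j' \<noteq> j" using F(4) ij p p' unfolding inj_on_snd_iff by blast
        ultimately show "p \<in> (I - {k}) \<times> (J - {j} - {h})" using F(1) p' by auto
      qed
      have per: "per_on (I - {k}) (J - {j} - {h}) a =
          prod s (I - {k}) * prod t (J - {j} - {h}) * dper (card (I - {k})) (card ?F')"
      proof (rule per_on_signed_flip)
        show "card (I - {k}) = card (J - {j} - {h})" using k jJ h fin cI cJ by simp
        show "?F' \<subseteq> (I - {k}) \<times> (J - {j} - {h})" by (rule F'sub)
        show "inj_on fst ?F'" "inj_on snd ?F'" using F(3,4) by (auto intro: inj_on_subset)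
        fix k' j' assume k': "k' \<in> I - {k}" and j': "j' \<in> J - {j} - {h}"
        then show "a k' j' = s k' * t j' * flip ?F' k' j'" using a[of k' j'] by (simp add: flip_def)
      qed (use fin in auto)
      have ss: "s k * s k = 1" using s[OF k] by (elim disjE) simp_all
      have prod: "prod s (I - {k}) = prod s I * s k"
        using prod.remove[OF fin(1) k, of s] ss by (simp add: mult.commute mult.left_commute)
      have "dper (card (I - {k})) (card ?F') = (if k = i then - 2 else 2)"
      proof -
        have c3: "card (I - {k}) = 3" using k fin cI by simp
        show ?thesis
        proof (cases "k = i")
          case True
          then have "q = j" using q ij F(3) unfolding inj_on_fst_iff by blast
          then have "card ?F' = 3" using True q F(2) finF by simp
          then show ?thesis unfolding c3 using True dper_3_3 by simp
        next
          case False
          then have "(k, q) \<noteq> (i, j)" by simp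
          then have "card ?F' = 2" using q ij F(2) finF by (simp add: card_Diff_subset)
          then show ?thesis unfolding c3 using False dper_3_2 by simp
        qed
      qed
      then show ?thesis unfolding per prod X_def by (simp only: mult.assoc mult.commute mult.left_commute)
    qed
    have "per_on I (J - {j}) a = (\<Sum>k\<in>I. a k h * per_on (I - {k}) (J - {j} - {h}) a)"
      by (rule per_on_expand_col) (use fin h jJ in auto)
    also have "\<dots> = (\<Sum>k\<in>I. X * (2 * g k - (if k = i then 4 * g k else 0)))"
    proof (rule sum.cong[OF refl])
      fix k assume k: "k \<in> I"
      have "a k h * per_on (I - {k}) (J - {j} - {h}) a = X * (g k * (if k = i then - 2 else 2))"
        unfolding m[OF k] g_def by (simp only: mult.assoc mult.commute mult.left_commute)
      then show "a k h * per_on (I - {k}) (J - {j} - {h}) a = X * (2 * g k - (if k = i then 4 * g k else 0))"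
        by simp
    qed
    also have "\<dots> = X * (2 * G - 4 * g i)"
      using fin iI by (simp add: sum_distrib_left[symmetric] sum_subtractf G_def)
    finally have e: "per_on I (J - {j}) a = X * (2 * G - 4 * g i)" .
    have "\<bar>prod s I\<bar> = 1" by (rule abs_prod_pm) (rule s)
    moreover have "\<bar>prod t (J - {j} - {h})\<bar> = 1" by (rule abs_prod_pm) (rule t, simp)
    ultimately have "\<bar>X\<bar> = 1" by (simp add: X_def abs_mult)
    then have "\<bar>per_on I (J - {j}) a\<bar> = \<bar>2 * (G - 2 * g i)\<bar>" unfolding e by (simp add: abs_mult)
    then show ?thesis by (simp only: abs_mult abs_numeral)
  qed
  have ex: "\<bar>per_on I (J - {h}) a\<bar> = 8"
    using abs_per_on_star[of I "J - {h}" 4 a] star fin cI cJh dper_4_4 by simp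
  have "(\<Sum>j\<in>J - {h}. \<bar>per_on I (J - {j}) a\<bar>) = (\<Sum>p\<in>F. \<bar>per_on I (J - {snd p}) a\<bar>)"
    using sum.reindex[OF F(4), of "\<lambda>j. \<bar>per_on I (J - {j}) a\<bar>"] unfolding sndF by (simp add: o_def)
  also have "\<dots> = (\<Sum>p\<in>F. 2 * \<bar>G - 2 * g (fst p)\<bar>)"
    by (rule sum.cong[OF refl]) (simp add: minor)
  also have "\<dots> = (\<Sum>i\<in>I. 2 * \<bar>G - 2 * g i\<bar>)"
    using sum.reindex[OF F(3), of "\<lambda>i. 2 * \<bar>G - 2 * g i\<bar>"] unfolding fstF by (simp add: o_def)
  \<comment> \<open>\<open>G\<close> is a sum of four odd numbers, so \<open>G - 2 * g i\<close> is
    even, and twice the absolute value of an even number is at most its square.\<close>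
  also have "\<dots> \<le> (\<Sum>i\<in>I. (G - 2 * g i)\<^sup>2)"
  proof (rule sum_mono)
    fix i assume "i \<in> I"
    have "odd (g k)" if "k \<in> I" for k using g[OF that] by (elim disjE) simp_all
    then have "{k \<in> I. odd (g k)} = I" by auto
    then have "even G" unfolding G_def using even_sum_iff[OF fin(1), of g] cI by simp
    then obtain k where k: "G - 2 * g i = 2 * k" by (metis dvd_def dvd_diff dvd_triv_left)
    have "\<bar>k\<bar> \<le> k * k"
    proof (cases "k = 0")
      case False
      then have "\<bar>k\<bar> * 1 \<le> \<bar>k\<bar> * \<bar>k\<bar>" by (intro mult_left_mono) auto
      then show ?thesis by simp
    qed simp
    then show "2 * \<bar>G - 2 * g i\<bar> \<le> (G - 2 * g i)\<^sup>2" unfolding k by (simp add: power2_eq_square abs_mult)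
  qed
  \<comment> \<open>On summation the terms in \<open>G\<close> cancel and 16 remains. With the 8 of
    the star minor the total is at most 24, while the bound in order 5 is
    \<open>dper 5 3 = 32\<close>.\<close>
  also have "\<dots> = (\<Sum>i\<in>I. G * G - 4 * G * g i + 4)"
  proof (rule sum.cong[OF refl])
    fix i assume "i \<in> I"
    have "g i * g i = 1" using g[OF \<open>i \<in> I\<close>] by (elim disjE) simp_all
    then show "(G - 2 * g i)\<^sup>2 = G * G - 4 * G * g i + 4" by (simp add: power2_eq_square algebra_simps)
  qed
  also have "\<dots> = 16"
  proof -
    have "(\<Sum>i\<in>I. G * G - 4 * G * g i + 4) = 4 * (G * G) - 4 * G * sum g I + 16"
      using cI by (simp add: sum.distrib sum_subtractf sum_distrib_left)
    then show ?thesis by (simp add: G_def)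
  qed
  finally have "(\<Sum>j\<in>J - {h}. \<bar>per_on I (J - {j}) a\<bar>) \<le> 16" .
  then show ?thesis using sum.remove[OF fin(2) h, of "\<lambda>j. \<bar>per_on I (J - {j}) a\<bar>"] ex by simp
qed

text \<open>The coloops of the matroid of the columns.\<close>

definition essential_cols :: "'k :: field_char_0 itself \<Rightarrow> 'a set \<Rightarrow> 'b set \<Rightarrow> ('a \<Rightarrow> 'b \<Rightarrow> int) \<Rightarrow> 'b set" where
  "essential_cols K I J a = {j \<in> J. rk K I (J - {j}) a < rk K I J a}"

text \<open>The minor at a coloop has rank \<open>r\<close>, any other minor along row
  \<open>i\<close> has rank \<open>Suc r\<close>; \<open>g\<close> collects the corresponding
  bounds. The columns off \<open>T\<close> are nonzero, so at most \<open>r\<close> units of rank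
  are left to coloops. The bound at a coloop is the larger one, so \<open>r\<close> coloops are the
  worst case.\<close>

lemma singular_expand:
  fixes I J :: "nat set"
  assumes sq: "sq n I J a" and i: "i \<in> I" and rk: "rk K I J a = Suc r" "rk K (I - {i}) J a = Suc r"
    and r: "r + 2 \<le> n" and IH: "\<And>s. kraeuter K (n - 1) s"
  defines "T \<equiv> essential_cols K (I - {i}) J a"
    and "g \<equiv> \<lambda>j. if j \<in> essential_cols K (I - {i}) J a then dper (n - 1) (r - 1) else dper (n - 1) r"
  shows "card T \<le> r" "card T + rk K (I - {i}) (J - T) a = Suc r" "\<bar>per_on I J a\<bar> \<le> dper n r"
    "\<bar>per_on I J a\<bar> = dper n r \<Longrightarrow> \<exists>s. (s = 1 \<or> s = -1) \<and> (\<forall>j\<in>J. a i j * per_on (I - {i}) (J - {j}) a = s * g j)"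
    "\<bar>per_on I J a\<bar> = dper n r \<Longrightarrow> r \<ge> 1 \<Longrightarrow> (n, r) \<noteq> (4, 2) \<Longrightarrow> card T = r"
proof -
  note fin = sqD(1,2)[OF sq] and cards = sqD(3,4)[OF sq] and pm = sqD(5)[OF sq]
  define P Q where "P = dper (n - 1) (r - 1)" and "Q = dper (n - 1) r"
  have finI: "finite (I - {i})" and cI: "card (I - {i}) = n - 1" using fin cards i by auto
  have TJ: "T \<subseteq> J" and finT: "finite T" using fin by (auto simp: T_def essential_cols_def)
  have pm': "pm_on (I - {i}) J' a" if "J' \<subseteq> J" for J' by (rule pm_on_subset[OF pm _ that]) auto
  have "card (I - {i}) \<noteq> 0" using cI r by simp
  then obtain k where k: "k \<in> I - {i}" by (metis card.empty ex_in_conv)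
  have ess: "card T + rk K (I - {i}) (J - T) a = Suc r"
    using rk_essential_cols[OF finI fin(2) TJ, of K a] rk by (simp add: T_def essential_cols_def)
  have pos: "rk K (I - {i}) J' a \<ge> 1" if J': "J' \<subseteq> J" "J' \<noteq> {}" for J'
  proof -
    from J'(2) obtain j where "j \<in> J'" by auto
    then show ?thesis by (rule rk_pos[OF finI k _ pm'[OF J'(1)]])
  qed
  have cT: "card T \<le> r"
  proof -
    have "card (J - T) = n - card T" using TJ finT fin cards by (simp add: card_Diff_subset)
    then have "card (J - T) \<noteq> 0" using ess r by simp
    then have "J - T \<noteq> {}" by (metis card.empty)
    then show ?thesis using pos[of "J - T"] ess by simp
  qed
  have sqm: "sq (n - 1) (I - {i}) (J - {j}) a" if "j \<in> J" for j by (rule sq_minor[OF sq i that])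
  have rkT: "rk K (I - {i}) (J - {j}) a = Suc (r - 1)" if j: "j \<in> T" for j
  proof -
    have jJ: "j \<in> J" using j TJ by auto
    have "card (J - {j}) = n - 1" using jJ fin cards by simp
    then have "card (J - {j}) \<noteq> 0" using r by simp
    then have "J - {j} \<noteq> {}" by (metis card.empty)
    then have "rk K (I - {i}) (J - {j}) a \<ge> 1" by (intro pos) auto
    moreover have "rk K (I - {i}) (J - {j}) a < Suc r"
      using j rk by (simp add: T_def essential_cols_def)
    moreover have "Suc r \<le> Suc (rk K (I - {i}) (J - {j}) a)"
      using rk_remove_col(2)[OF finI fin(2), of K a j] rk by simp
    ultimately show ?thesis by simp
  qed
  have rkN: "rk K (I - {i}) (J - {j}) a = Suc r" if j: "j \<in> J" "j \<notin> T" for j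
  proof -
    have "\<not> rk K (I - {i}) (J - {j}) a < Suc r" using j rk by (simp add: T_def essential_cols_def)
    moreover have "rk K (I - {i}) (J - {j}) a \<le> Suc r"
      using rk_remove_col(1)[OF finI fin(2), of K j a] rk by simp
    ultimately show ?thesis by simp
  qed
  have g: "g j = (if j \<in> T then P else Q)" for j by (simp add: g_def T_def P_def Q_def)
  have QP: "Q \<le> P" unfolding P_def Q_def by (rule dper_antimono) (use r in auto)
  have rec: "dper n r = int r * P + (int n - int r) * Q"
    using dper_expand[of r "n - 1"] r by (simp add: P_def Q_def)
  have sumg: "sum g J = int (card T) * P + (int n - int (card T)) * Q"
  proof -
    have "sum g J = (\<Sum>j\<in>J. Q + (if j \<in> T then P - Q else 0))" by (rule sum.cong) (simp_all add: g)
    also have "\<dots> = int n * Q + int (card T) * (P - Q)"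
      using fin cards TJ by (simp add: sum.distrib sum.inter_restrict[symmetric] Int_absorb1)
    finally show ?thesis by (simp add: algebra_simps)
  qed
  have sumg_le: "sum g J \<le> dper n r"
  proof -
    have "(int r - int (card T)) * (P - Q) \<ge> 0" using cT QP by simp
    then show ?thesis unfolding sumg rec by (simp add: algebra_simps)
  qed
  have per: "per_on I J a = (\<Sum>j\<in>J. a i j * per_on (I - {i}) (J - {j}) a)"
    by (rule per_on_expand_row[OF fin i])
  have absa: "\<bar>a i j * w\<bar> = \<bar>w\<bar>" if "j \<in> J" for j w
    using pm_onD[OF pm i that] by (elim disjE) (simp_all add: abs_mult)
  show "card T \<le> r" by (rule cT)
  show "card T + rk K (I - {i}) (J - T) a = Suc r" by (rule ess)
  have main: "\<bar>per_on I J a\<bar> \<le> dper n r \<and> (\<bar>per_on I J a\<bar> = dper n r \<longrightarrow>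
      (\<forall>j\<in>J. \<bar>a i j * per_on (I - {i}) (J - {j}) a\<bar> \<le> g j) \<and> \<bar>per_on I J a\<bar> = sum g J)"
  proof (cases "\<forall>j\<in>J. \<bar>per_on (I - {i}) (J - {j}) a\<bar> \<le> g j")
    case True
    then have b: "\<bar>a i j * per_on (I - {i}) (J - {j}) a\<bar> \<le> g j" if "j \<in> J" for j
      using that by (simp add: absa)
    have "\<bar>per_on I J a\<bar> \<le> sum g J"
      unfolding per by (rule order_trans[OF sum_abs sum_mono]) (rule b)
    then show ?thesis using sumg_le b by auto
  next
    case False
    then obtain h where h: "h \<in> J" "\<not> \<bar>per_on (I - {i}) (J - {h}) a\<bar> \<le> g h" by auto
    have hT: "h \<notin> T"
    proof
      assume hT: "h \<in> T"
      have "\<bar>per_on (I - {i}) (J - {h}) a\<bar> \<le> dper (n - 1) (r - 1)"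
        by (rule kraeuterD(1)[OF IH sqm[OF h(1)] rkT[OF hT]]) (use r in auto)
      then show False using h(2) hT by (simp add: g P_def)
    qed
    \<comment> \<open>Only a nonsingular minor of order 4 can violate \<open>g\<close>; then
      \<open>n = 5\<close>, and \<open>Hadamard_minor_bound\<close> makes the estimate
      strict.\<close>
    have n5: "(n - 1, r) = (4, 3)"
    proof (rule ccontr)
      assume "(n - 1, r) \<noteq> (4, 3)"
      then have "\<bar>per_on (I - {i}) (J - {h}) a\<bar> \<le> dper (n - 1) r"
        by (rule kraeuterD(1)[OF IH sqm[OF h(1)] rkN[OF h(1) hT]])
      then show False using h(2) hT by (simp add: g Q_def)
    qed
    have "\<bar>per_on (I - {i}) (J - {h}) a\<bar> \<le> dper 4 3 \<or> is_star (I - {i}) (J - {h}) 4 a"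
      by (rule kraeuterD(2)[OF IH sqm[OF h(1)] rkN[OF h(1) hT] n5])
    then have star: "is_star (I - {i}) (J - {h}) 4 a" using h(2) hT n5 by (auto simp: g Q_def)
    have "\<bar>per_on I J a\<bar> \<le> (\<Sum>j\<in>J. \<bar>a i j * per_on (I - {i}) (J - {j}) a\<bar>)"
      unfolding per by (rule sum_abs)
    also have "\<dots> = (\<Sum>j\<in>J. \<bar>per_on (I - {i}) (J - {j}) a\<bar>)"
      by (rule sum.cong[OF refl]) (rule absa)
    also have "\<dots> \<le> 24"
      by (rule Hadamard_minor_bound[OF finI fin(2) _ _ pm'[OF subset_refl] h(1) star]) (use cI cards n5 in auto)
    finally have "\<bar>per_on I J a\<bar> < dper 5 3" unfolding dper_5_3 by simp
    moreover have "n = 5" "r = 3" using n5 by auto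
    ultimately show ?thesis by simp
  qed
  then show "\<bar>per_on I J a\<bar> \<le> dper n r" by blast
  show "\<exists>s. (s = 1 \<or> s = -1) \<and> (\<forall>j\<in>J. a i j * per_on (I - {i}) (J - {j}) a = s * g j)"
    if eq: "\<bar>per_on I J a\<bar> = dper n r"
  proof (rule sum_abs_extremal[OF fin(2), of "\<lambda>j. a i j * per_on (I - {i}) (J - {j}) a" g])
    show "\<bar>a i j * per_on (I - {i}) (J - {j}) a\<bar> \<le> g j" if "j \<in> J" for j using main eq that by simp
    show "\<bar>\<Sum>j\<in>J. a i j * per_on (I - {i}) (J - {j}) a\<bar> = sum g J" using main eq per by simp
  qed
  show "card T = r" if eq: "\<bar>per_on I J a\<bar> = dper n r" and r1: "r \<ge> 1" and ne: "(n, r) \<noteq> (4, 2)"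
  proof -
    have "sum g J = dper n r" using main eq by simp
    then have "(int r - int (card T)) * (P - Q) = 0" unfolding sumg rec by (simp add: algebra_simps)
    \<comment> \<open>The difference is \<open>2 * dper (n - 2) (r - 1)\<close>, which vanishes just
      for \<open>(n, r) = (4, 2)\<close>.\<close>
    moreover have "P - Q > 0"
    proof -
      have "Suc (r - 1) = r" "n - 1 - 1 = n - 2" using r1 by simp_all
      then have "Q = P - 2 * dper (n - 2) (r - 1)"
        using dper.simps(2)[of "n - 1" "r - 1"] unfolding P_def Q_def by simp
      moreover have "dper (n - 2) (r - 1) > 0" by (rule dper_pos) (use r r1 ne in auto)
      ultimately show ?thesis by simp
    qed
    ultimately show ?thesis by simp
  qed
qed

section \<open>The equality case for singular matrices\<close>

definition parallel_rows :: "'b set \<Rightarrow> ('a \<Rightarrow> 'b \<Rightarrow> int) \<Rightarrow> 'a \<Rightarrow> 'a \<Rightarrow> bool" where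
  "parallel_rows J a x y \<longleftrightarrow> (\<exists>e. (e = 1 \<or> e = -1) \<and> (\<forall>j\<in>J. a y j = e * a x j))"

lemma parallel_rowsI: "e = 1 \<or> e = -1 \<Longrightarrow> (\<And>j. j \<in> J \<Longrightarrow> a y j = e * a x j) \<Longrightarrow> parallel_rows J a x y"
  unfolding parallel_rows_def by (intro exI[of _ e] conjI ballI)

lemma parallel_rowsE:
  assumes "parallel_rows J a x y"
  obtains e where "e = 1 \<or> e = -1" "\<And>j. j \<in> J \<Longrightarrow> a y j = e * a x j"
  using assms unfolding parallel_rows_def by (elim exE conjE) (rule that, assumption, erule bspec)

lemma parallel_rows_refl: "parallel_rows J a x x"
  by (rule parallel_rowsI[of 1]) simp_all

lemma parallel_rows_of_card:
  assumes sq: "sq n I J a" and xy: "x \<in> I" "y \<in> I"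
    and c: "card (diff_on J a x y) = 0 \<or> card (diff_on J a x y) = n"
  shows "parallel_rows J a x y"
proof -
  note fin = sqD(1,2)[OF sq] and cards = sqD(3,4)[OF sq] and pm = sqD(5)[OF sq]
  have finD: "finite (diff_on J a x y)" by (rule finite_subset[OF diff_on_subset fin(2)])
  from c show ?thesis
  proof
    assume "card (diff_on J a x y) = 0"
    then have D: "diff_on J a x y = {}" using finD by simp
    show ?thesis
    proof (rule parallel_rowsI[of 1])
      fix j assume "j \<in> J"
      moreover have "j \<notin> diff_on J a x y" using D by simp
      ultimately show "a y j = 1 * a x j" by (simp add: diff_on_def)
    qed simp
  next
    assume "card (diff_on J a x y) = n"
    then have D: "diff_on J a x y = J" using card_subset_eq[OF fin(2) diff_on_subset] cards by simp
    show ?thesis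
    proof (rule parallel_rowsI[of "-1"])
      fix j assume j: "j \<in> J"
      then have "j \<in> diff_on J a x y" using D by simp
      then have "a x j \<noteq> a y j" by (simp add: diff_on_def)
      then show "a y j = -1 * a x j"
        using pm_onD[OF pm xy(1) j] pm_onD[OF pm xy(2) j] by (elim disjE) simp_all
    qed simp
  qed
qed

lemma sum_rows_product:
  assumes "finite J" "pm_on I J a" "x \<in> I" "y \<in> I"
  shows "(\<Sum>j\<in>J. a x j * a y j) = int (card J) - 2 * int (card (diff_on J a x y))"
proof -
  have "(\<Sum>j\<in>J. a x j * a y j) = (\<Sum>j\<in>J. 1 - (if j \<in> diff_on J a x y then 2 else 0))"
  proof (rule sum.cong[OF refl])
    fix j assume "j \<in> J"
    then show "a x j * a y j = 1 - (if j \<in> diff_on J a x y then 2 else 0)"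
      using pm_onD[OF assms(2,3)] pm_onD[OF assms(2,4)] by (fastforce simp: diff_on_def)
  qed
  also have "\<dots> = int (card J) - 2 * int (card (diff_on J a x y))"
    using assms(1) diff_on_subset[of J a x y]
    by (simp add: sum_subtractf sum.inter_restrict[symmetric] Int_absorb1)
  finally show ?thesis .
qed

text \<open>This replaces the coloop count at (4,2). Without parallel rows, a close pair of rows
  would bound the permanent by 2 + 2 < 8. So all distances are 2, the rows are orthogonal, and the
  matrix would be nonsingular.\<close>

lemma order_4_parallel_rows:
  fixes I J :: "nat set"
  assumes sq: "sq 4 I J a" and rk: "rk K I J a = 3" and per: "\<bar>per_on I J a\<bar> = 8"
    and IH: "\<And>r. kraeuter K 3 r"
  shows "\<exists>x\<in>I. \<exists>y\<in>I. x \<noteq> y \<and> parallel_rows J a x y"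
proof (rule ccontr)
  assume no: "\<not> ?thesis"
  note fin = sqD(1,2)[OF sq] and cards = sqD(3,4)[OF sq] and pm = sqD(5)[OF sq]
  have np: False if "x \<in> I" "y \<in> I" "x \<noteq> y" "parallel_rows J a x y" for x y
    using no that by blast
  have near: False if xy: "x \<in> I" "y \<in> I" "x \<noteq> y"
    and c: "card (diff_on J a x y) = 1 \<or> card (diff_on J a x y) = 4 - 1" for x y
  proof (rule near_rowsE[OF sq xy(1,2) c])
    fix l e assume l: "l \<in> J" and e: "e = 1 \<or> e = -1"
      and near: "\<And>j. j \<in> J - {l} \<Longrightarrow> a y j = e * a x j" "a y l = - e * a x l"
    define R where "R = I - {x, y}"
    have R: "finite R" "card R = 2" using fin cards xy by (auto simp: R_def card_Diff_subset)
    \<comment> \<open>If the minor had rank 1, the fourth row \<open>z\<close> would be parallel to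
      \<open>x\<close> and \<open>y\<close> off \<open>l\<close>. As these two differ up to sign at
      \<open>l\<close>, \<open>z\<close> would be parallel to one of them throughout. In rank 2 or 3
      the bound is 2.\<close>
    have b: "\<bar>a m l * per_on (I - {m}) (J - {l}) a\<bar> \<le> 2" if m: "m \<in> R" for m
    proof -
      have mI: "m \<in> I" "m \<noteq> x" "m \<noteq> y" using m by (auto simp: R_def)
      have sqm: "sq 3 (I - {m}) (J - {l}) a" using sq_minor[OF sq mI(1) l] by simp
      note sqmD = sqD[OF sqm]
      have "card (R - {m}) \<noteq> 0" using R m by simp
      then obtain z where z: "z \<in> R - {m}" by (metis card.empty ex_in_conv)
      have zI: "z \<in> I - {m}" "z \<noteq> x" "z \<noteq> y" "z \<in> I" using z by (auto simp: R_def)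
      have xI: "x \<in> I - {m}" using xy mI by auto
      have "card (J - {l}) \<noteq> 0" using sqmD(4) by simp
      then obtain j0 where j0: "j0 \<in> J - {l}" by (metis card.empty ex_in_conv)
      have "rk K (I - {m}) (J - {l}) a \<ge> 1" by (rule rk_pos[OF sqmD(1) xI j0 sqmD(5)])
      moreover have "rk K (I - {m}) (J - {l}) a \<noteq> 1"
      proof
        assume r1: "rk K (I - {m}) (J - {l}) a = 1"
        obtain e1 where e1: "e1 = 1 \<or> e1 = -1" "\<forall>j\<in>J - {l}. a z j = e1 * a x j"
          using rk_1_parallel_row[OF sqmD(1) r1 sqmD(5) xI zI(1)] by (elim exE conjE) (rule that)
        have "a z l = e1 * a x l \<or> a z l = - e1 * a x l"
          using e1(1) pm_onD[OF pm zI(4) l] pm_onD[OF pm xy(1) l] by (elim disjE) simp_all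
        then show False
        proof
          assume "a z l = e1 * a x l"
          then have "parallel_rows J a x z" using e1 by (intro parallel_rowsI[of e1]) auto
          then show False using np[OF xy(1) zI(4)] zI(2) by simp
        next
          assume zl: "a z l = - e1 * a x l"
          have ee: "e * e = 1" using e by (elim disjE) simp_all
          have "parallel_rows J a y z"
          proof (rule parallel_rowsI[of "e1 * e"])
            show "e1 * e = 1 \<or> e1 * e = -1" using e e1(1) by (elim disjE) simp_all
            fix j assume j: "j \<in> J"
            show "a z j = e1 * e * a y j"
            proof (cases "j = l")
              case True
              have "e1 * e * (- e * a x l) = - e1 * a x l" by (rule sign_cancel2(2)[OF ee])
              then show ?thesis unfolding True near(2) zl by (rule sym)
            next
              case False
              then have jl: "j \<in> J - {l}" using j by simp
              have "e1 * e * (e * a x j) = e1 * a x j" by (rule sign_cancel2(1)[OF ee])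
              then show ?thesis unfolding near(1)[OF jl] bspec[OF e1(2) jl] by (rule sym)
            qed
          qed
          then show False using np[OF xy(2) zI(4)] zI(3) by simp
        qed
      qed
      moreover have "rk K (I - {m}) (J - {l}) a \<le> 3"
        using rk_le_card[OF sqmD(1), of K "J - {l}" a] sqmD(3) by simp
      ultimately have "rk K (I - {m}) (J - {l}) a = Suc 1 \<or> rk K (I - {m}) (J - {l}) a = Suc 2" by arith
      then have "\<bar>per_on (I - {m}) (J - {l}) a\<bar> \<le> 2"
      proof
        assume r: "rk K (I - {m}) (J - {l}) a = Suc 1"
        show ?thesis using kraeuterD(1)[OF IH sqm r] unfolding dper_3_1 by simp
      next
        assume r: "rk K (I - {m}) (J - {l}) a = Suc 2"
        show ?thesis using kraeuterD(1)[OF IH sqm r] unfolding dper_3_2 by simp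
      qed
      then show ?thesis using pm_onD[OF pm mI(1) l] by (elim disjE) simp_all
    qed
    have "per_on I J a = (\<Sum>m\<in>R. a m l * per_on (I - {m}) (J - {l}) a)"
      unfolding R_def by (rule per_on_near_rows[OF fin xy l e]) (rule near | assumption)+
    also have "\<bar>\<dots>\<bar> \<le> (\<Sum>m\<in>R. 2)" by (rule order_trans[OF sum_abs sum_mono]) (rule b)
    finally show False using per R by simp
  qed simp
  \<comment> \<open>Sizes 0 and 4 of the difference set mean parallel rows, 1 and 3 mean close ones;
    size 2 of 4 is orthogonality.\<close>
  have orth: "(\<Sum>j\<in>J. a x j * a y j) = 0" if xy: "x \<in> I" "y \<in> I" "x \<noteq> y" for x y
  proof -
    have "\<not> (card (diff_on J a x y) = 0 \<or> card (diff_on J a x y) = 4)"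
      by (intro notI) (rule np[OF xy parallel_rows_of_card[OF sq xy(1,2)]])
    moreover have "card (diff_on J a x y) \<noteq> 1" "card (diff_on J a x y) \<noteq> 3" using near[OF xy] by auto
    moreover have "card (diff_on J a x y) \<le> 4" using card_mono[OF fin(2) diff_on_subset[of J a x y]] cards by simp
    ultimately have "card (diff_on J a x y) = 2" by arith
    then show ?thesis using sum_rows_product[OF fin(2) pm xy(1,2)] cards by simp
  qed
  obtain i where i: "i \<in> I" "rk K (I - {i}) J a = rk K I J a"
    using rk_ex_redundant_row[OF fin(1), of K J a] rk cards by auto
  have c: "(\<Sum>j\<in>J. of_int (a i j) * of_int (a k j)) = (of_int (\<Sum>j\<in>J. a i j * a k j) :: 'a)" for k
    by simp
  \<comment> \<open>The inner product with row \<open>i\<close> is a functional that vanishes on the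
    other rows; as row \<open>i\<close> is redundant, it would be orthogonal to itself.\<close>
  have "(\<Sum>j\<in>J. of_int (a i j) * of_int (a i j)) = (0 :: 'a)"
  proof (rule rank_on_redundant_functional[OF fin i(1) i(2)[unfolded rk_def]])
    fix k assume "k \<in> I - {i}"
    then show "(\<Sum>j\<in>J. of_int (a i j) * of_int (a k j)) = (0 :: 'a)"
      unfolding c using orth[of i k] i(1) by simp
  qed
  then have "(\<Sum>j\<in>J. a i j * a i j) = 0" unfolding c by (simp only: of_int_eq_0_iff)
  moreover have "(\<Sum>j\<in>J. a i j * a i j) = 4"
    using sum_rows_product[OF fin(2) pm i(1) i(1)] cards by (simp add: diff_on_def)
  ultimately show False by simp
qed

text \<open>With exactly \<open>r\<close> coloops, the other \<open>n - r\<close> columns have rank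
  1 off the redundant row \<open>i\<close>, and their proportionality extends to row
  \<open>i\<close>. At (4,2) two parallel columns suffice, since \<open>n - r = 2\<close>.\<close>

lemma singular_parallel_cols:
  fixes I J :: "nat set"
  assumes sq: "sq n I J a" and rk: "rk K I J a = Suc r" and r: "1 \<le> r" "r + 2 \<le> n"
    and IH: "\<And>s. kraeuter K (n - 1) s" and eq: "\<bar>per_on I J a\<bar> = dper n r"
  shows "\<exists>L\<subseteq>J. card L = n - r \<and> (\<forall>p\<in>L. \<forall>q\<in>L. parallel_rows I (\<lambda>j i. a i j) p q)"
proof (cases "(n, r) = (4, 2)")
  case True
  then have nr: "n = 4" "r = 2" by simp_all
  have sqt: "sq 4 J I (\<lambda>j i. a i j)" using sq_transpose[OF sq] nr by simp
  note fin = sqD(1,2)[OF sq]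
  have "\<exists>x\<in>J. \<exists>y\<in>J. x \<noteq> y \<and> parallel_rows I (\<lambda>j i. a i j) x y"
  proof (rule order_4_parallel_rows[OF sqt])
    show "rk K J I (\<lambda>j i. a i j) = 3" using rk_transpose[OF fin, of K a] rk nr by simp
    show "\<bar>per_on J I (\<lambda>j i. a i j)\<bar> = 8"
      unfolding per_on_transpose[OF fin] eq nr by (rule dper_4_2)
    show "kraeuter K 3 s" for s using IH[of s] nr by simp
  qed
  then obtain x y where xy: "x \<in> J" "y \<in> J" "x \<noteq> y" "parallel_rows I (\<lambda>j i. a i j) x y"
    by (elim bexE conjE) (rule that)
  have sym: "parallel_rows I (\<lambda>j i. a i j) y x"
    using xy(4)
  proof (rule parallel_rowsE)
    fix e assume e: "e = 1 \<or> e = -1" "\<And>i. i \<in> I \<Longrightarrow> a i y = e * a i x"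
    show ?thesis
    proof (rule parallel_rowsI[OF e(1)])
      fix i assume "i \<in> I"
      then show "a i x = e * a i y" using e(1) unfolding e(2)[OF \<open>i \<in> I\<close>] by (elim disjE) simp_all
    qed
  qed
  show ?thesis
    by (rule exI[of _ "{x, y}"]) (use xy sym nr in \<open>simp add: parallel_rows_refl\<close>)
next
  case False
  note fin = sqD(1,2)[OF sq] and cards = sqD(3,4)[OF sq] and pm = sqD(5)[OF sq]
  obtain i where i: "i \<in> I" "rk K (I - {i}) J a = rk K I J a"
    using rk_ex_redundant_row[OF fin(1), of K J a] rk cards r by auto
  have rki: "rk K (I - {i}) J a = Suc r" using i(2) rk by simp
  define T where "T = essential_cols K (I - {i}) J a"
  have cT: "card T = r"
    unfolding T_def by (rule singular_expand(5)[OF sq i(1) rk rki r(2) IH eq r(1) False])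
  have rk1: "rk K (I - {i}) (J - T) a = 1"
    using singular_expand(2)[OF sq i(1) rk rki r(2) IH] cT by (simp add: T_def)
  have TJ: "T \<subseteq> J" by (auto simp: T_def essential_cols_def)
  have "parallel_rows I (\<lambda>j i. a i j) p q" if pq: "p \<in> J - T" "q \<in> J - T" for p q
  proof -
    have fin': "finite (I - {i})" "finite (J - T)" using fin by auto
    have "rk K (J - T) (I - {i}) (\<lambda>j i. a i j) = 1"
      using rk_transpose[OF fin', of K a] rk1 by simp
    moreover have "pm_on (J - T) (I - {i}) (\<lambda>j i. a i j)"
      by (rule pm_on_transpose) (rule pm_on_subset[OF pm], auto)
    ultimately have "\<exists>e. (e = 1 \<or> e = -1) \<and> (\<forall>k\<in>I - {i}. a k q = e * a k p)"
      using rk_1_parallel_row[of "J - T" K "I - {i}" "\<lambda>j i. a i j" p q] fin' pq by simp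
    then obtain e where e: "e = 1 \<or> e = -1" "\<forall>k\<in>I - {i}. a k q = e * a k p" by (elim exE conjE) (rule that)
    have ie: "a i q = e * a i p"
      by (rule rk_redundant_parallel[OF fin i(1) i(2)]) (use e(2) pq in auto)
    show ?thesis
    proof (rule parallel_rowsI[OF e(1)])
      fix k assume "k \<in> I"
      then show "a k q = e * a k p" using ie e(2) by (cases "k = i") auto
    qed
  qed
  moreover have "card (J - T) = n - r"
    using TJ fin cards cT finite_subset[OF TJ fin(2)] by (simp add: card_Diff_subset)
  ultimately show ?thesis by (intro exI[of _ "J - T"]) simp
qed

text \<open>
  Each extremal minor is either given by flipping entries of the all-ones matrix (good), or it has a
  column that is constantly -1 apart from one row (bad). The sign of its permanent tells the two cases
  apart, hence all minors are of the same kind; if they were all bad, two columns would coincide.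
\<close>

lemma normalized_star:
  fixes I J :: "nat set"
  assumes sq: "sq n I J c" and r: "1 \<le> r" "r + 2 \<le> n"
    and L: "L \<subseteq> J" "card L = n - r" "\<And>k l. k \<in> I \<Longrightarrow> l \<in> L \<Longrightarrow> c k l = 1"
    and M: "M \<subseteq> I" "card M = n - r" "\<And>k j. k \<in> M \<Longrightarrow> j \<in> J \<Longrightarrow> c k j = 1"
    and i: "i \<in> M"
    and distinct: "\<And>p q. p \<in> J - L \<Longrightarrow> q \<in> J - L \<Longrightarrow> p \<noteq> q \<Longrightarrow> \<exists>k\<in>I. c k p \<noteq> c k q"
    and nonconst: "\<And>p. p \<in> J - L \<Longrightarrow> \<exists>k\<in>I. c k p \<noteq> 1"
    and minors: "\<And>j. j \<in> J - L \<Longrightarrow> is_star (I - {i}) (J - {j}) (r - 1) c"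
    and s: "\<And>j. j \<in> J - L \<Longrightarrow> per_on (I - {i}) (J - {j}) c = s * dper (n - 1) (r - 1)" "s = 1 \<or> s = -1"
  shows "is_star I J r c"
proof -
  note fin = sqD(1,2)[OF sq] and cards = sqD(3,4)[OF sq] and pm = sqD(5)[OF sq]
  have finL: "finite L" by (rule finite_subset[OF L(1) fin(2)])
  have cJL: "card (J - L) = r" using L finL cards r by (simp add: card_Diff_subset)
  have iI: "i \<in> I" using i M(1) by auto
  have ci: "c i j = 1" if "j \<in> J" for j by (rule M(3)[OF i that])
  \<comment> \<open>Every column outside \<open>L\<close> contains exactly one -1; this gives the
    flips of the star.\<close>
  have column: "\<exists>k\<in>I - {i}. c k q = -1 \<and> (\<forall>k'\<in>I. c k' q = -1 \<longrightarrow> k' = k)" if q: "q \<in> J - L" for q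
  proof (cases "r = 1")
    \<comment> \<open>\<open>M\<close> omits only one row, so that row alone can contain a
      -1.\<close>
    case True
    have finM: "finite M" by (rule finite_subset[OF M(1) fin(1)])
    have "card (I - M) = 1" using M cards True r finM by (simp add: card_Diff_subset)
    then obtain k where k: "I - M = {k}" by (rule card_1_singletonE)
    have kI: "k \<in> I - M" unfolding k by simp
    have one: "c k' q = 1" if "k' \<in> I" "k' \<noteq> k" for k'
    proof (rule M(3))
      have "k' \<notin> I - M" unfolding k using that by simp
      then show "k' \<in> M" using that by simp
    qed (use q in simp)
    obtain k' where k': "k' \<in> I" "c k' q \<noteq> 1" using nonconst[OF q] by (elim bexE) (rule that)
    have kk: "k' = k" using one[OF k'(1)] k'(2) by (cases "k' = k") simp_all
    have ck: "c k q = -1" using pm_onD[OF pm k'(1), of q] q k'(2) unfolding kk by simp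
    have uniq: "k' = k" if "k' \<in> I" "c k' q = -1" for k' using one[OF that(1)] that(2) by (cases "k' = k") simp_all
    show ?thesis
    proof (intro bexI[of _ k] conjI ballI impI)
      show "k \<in> I - {i}" using kI i by auto
    qed (use ck uniq in auto)
  next
    case False
    then have r2: "r \<ge> 2" using r by simp
    have n4: "n \<ge> 4" using r r2 by simp
    have cI: "card (I - {i}) = n - 1" using iI fin cards by simp
    have "card (M - {i}) \<noteq> 0" using i M r finite_subset[OF M(1) fin(1)] by simp
    then obtain i' where i': "i' \<in> M - {i}" by (metis card.empty ex_in_conv)
    have i'I: "i' \<in> I - {i}" "i' \<in> M" using i' M(1) by auto
    have Ppos: "dper (n - 1) (r - 1) > 0" by (rule dper_pos) (use n4 r in auto)
    \<comment> \<open>Row \<open>i'\<close> consists of ones like \<open>i\<close>, but survives in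
      the minors. A flip in this row, at column \<open>j0\<close>, forces the column sign -1, so
      that the rest of the column is -1; this is \<open>bad\<close>. Without such a flip all column
      signs are 1.\<close>
    define good where "good j F \<longleftrightarrow> F \<subseteq> (I - {i}) \<times> (J - {j} - L) \<and> inj_on fst F \<and> inj_on snd F \<and>
      snd ` F = J - {j} - L \<and> (\<forall>k\<in>I - {i}. \<forall>q\<in>J - {j}. c k q = flip F k q)" for j and F :: "(nat \<times> nat) set"
    define bad where "bad j j0 \<longleftrightarrow> j0 \<in> J - L \<and> j0 \<noteq> j \<and> c i' j0 = 1 \<and> (\<forall>k\<in>I - {i, i'}. c k j0 = -1)" for j j0
    \<comment> \<open>The columns of \<open>L\<close> are unflipped, so all row signs of the minor
      agree and can be moved to the columns. The product of the resulting column signs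
      \<open>y\<close> is then 1 in the good and -1 in the bad case.\<close>
    have dich: "(s = 1 \<and> (\<exists>F. good j F)) \<or> (s = -1 \<and> (\<exists>j0. bad j j0))" if j: "j \<in> J - L" for j
      using minors[OF j]
    proof (rule is_starE)
      fix \<sigma> t F
      assume \<sigma>: "\<And>k. k \<in> I - {i} \<Longrightarrow> \<sigma> k = 1 \<or> \<sigma> k = -1" and t: "\<And>q. q \<in> J - {j} \<Longrightarrow> t q = 1 \<or> t q = -1"
        and F: "F \<subseteq> (I - {i}) \<times> (J - {j})" "card F = r - 1" "inj_on fst F" "inj_on snd F"
        and cF: "\<And>k q. k \<in> I - {i} \<Longrightarrow> q \<in> J - {j} \<Longrightarrow> c k q = \<sigma> k * t q * flip F k q"
      have jJ: "j \<in> J" "j \<notin> L" using j by auto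
      have LJ: "l \<in> J - {j}" if "l \<in> L" for l using that L(1) jJ by auto
      have injF: "inj_on fst (F\<inverse>)" "inj_on snd (F\<inverse>)"
        using F(3,4) unfolding inj_on_fst_iff inj_on_snd_iff by blast+
      \<comment> \<open>Two columns of \<open>L\<close> coincide, so
        \<open>star_parallel_unflipped\<close> applies to the transposed minor, whose rows have
        length \<open>n - 1 \<ge> 3\<close>.\<close>
      have unfl: "(k, l) \<notin> F" if l: "l \<in> L" and k: "k \<in> I - {i}" for k l
      proof -
        have "card (L - {l}) \<noteq> 0" using l L(2) finL r by simp
        then obtain l' where l': "l' \<in> L - {l}" by (metis card.empty ex_in_conv)
        have "(l, k) \<notin> F\<inverse>"
        proof (rule star_parallel_unflipped[where J = "I - {i}" and x = l and y = l' and s = t and t = \<sigma> and e = 1 and a = "\<lambda>j k. c k j"])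
          show "c p l = t l * \<sigma> p * flip (F\<inverse>) l p" if "p \<in> I - {i}" for p
            using cF[OF that LJ[OF l]] by (simp add: flip_def mult.commute)
          show "c p l' = t l' * \<sigma> p * flip (F\<inverse>) l' p" if "p \<in> I - {i}" for p
            using cF[OF that LJ, of l'] l' by (simp add: flip_def mult.commute)
          show "c p l' = 1 * c p l" if "p \<in> I - {i}" for p
            using L(3)[of p l] L(3)[of p l'] l l' that by simp
          show "t l = 1 \<or> t l = -1" by (rule t[OF LJ[OF l]])
          show "t l' = 1 \<or> t l' = -1" by (rule t[OF LJ]) (use l' in simp)
        qed (use fin cI n4 l' injF \<sigma> k in auto)
        then show ?thesis by simp
      qed
      have FL: "F \<subseteq> (I - {i}) \<times> (J - {j} - L)" using F(1) unfl by blast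
      have sndF: "snd ` F = J - {j} - L"
      proof (rule card_subset_eq)
        show "finite (J - {j} - L)" using fin by simp
        show "snd ` F \<subseteq> J - {j} - L" using FL by auto
        have "J - {j} - L = J - L - {j}" by auto
        then have "card (J - {j} - L) = r - 1" using cJL j fin by simp
        then show "card (snd ` F) = card (J - {j} - L)" using F(2,4) by (simp add: card_image)
      qed
      have "card L \<noteq> 0" using L(2) r by simp
      then obtain l where l: "l \<in> L" by (metis card.empty ex_in_conv)
      have \<sigma>t: "\<sigma> k = t l" if k: "k \<in> I - {i}" for k
      proof -
        have "c k l = 1" by (rule L(3)) (use k l in auto)
        then have "\<sigma> k * t l = 1" using cF[OF k LJ[OF l]] unfl[OF l k] by (simp add: flip_def)
        then show ?thesis using \<sigma>[OF k] t[OF LJ[OF l]] by (elim disjE) simp_all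
      qed
      define y where "y q = t l * t q" for q
      have y: "y q = 1 \<or> y q = -1" if "q \<in> J - {j}" for q
        using t[OF LJ[OF l]] t[OF that] unfolding y_def by (elim disjE) simp_all
      have cy: "c k q = y q * flip F k q" if "k \<in> I - {i}" "q \<in> J - {j}" for k q
        using cF[OF that] \<sigma>t[OF that(1)] by (simp add: y_def)
      have per: "per_on (I - {i}) (J - {j}) c = prod y (J - {j}) * dper (n - 1) (r - 1)"
      proof -
        have "per_on (I - {i}) (J - {j}) c = prod (\<lambda>_. 1) (I - {i}) * prod y (J - {j}) * dper (card (I - {i})) (card F)"
          by (rule per_on_signed_flip) (use fin F cards cI jJ cy in auto)
        then show ?thesis by (simp add: cI F(2))
      qed
      have yi': "y q * flip F i' q = 1" if "q \<in> J - {j}" for q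
        using cy[OF i'I(1) that] M(3)[OF i'I(2), of q] that by simp
      show ?thesis
      proof (cases "\<exists>j0. (i', j0) \<in> F")
        case False
        then have y1: "y q = 1" if "q \<in> J - {j}" for q
          using yi'[OF that] by (simp add: flip_def)
        then have "prod y (J - {j}) = 1" by (intro prod.neutral) simp
        then have "s * dper (n - 1) (r - 1) = dper (n - 1) (r - 1)" using per s(1)[OF j] by simp
        then have "s = 1" using Ppos by simp
        moreover have "good j F" unfolding good_def using FL F(3,4) sndF cy y1 by simp
        ultimately show ?thesis by auto
      next
        case True
        then obtain j0 where j0: "(i', j0) \<in> F" by (elim exE) (rule that)
        have j0J: "j0 \<in> J - {j}" "j0 \<notin> L" using FL j0 by auto
        have fl: "flip F i' q = (if q = j0 then -1 else 1)" for q
        proof -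
          have "(i', q) \<in> F \<longleftrightarrow> q = j0" using j0 F(3) unfolding inj_on_fst_iff by blast
          then show ?thesis by (simp add: flip_def)
        qed
        have yj0: "y j0 = -1" using yi'[OF j0J(1)] fl[of j0] by simp
        have y1: "y q = 1" if "q \<in> J - {j} - {j0}" for q
          using yi'[of q] fl[of q] that by simp
        have "prod y (J - {j}) = y j0 * prod y (J - {j} - {j0})"
          by (rule prod.remove) (use fin j0J in auto)
        also have "prod y (J - {j} - {j0}) = 1" by (intro prod.neutral) (use y1 in simp)
        finally have "s * dper (n - 1) (r - 1) = - dper (n - 1) (r - 1)" using per s(1)[OF j] yj0 by simp
        then have "(s + 1) * dper (n - 1) (r - 1) = 0" by (simp add: algebra_simps)
        then have "s = -1" using Ppos by simp
        moreover have "bad j j0"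
          unfolding bad_def
        proof (intro conjI ballI)
          show "c i' j0 = 1" using M(3)[OF i'I(2), of j0] j0J by simp
          fix k assume k: "k \<in> I - {i, i'}"
          have "(k, j0) \<notin> F" using j0 F(4) k unfolding inj_on_snd_iff by blast
          then show "c k j0 = -1" using cy[of k j0] k j0J yj0 by (simp add: flip_def)
        qed (use j0J in auto)
        ultimately show ?thesis by auto
      qed
    qed
    \<comment> \<open>A bad column \<open>j0\<close> found in one minor and a bad column
      \<open>j1\<close> found after deleting \<open>j0\<close> are different, yet both are 1 in rows
      \<open>i\<close>, \<open>i'\<close> and -1 elsewhere.\<close>
    have "s \<noteq> -1"
    proof
      assume s1: "s = -1"
      have ex: "\<exists>j0. bad j j0" if "j \<in> J - L" for j using dich[OF that] s1 by simp
      obtain j0 where j0: "bad q j0" using ex[OF q] by (elim exE) (rule that)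
      have j0J: "j0 \<in> J - L" using j0 by (simp add: bad_def)
      obtain j1 where j1: "bad j0 j1" using ex[OF j0J] by (elim exE) (rule that)
      have j1J: "j1 \<in> J - L" "j1 \<noteq> j0" using j1 by (simp_all add: bad_def)
      have eqc: "c k j1 = c k j0" if "k \<in> I" for k
      proof -
        have JJ: "j0 \<in> J" "j1 \<in> J" using j0J j1J by simp_all
        show ?thesis
        proof (cases "k = i")
          case True
          then show ?thesis using ci[OF JJ(1)] ci[OF JJ(2)] by simp
        next
          case ki: False
          show ?thesis
          proof (cases "k = i'")
            case True
            then show ?thesis using j0 j1 by (simp add: bad_def)
          next
            case False
            then have "k \<in> I - {i, i'}" using ki that by simp
            then show ?thesis using j0 j1 by (simp add: bad_def)
          qed
        qed
      qed
      obtain k where "k \<in> I" "c k j1 \<noteq> c k j0" using distinct[OF j1J(1) j0J j1J(2)] by (elim bexE) (rule that)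
      then show False using eqc by simp
    qed
    \<comment> \<open>Column \<open>q\<close> is read off from a minor that deletes another column
      \<open>j\<close>, which exists as \<open>r \<ge> 2\<close>.\<close>
    have "card (J - L - {q}) \<noteq> 0" using cJL q fin r2 by simp
    then obtain j where j: "j \<in> J - L - {q}" by (metis card.empty ex_in_conv)
    then have "\<exists>F. good j F" using dich[of j] \<open>s \<noteq> -1\<close> by simp
    then obtain F where F: "good j F" by (elim exE) (rule that)
    have Fd: "F \<subseteq> (I - {i}) \<times> (J - {j} - L)" "inj_on snd F" "snd ` F = J - {j} - L"
      and cF: "\<And>k q. k \<in> I - {i} \<Longrightarrow> q \<in> J - {j} \<Longrightarrow> c k q = flip F k q"
      using F unfolding good_def by simp_all
    have "q \<in> snd ` F" unfolding Fd(3) using q j by auto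
    then obtain k where k: "(k, q) \<in> F" by (metis imageE prod.collapse)
    have kI: "k \<in> I - {i}" using k Fd(1) by auto
    have qj: "q \<in> J - {j}" using q j by auto
    show ?thesis
    proof (intro bexI[of _ k] conjI ballI impI)
      show "c k q = -1" using cF[OF kI qj] k by (simp add: flip_def)
      fix k' assume k': "k' \<in> I" "c k' q = -1"
      have "k' \<noteq> i" using ci[of q] q k' by auto
      then have "flip F k' q = -1" using cF[of k' q] k' qj by simp
      then have "(k', q) \<in> F" by (simp add: flip_def split: if_splits)
      then show "k' = k" using k Fd(2) unfolding inj_on_snd_iff by blast
    qed (rule kI)
  qed
  then have "\<forall>q\<in>J - L. \<exists>k. k \<in> I - {i} \<and> c k q = -1 \<and> (\<forall>k'\<in>I. c k' q = -1 \<longrightarrow> k' = k)"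
    by (simp only: Bex_def) (rule ballI)
  from bchoice[OF this] obtain g where "\<forall>q\<in>J - L. g q \<in> I - {i} \<and> c (g q) q = -1 \<and> (\<forall>k'\<in>I. c k' q = -1 \<longrightarrow> k' = g q)" ..
  then have g: "g q \<in> I" "c (g q) q = -1" "\<And>k. k \<in> I \<Longrightarrow> c k q = -1 \<Longrightarrow> k = g q" if "q \<in> J - L" for q
    using that by auto
  define F where "F = (\<lambda>q. (g q, q)) ` (J - L)"
  have F: "(k, q) \<in> F \<longleftrightarrow> q \<in> J - L \<and> k = g q" for k q by (auto simp: F_def)
  have cF: "c k q = flip F k q" if k: "k \<in> I" and q: "q \<in> J" for k q
  proof (cases "q \<in> L")
    case True
    then show ?thesis using L(3)[OF k True] by (simp add: flip_def F)
  next
    case False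
    then have q': "q \<in> J - L" using q by simp
    show ?thesis
    proof (cases "k = g q")
      case True
      then show ?thesis using g(2)[OF q'] q' by (simp add: flip_def F)
    next
      case False
      then have "c k q \<noteq> -1" using g(3)[OF q' k] by auto
      then show ?thesis using pm_onD[OF pm k q] False by (simp add: flip_def F)
    qed
  qed
  show ?thesis
  proof (rule is_starI[where s = "\<lambda>_. 1" and t = "\<lambda>_. 1" and F = F])
    show "F \<subseteq> I \<times> J" using g(1) by (auto simp: F_def)
    show "card F = r" using cJL by (simp add: F_def card_image inj_on_def)
    show "inj_on snd F" by (auto simp: F_def inj_on_def)
    \<comment> \<open>Two columns with their only -1 in the same row would be equal.\<close>
    show "inj_on fst F" unfolding inj_on_fst_iff
    proof (intro allI impI, rule ccontr)
      fix k p q assume *: "(k, p) \<in> F" "(k, q) \<in> F" "p \<noteq> q"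
      then have pq: "p \<in> J - L" "q \<in> J - L" "k = g p" "k = g q" by (simp_all add: F)
      obtain k' where k': "k' \<in> I" "c k' p \<noteq> c k' q"
        using distinct[OF pq(1,2) *(3)] by (elim bexE) (rule that)
      have "flip F k' p = flip F k' q" using pq by (simp add: flip_def F)
      then show False using k' cF[of k' p] cF[of k' q] pq by simp
    qed
    fix k q assume "k \<in> I" "q \<in> J"
    then show "c k q = 1 * 1 * flip F k q" using cF by simp
  qed simp_all
qed

lemma is_star_scale:
  assumes "is_star I J r c" "\<And>i. i \<in> I \<Longrightarrow> \<sigma> i = 1 \<or> \<sigma> i = -1" "\<And>j. j \<in> J \<Longrightarrow> \<tau> j = 1 \<or> \<tau> j = -1"
    and "\<And>i j. i \<in> I \<Longrightarrow> j \<in> J \<Longrightarrow> a i j = \<sigma> i * \<tau> j * c i j"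
  shows "is_star I J r a"
  using assms(1)
proof (rule is_starE)
  fix s t F
  assume s: "\<And>i. i \<in> I \<Longrightarrow> s i = 1 \<or> s i = -1" and t: "\<And>j. j \<in> J \<Longrightarrow> t j = 1 \<or> t j = -1"
    and F: "F \<subseteq> I \<times> J" "card F = r" "inj_on fst F" "inj_on snd F"
    and c: "\<And>i j. i \<in> I \<Longrightarrow> j \<in> J \<Longrightarrow> c i j = s i * t j * flip F i j"
  show ?thesis
  proof (rule is_starI[where s = "\<lambda>i. \<sigma> i * s i" and t = "\<lambda>j. \<tau> j * t j", OF _ _ F])
    show "\<sigma> i * s i = 1 \<or> \<sigma> i * s i = -1" if "i \<in> I" for i
      using s[OF that] assms(2)[OF that] by (elim disjE) simp_all
    show "\<tau> j * t j = 1 \<or> \<tau> j * t j = -1" if "j \<in> J" for j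
      using t[OF that] assms(3)[OF that] by (elim disjE) simp_all
    show "a i j = \<sigma> i * s i * (\<tau> j * t j) * flip F i j" if "i \<in> I" "j \<in> J" for i j
      unfolding assms(4)[OF that] c[OF that] by (simp only: mult.assoc mult.commute mult.left_commute)
  qed
qed

lemma is_star_cong:
  assumes "is_star I J r a" "\<And>i j. i \<in> I \<Longrightarrow> j \<in> J \<Longrightarrow> a i j = b i j"
  shows "is_star I J r b"
  by (rule is_star_scale[OF assms(1), of "\<lambda>_. 1" "\<lambda>_. 1"]) (simp_all add: assms(2))

lemma rk_remove_parallel_cols:
  assumes "finite I" "finite J" "l \<in> J" "finite X" "X \<subseteq> J - {l}"
    and "\<And>p. p \<in> X \<Longrightarrow> parallel_rows I (\<lambda>j i. a i j) l p"
  shows "rk K I (J - X) a = rk K I J a"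
  using assms(4-6)
proof (induction X rule: finite_induct)
  case (insert p X)
  have "parallel_rows I (\<lambda>j i. a i j) l p" using insert.prems(2) by simp
  then obtain e where e: "\<And>i. i \<in> I \<Longrightarrow> a i p = e * a i l" by (elim parallel_rowsE) (rule that)
  have "rk K I (J - X - {p}) a = rk K I (J - X) a"
    by (rule rk_parallel_col[where v = l and e = e]) (use assms(1-3) insert e in auto)
  moreover have "J - insert p X = J - X - {p}" by auto
  ultimately show ?case using insert by simp
qed simp

text \<open>Applied to the matrix and its transpose, \<open>singular_parallel_cols\<close> gives
  parallel columns \<open>L\<close> and parallel rows \<open>M\<close>. Expanding along a row
  \<open>i\<close> of \<open>M\<close>, which is redundant, shows that the minors at the columns off
  \<open>L\<close> are extremal with a common sign; after normalisation
  \<open>normalized_star\<close> applies.\<close>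

lemma singular_star:
  fixes I J :: "nat set"
  assumes sq: "sq n I J a" and rk: "rk K I J a = Suc r" and r: "1 \<le> r" "r + 2 \<le> n"
    and IH: "\<And>s. kraeuter K (n - 1) s" and eq: "\<bar>per_on I J a\<bar> = dper n r"
  shows "is_star I J r a"
proof -
  note fin = sqD(1,2)[OF sq] and cards = sqD(3,4)[OF sq] and pm = sqD(5)[OF sq]
  have sqt: "sq n J I (\<lambda>j i. a i j)" by (rule sq_transpose[OF sq])
  have rkt: "rk K J I (\<lambda>j i. a i j) = Suc r" using rk_transpose[OF fin, of K a] rk by simp
  have eqt: "\<bar>per_on J I (\<lambda>j i. a i j)\<bar> = dper n r" unfolding per_on_transpose[OF fin] by (rule eq)
  obtain L where L: "L \<subseteq> J" "card L = n - r" and Lp: "\<forall>p\<in>L. \<forall>q\<in>L. parallel_rows I (\<lambda>j i. a i j) p q"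
    using singular_parallel_cols[OF sq rk r IH eq] by (elim exE conjE) (rule that)
  obtain M where M: "M \<subseteq> I" "card M = n - r" and Mp: "\<forall>p\<in>M. \<forall>q\<in>M. parallel_rows J a p q"
    using singular_parallel_cols[OF sqt rkt r IH eqt] by (elim exE conjE) (rule that)
  have finL: "finite L" and finM: "finite M" using L(1) M(1) fin finite_subset by blast+
  have "card M \<ge> 2" "card L \<ge> 2" using L M r by simp_all
  obtain i i' where i: "i \<in> M" "i' \<in> M" "i \<noteq> i'" by (rule obtain_two_elements[OF \<open>card M \<ge> 2\<close>])
  obtain l l' where l: "l \<in> L" "l' \<in> L" "l \<noteq> l'" by (rule obtain_two_elements[OF \<open>card L \<ge> 2\<close>])
  have iI: "i \<in> I" "i' \<in> I" and lJ: "l \<in> J" "l' \<in> J" using i l L(1) M(1) by auto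
  have lpar: "parallel_rows I (\<lambda>j i. a i j) l p" if "p \<in> L" for p using Lp l(1) that by simp
  have rki: "rk K (I - {i}) J a = Suc r"
  proof -
    have "parallel_rows J a i' i" using Mp i by simp
    then obtain e where "\<And>j. j \<in> J \<Longrightarrow> a i j = e * a i' j" by (elim parallel_rowsE) (rule that)
    then have "rk K (I - {i}) J a = rk K I J a" by (rule rk_parallel_row[OF fin(1) iI i(3)])
    then show ?thesis using rk by simp
  qed
  have finI: "finite (I - {i})" using fin by simp
  define P where "P = dper (n - 1) (r - 1)"
  obtain s where s: "s = 1 \<or> s = -1"
    and sg: "\<forall>j\<in>J. a i j * per_on (I - {i}) (J - {j}) a = s *
      (if j \<in> essential_cols K (I - {i}) J a then dper (n - 1) (r - 1) else dper (n - 1) r)"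
    using singular_expand(4)[OF sq iI(1) rk rki r(2) IH eq] by (elim exE conjE) (rule that)
  have cJL: "card (J - L) = r" using L finL cards r by (simp add: card_Diff_subset)
  \<comment> \<open>Without \<open>j\<close> and with only one column of \<open>L\<close> kept,
    \<open>r\<close> columns remain, at no loss of rank from \<open>L\<close>; hence
    \<open>j\<close> is a coloop.\<close>
  have rkj: "rk K (I - {i}) (J - {j}) a = r" if j: "j \<in> J - L" for j
  proof -
    have "rk K (I - {i}) (J - {j} - (L - {l})) a = rk K (I - {i}) (J - {j}) a"
    proof (rule rk_remove_parallel_cols)
      fix p assume "p \<in> L - {l}"
      then have "parallel_rows I (\<lambda>j i. a i j) l p" using lpar by simp
      then show "parallel_rows (I - {i}) (\<lambda>j i. a i j) l p"
        by (elim parallel_rowsE) (rule parallel_rowsI, assumption, simp)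
    qed (use fin lJ l j L(1) finL in auto)
    moreover have "rk K (I - {i}) (J - {j} - (L - {l})) a \<le> card (J - {j} - (L - {l}))"
    proof -
      have "finite (J - {j} - (L - {l}))" using fin by simp
      then have "rk K (J - {j} - (L - {l})) (I - {i}) (\<lambda>j i. a i j) \<le> card (J - {j} - (L - {l}))"
        by (rule rk_le_card)
      then show ?thesis using rk_transpose[OF finI, of "J - {j} - (L - {l})" K a] fin by simp
    qed
    moreover have "card (J - {j} - (L - {l})) = r"
    proof -
      have "J - {j} - (L - {l}) = insert l (J - L - {j})" using lJ l j by auto
      moreover have "card (J - L - {j}) = r - 1" using cJL j fin by simp
      ultimately show ?thesis using fin l r(1) by simp
    qed
    moreover have "Suc r \<le> Suc (rk K (I - {i}) (J - {j}) a)"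
      using rk_remove_col(2)[OF finI fin(2), of K a j] rki by simp
    ultimately show ?thesis by simp
  qed
  have sP: "a i j * per_on (I - {i}) (J - {j}) a = s * P" if j: "j \<in> J - L" for j
  proof -
    have "j \<in> essential_cols K (I - {i}) J a"
      using rkj[OF j] rki j by (simp add: essential_cols_def)
    then show ?thesis using bspec[OF sg, of j] j by (simp add: P_def)
  qed
  have Ppos: "P \<ge> 0" unfolding P_def by (rule dper_nonneg) (use r in auto)
  have minors: "is_star (I - {i}) (J - {j}) (r - 1) a" if j: "j \<in> J - L" for j
  proof (rule kraeuterD(3)[OF IH])
    show "sq (n - 1) (I - {i}) (J - {j}) a" by (rule sq_minor[OF sq iI(1)]) (use j in simp)
    show "rk K (I - {i}) (J - {j}) a = Suc (r - 1)" using rkj[OF j] r by simp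
    have "\<bar>a i j * per_on (I - {i}) (J - {j}) a\<bar> = P"
      using sP[OF j] s Ppos by (elim disjE) simp_all
    moreover have "\<bar>a i j\<bar> = 1" using pm_onD[OF pm iI(1), of j] j by auto
    ultimately show "\<bar>per_on (I - {i}) (J - {j}) a\<bar> = dper (n - 1) (r - 1)"
      by (simp add: abs_mult P_def)
  qed
  \<comment> \<open>These signs turn row \<open>i\<close> and column \<open>l\<close> into ones;
    rows parallel to \<open>i\<close> and columns parallel to \<open>l\<close> become ones as
    well.\<close>
  define \<sigma> \<tau> where "\<sigma> k = a k l" and "\<tau> j = a i j * a i l" for k j
  define c where "c k j = \<sigma> k * \<tau> j * a k j" for k j
  have al: "a k j = 1 \<or> a k j = -1" if "k \<in> I" "j \<in> J" for k j by (rule pm_onD[OF pm that])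
  have \<sigma>: "\<sigma> k = 1 \<or> \<sigma> k = -1" if "k \<in> I" for k using al[OF that lJ(1)] by (simp add: \<sigma>_def)
  have \<tau>: "\<tau> j = 1 \<or> \<tau> j = -1" if "j \<in> J" for j
    using al[OF iI(1) that] al[OF iI(1) lJ(1)] unfolding \<tau>_def by (elim disjE) simp_all
  have sqs: "\<sigma> k * \<sigma> k = 1" if "k \<in> I" for k using \<sigma>[OF that] by (elim disjE) simp_all
  have sqt': "\<tau> j * \<tau> j = 1" if "j \<in> J" for j using \<tau>[OF that] by (elim disjE) simp_all
  have ac: "a k j = \<sigma> k * \<tau> j * c k j" if "k \<in> I" "j \<in> J" for k j
  proof -
    have "\<sigma> k * \<tau> j * c k j = (\<sigma> k * \<sigma> k) * (\<tau> j * \<tau> j) * a k j"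
      unfolding c_def by (simp only: mult.assoc mult.commute mult.left_commute)
    then show ?thesis using sqs[OF that(1)] sqt'[OF that(2)] by simp
  qed
  have "is_star I J r c"
  proof (rule normalized_star[where L = L and M = M and i = i and s = "s * prod \<sigma> I * prod \<tau> J"])
    have "pm_on I J c"
      unfolding pm_on_def
    proof (intro ballI)
      fix k j assume kj: "k \<in> I" "j \<in> J"
      show "c k j = 1 \<or> c k j = -1"
        using \<sigma>[OF kj(1)] \<tau>[OF kj(2)] al[OF kj] unfolding c_def by (elim disjE) simp_all
    qed
    then show "sq n I J c" using sq by (simp add: sq_def)
    show "c k p = 1" if k: "k \<in> I" and p: "p \<in> L" for k p
    proof -
      obtain e where e: "e = 1 \<or> e = -1" "\<And>k. k \<in> I \<Longrightarrow> a k p = e * a k l"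
        using lpar[OF p] by (elim parallel_rowsE) (rule that)
      have "c k p = (e * e) * (a k l * a k l) * (a i l * a i l)"
        unfolding c_def \<sigma>_def \<tau>_def e(2)[OF k] e(2)[OF iI(1)] by (simp only: mult.assoc mult.commute mult.left_commute)
      moreover have "e * e = 1" using e(1) by (elim disjE) simp_all
      ultimately show ?thesis using pm_on_sq[OF pm k lJ(1)] pm_on_sq[OF pm iI(1) lJ(1)] by simp
    qed
    show "c k j = 1" if k: "k \<in> M" and j: "j \<in> J" for k j
    proof -
      have "parallel_rows J a i k" using Mp i k by simp
      then obtain e where e: "e = 1 \<or> e = -1" "\<And>j. j \<in> J \<Longrightarrow> a k j = e * a i j"
        by (elim parallel_rowsE) (rule that)
      have "c k j = (e * e) * (a i l * a i l) * (a i j * a i j)"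
        unfolding c_def \<sigma>_def \<tau>_def e(2)[OF j] e(2)[OF lJ(1)] by (simp only: mult.assoc mult.commute mult.left_commute)
      moreover have "e * e = 1" using e(1) by (elim disjE) simp_all
      ultimately show ?thesis using pm_on_sq[OF pm iI(1) lJ(1)] pm_on_sq[OF pm iI(1) j] by simp
    qed
    have rk_contra: False if X: "X \<subseteq> J" "card X < Suc r" "rk K I X a = Suc r" for X
    proof -
      have fX: "finite X" by (rule finite_subset[OF X(1) fin(2)])
      have "rk K X I (\<lambda>j i. a i j) \<le> card X" by (rule rk_le_card[OF fX])
      then show False using rk_transpose[OF fin(1) fX, of K a] X by simp
    qed
    \<comment> \<open>\<open>J - L\<close> together with one column of \<open>L\<close> consists of
      \<open>Suc r\<close> columns of rank \<open>Suc r\<close>, so no two of them are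
      parallel.\<close>
    have rkL: "rk K I (J - (L - {l})) a = Suc r" "card (J - (L - {l})) = Suc r"
    proof -
      have "rk K I (J - (L - {l})) a = rk K I J a"
        by (rule rk_remove_parallel_cols[OF fin lJ(1)]) (use finL L(1) lpar in auto)
      then show "rk K I (J - (L - {l})) a = Suc r" using rk by simp
      have "J - (L - {l}) = insert l (J - L)" using lJ l by auto
      then show "card (J - (L - {l})) = Suc r" using cJL fin l by simp
    qed
    have no_par: False if p: "p \<in> J - L" and q: "q \<in> J - (L - {l})" and pq: "p \<noteq> q"
      and cpq: "\<And>k. k \<in> I \<Longrightarrow> c k p = c k q" for p q
    proof -
      have pJ: "p \<in> J - (L - {l})" "p \<in> J" "q \<in> J" using p q by auto
      have par: "a k p = (\<tau> p * \<tau> q) * a k q" if k: "k \<in> I" for k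
      proof -
        have "(\<tau> p * \<tau> q) * a k q = (\<tau> q * \<tau> q) * (\<sigma> k * \<tau> p * c k p)"
          unfolding ac[OF k pJ(3)] cpq[OF k] by (simp only: mult.assoc mult.commute mult.left_commute)
        also have "\<dots> = \<sigma> k * \<tau> p * c k p" by (simp only: sqt'[OF pJ(3)] mult_1)
        also have "\<dots> = a k p" by (rule ac[OF k pJ(2), symmetric])
        finally show ?thesis by (rule sym)
      qed
      have fJ: "finite (J - (L - {l}))" using fin by simp
      have "rk K I (J - (L - {l}) - {p}) a = rk K I (J - (L - {l})) a"
        by (rule rk_parallel_col[OF fin(1) fJ pJ(1) q pq par])
      moreover have "card (J - (L - {l}) - {p}) < Suc r" using rkL(2) pJ(1) fin by simp
      ultimately show False using rkL(1) by (intro rk_contra[of "J - (L - {l}) - {p}"]) auto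
    qed
    show "\<exists>k\<in>I. c k p \<noteq> c k q" if "p \<in> J - L" "q \<in> J - L" "p \<noteq> q" for p q
    proof (rule ccontr)
      assume "\<not> ?thesis"
      then show False by (intro no_par[OF that(1) _ that(3)]) (use that in auto)
    qed
    have cl: "c k l = 1" if "k \<in> I" for k
      unfolding c_def \<sigma>_def \<tau>_def using al[OF that lJ(1)] al[OF iI(1) lJ(1)] by (elim disjE) simp_all
    show "\<exists>k\<in>I. c k p \<noteq> 1" if "p \<in> J - L" for p
    proof (rule ccontr)
      assume "\<not> ?thesis"
      then have "c k p = c k l" if "k \<in> I" for k using that cl by simp
      then show False by (intro no_par[OF that, of l]) (use that l lJ in auto)
    qed
    have mc: "c k j = \<sigma> k * \<tau> j * a k j" for k j by (simp add: c_def)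
    show "is_star (I - {i}) (J - {j}) (r - 1) c" if j: "j \<in> J - L" for j
      by (rule is_star_scale[OF minors[OF j], of \<sigma> \<tau>]) (use \<sigma> \<tau> mc in auto)
    show "per_on (I - {i}) (J - {j}) c = (s * prod \<sigma> I * prod \<tau> J) * dper (n - 1) (r - 1)" if j: "j \<in> J - L" for j
    proof -
      have jJ: "j \<in> J" using j by simp
      have per: "per_on (I - {i}) (J - {j}) c = prod \<sigma> (I - {i}) * prod \<tau> (J - {j}) * per_on (I - {i}) (J - {j}) a"
        unfolding c_def by (rule per_on_scale) (use fin in auto)
      have pI: "prod \<sigma> I = \<sigma> i * prod \<sigma> (I - {i})" by (rule prod.remove[OF fin(1) iI(1)])
      have pJ: "prod \<tau> J = \<tau> j * prod \<tau> (J - {j})" by (rule prod.remove[OF fin(2) jJ])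
      \<comment> \<open>The sign by which rescaling changes the minor differs from the global one by
        \<open>\<sigma> i * \<tau> j\<close>, which is the coefficient \<open>a i j\<close> of the
        expansion.\<close>
      have ij: "\<sigma> i * \<tau> j = a i j"
        using al[OF iI(1) lJ(1)] unfolding \<sigma>_def \<tau>_def by (elim disjE) simp_all
      have "(s * prod \<sigma> I * prod \<tau> J) * P = prod \<sigma> I * prod \<tau> J * (s * P)"
        by (simp only: mult.assoc mult.commute mult.left_commute)
      also have "\<dots> = (\<sigma> i * prod \<sigma> (I - {i})) * (\<tau> j * prod \<tau> (J - {j})) * (a i j * per_on (I - {i}) (J - {j}) a)"
        by (simp only: pI pJ sP[OF j])
      also have "\<dots> = (\<sigma> i * \<tau> j) * a i j * (prod \<sigma> (I - {i}) * prod \<tau> (J - {j}) * per_on (I - {i}) (J - {j}) a)"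
        by (simp only: mult.assoc mult.commute mult.left_commute)
      also have "\<dots> = per_on (I - {i}) (J - {j}) c"
        by (simp only: ij pm_on_sq[OF pm iI(1) jJ] mult_1 per)
      finally show ?thesis by (simp only: P_def)
    qed
    show "s * prod \<sigma> I * prod \<tau> J = 1 \<or> s * prod \<sigma> I * prod \<tau> J = -1"
    proof -
      have "\<bar>prod \<sigma> I\<bar> = 1" by (rule abs_prod_pm) (rule \<sigma>)
      moreover have "\<bar>prod \<tau> J\<bar> = 1" by (rule abs_prod_pm) (rule \<tau>)
      moreover have "\<bar>s\<bar> = 1" using s by auto
      ultimately have "\<bar>s * prod \<sigma> I * prod \<tau> J\<bar> = 1" by (simp add: abs_mult)
      then show ?thesis by linarith
    qed
  qed (use r L M i in auto)
  then show ?thesis by (rule is_star_scale[OF _ \<sigma> \<tau> ac])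
qed

section \<open>Small cases and the induction\<close>

lemma rank_1_star:
  fixes I J :: "nat set"
  assumes sq: "sq n I J a" and n: "n \<ge> 1" and rk: "rk K I J a = Suc 0"
  shows "is_star I J 0 a"
proof -
  note fin = sqD(1,2)[OF sq] and cards = sqD(3,4)[OF sq] and pm = sqD(5)[OF sq]
  have "card I \<noteq> 0" "card J \<noteq> 0" using cards n by simp_all
  then obtain x l where x: "x \<in> I" and l: "l \<in> J" by (metis card.empty ex_in_conv)
  have e: "\<exists>e. (e = 1 \<or> e = -1) \<and> (\<forall>j\<in>J. a y j = e * a x j)" if "y \<in> I" for y
    by (rule rk_1_parallel_row[OF fin(1) _ pm x that]) (use rk in simp)
  have "\<forall>y\<in>I. \<exists>e. (e = 1 \<or> e = -1) \<and> (\<forall>j\<in>J. a y j = e * a x j)" by (intro ballI e)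
  from bchoice[OF this] obtain s where s: "\<forall>y\<in>I. (s y = 1 \<or> s y = -1) \<and> (\<forall>j\<in>J. a y j = s y * a x j)" ..
  show ?thesis
    by (rule is_starI[where s = s and t = "a x" and F = "{}"]) (use s pm_onD[OF pm x] in \<open>auto simp: flip_def\<close>)
qed

text \<open>The bound \<open>dper 2 1\<close> is 0, so every nonsingular matrix of order 2 is
  extremal and has to be a star.\<close>

lemma order_2_nonsingular:
  fixes I J :: "nat set"
  assumes sq: "sq 2 I J a" and rk: "rk K I J a = 2"
  shows "per_on I J a = 0 \<and> is_star I J 1 a"
proof -
  note fin = sqD(1,2)[OF sq] and cards = sqD(3,4)[OF sq] and pm = sqD(5)[OF sq]
  obtain x y where x: "x \<in> I" "y \<in> I" "x \<noteq> y" by (rule obtain_two_elements[of I]) (use cards in simp)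
  obtain p q where p: "p \<in> J" "q \<in> J" "p \<noteq> q" by (rule obtain_two_elements[of J]) (use cards in simp)
  have I: "I = {x, y}" using card_subset_eq[OF fin(1), of "{x, y}"] x cards by simp
  have J: "J = {p, q}" using card_subset_eq[OF fin(2), of "{p, q}"] p cards by simp
  have c: "card (diff_on J a x y) = 1"
    using card_diff_on_nonsingular[OF sq rk x] by simp
  have sum0: "(\<Sum>j\<in>J. a x j * a y j) = 0"
    using sum_rows_product[OF fin(2) pm x(1,2)] c cards by simp
  then have sum: "a x p * a y p = - (a x q * a y q)" using p(3) by (simp add: J)
  have sgn: "a x p = 1 \<or> a x p = -1" "a x q = 1 \<or> a x q = -1" "a y p = 1 \<or> a y p = -1" "a y q = 1 \<or> a y q = -1"
    using pm_onD[OF pm] x p by simp_all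
  have single: "per_on {y} {j} a = a y j" for j
    using per_on_expand_row[of "{y}" "{j}" y a] by simp
  have "per_on I J a = a x p * a y q + a x q * a y p"
  proof -
    have "I - {x} = {y}" "J - {p} = {q}" "J - {q} = {p}" using x p by (auto simp: I J)
    then show ?thesis using per_on_expand_row[OF fin x(1), of a] p(3) single by (simp add: J)
  qed
  also have "\<dots> = 0" using sgn sum by (elim disjE) simp_all
  finally have per: "per_on I J a = 0" .
  define e where "e = a y p * a x p"
  have "is_star I J 1 a"
  proof (rule is_starI[where s = "\<lambda>k. if k = x then 1 else e" and t = "a x" and F = "{(y, q)}"])
    fix k j assume "k \<in> I" "j \<in> J"
    then have k: "k = x \<or> k = y" and j: "j = p \<or> j = q" by (auto simp: I J)
    have "a y p = e * a x p" "a y q = - e * a x q"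
      using sgn sum unfolding e_def by (elim disjE; simp)+
    then show "a k j = (if k = x then 1 else e) * a x j * flip {(y, q)} k j"
      using k j x(3) p(3) by (elim disjE) (simp_all add: flip_def)
  next
    have "e = 1 \<or> e = -1" using sgn unfolding e_def by (elim disjE) simp_all
    then show "(if k = x then 1 else e) = 1 \<or> (if k = x then 1 else e) = -1" for k by simp
  qed (use pm_onD[OF pm x(1)] x p in \<open>auto simp: I J\<close>)
  with per show ?thesis by simp
qed

text \<open>Strong induction is used because the two-row expansion refers to order
  \<open>n - 2\<close>.\<close>

lemma kraeuter_all:
  fixes K :: "'k :: field_char_0 itself"
  assumes "n \<ge> 1"
  shows "kraeuter K n r"
  using assms
proof (induction n arbitrary: r rule: less_induct)
  case (less n r)
  show ?case
    unfolding kraeuter_def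
  proof (intro allI impI)
    fix I J :: "nat set" and a
    assume sq: "sq n I J a" and rk: "rk K I J a = Suc r"
    note fin = sqD(1,2)[OF sq] and cards = sqD(3,4)[OF sq]
    have rn: "Suc r \<le> n" using rk_le_card[OF fin(1), of K J a] rk cards by simp
    let ?G = "((n, r) \<noteq> (4, 3) \<longrightarrow> \<bar>per_on I J a\<bar> \<le> dper n r) \<and>
     ((n, r) = (4, 3) \<longrightarrow> \<bar>per_on I J a\<bar> \<le> dper 4 3 \<or> is_star I J 4 a) \<and>
     (\<bar>per_on I J a\<bar> = dper n r \<longrightarrow> is_star I J r a)"
    have IH1: "kraeuter K (n - 1) s" if "n \<ge> 2" for s
      by (rule less.IH) (use that in auto)
    consider "r = 0" | "r \<ge> 1" "r + 2 \<le> n" | "n = 2" "r = 1" | "n \<ge> 3" "n = Suc r" using rn by linarith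
    then show ?G
    proof cases
      case 1
      have st: "is_star I J 0 a" by (rule rank_1_star[OF sq less.prems]) (use rk 1 in simp)
      have "\<bar>per_on I J a\<bar> = \<bar>dper n 0\<bar>"
        using abs_per_on_star[OF fin _ st] cards by simp
      then show ?thesis using 1 st by simp
    next
      case 2
      then have IH': "\<And>s. kraeuter K (n - 1) s" using IH1 by simp
      obtain i where i: "i \<in> I" "rk K (I - {i}) J a = rk K I J a"
        using rk_ex_redundant_row[OF fin(1), of K J a] rk cards 2 by auto
      have rki: "rk K (I - {i}) J a = Suc r" using i(2) rk by simp
      have "\<bar>per_on I J a\<bar> \<le> dper n r" by (rule singular_expand(3)[OF sq i(1) rk rki 2(2) IH'])
      moreover have "\<bar>per_on I J a\<bar> = dper n r \<Longrightarrow> is_star I J r a"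
        by (rule singular_star[OF sq rk 2 IH'])
      moreover have "(n, r) \<noteq> (4, 3)" using 2 by auto
      ultimately show ?thesis by blast
    next
      case 3
      have "per_on I J a = 0 \<and> is_star I J 1 a"
        by (rule order_2_nonsingular[where K = K]) (use sq rk 3 in simp_all)
      then show ?thesis using 3 dper_2_1 by (simp del: dper.simps)
    next
      case 4
      have IH': "kraeuter K m s" if "1 \<le> m" "m < n" for m s by (rule less.IH[OF that(2,1)])
      have rkn: "rk K I J a = n" using rk 4 by simp
      have r: "r = n - 1" using 4 by simp
      have "(n \<noteq> 4 \<longrightarrow> \<bar>per_on I J a\<bar> \<le> dper n (n - 1)) \<and>
        (n = 4 \<longrightarrow> \<bar>per_on I J a\<bar> \<le> dper 4 3 \<or> is_star I J 4 a) \<and>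
        (\<bar>per_on I J a\<bar> = dper n (n - 1) \<longrightarrow> is_star I J (n - 1) a)"
        by (rule kraeuter_nonsingular[OF sq 4(1) rkn IH'])
      then show ?thesis unfolding r by (cases "n = 4") simp_all
    qed
  qed
qed

section \<open>Standard transformations\<close>

text \<open>The rank of the library is the size of a maximal independent set of columns inside a
  carrier of vectors. A linear embedding into functions maps such a set to a basis of the span of
  the columns; transposing passes to rows.\<close>

lemma rank_eq_rk:
  fixes K :: "'k :: field_char_0 itself"
  assumes A: "A \<in> carrier_mat n n"
  shows "vec_space.rank n (map_mat of_int A :: 'k mat) = rk K {0..<n} {0..<n} (\<lambda>i j. A $$ (i, j))"
proof -
  let ?N = "{0..<n}"
  interpret V: vec_space "TYPE('k)" n .
  define B :: "'k mat" where "B = map_mat of_int A"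
  have B: "B \<in> carrier_mat n n" using A by (simp add: B_def)
  \<comment> \<open>Extension by 0 matches the convention of \<open>row_on\<close>.\<close>
  define \<phi> :: "'k vec \<Rightarrow> nat \<Rightarrow> 'k" where "\<phi> v = (\<lambda>i. if i < n then v $ i else 0)" for v
  let ?C = "set (cols B)"
  have C: "?C \<subseteq> carrier_vec n" using B cols_dim by blast
  have "\<exists>S. finite S \<and> maximal S (\<lambda>T. T \<subseteq> ?C \<and> V.lin_indpt T)"
  proof (rule maximal_exists)
    show "{} \<subseteq> ?C \<and> V.lin_indpt {}" by (simp add: V.lin_dep_def)
    show "finite T \<and> card T \<le> card ?C" if "T \<subseteq> ?C \<and> V.lin_indpt T" for T
      using that by (meson List.finite_set card_mono finite_subset)
  qed
  then obtain S where S: "finite S" "maximal S (\<lambda>T. T \<subseteq> ?C \<and> V.lin_indpt T)"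
    by (elim exE conjE) (rule that)
  have SC: "S \<subseteq> ?C" and ind: "V.lin_indpt S" using S(2) unfolding maximal_def by simp_all
  have Sn: "S \<subseteq> carrier_vec n" using SC C by blast
  have \<phi>inj: "inj_on \<phi> (carrier_vec n)"
  proof (rule inj_onI)
    fix v w assume v: "v \<in> carrier_vec n" and w: "w \<in> carrier_vec n" and eq: "\<phi> v = \<phi> w"
    show "v = w"
    proof (rule eq_vecI)
      fix i assume "i < dim_vec w"
      then have "i < n" using w by simp
      then show "v $ i = w $ i" using fun_cong[OF eq, of i] by (simp add: \<phi>_def)
    qed (use v w in simp)
  qed
  have \<phi>S: "inj_on \<phi> S" by (rule inj_on_subset[OF \<phi>inj Sn])
  have lin: "\<phi> (V.lincomb a X) = (\<Sum>v\<in>X. (\<lambda>i. a v * \<phi> v i))" if X: "X \<subseteq> carrier_vec n" "finite X" for a X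
  proof
    fix i
    show "\<phi> (V.lincomb a X) i = (\<Sum>v\<in>X. (\<lambda>i. a v * \<phi> v i)) i"
      using V.lincomb_index[OF _ X(1), of i a] by (simp add: \<phi>_def sum_fun_apply)
  qed
  have "fun_vs.dim (\<phi> ` ?C) = card S"
  proof (rule fun_vs.dim_unique)
    show "\<phi> ` S \<subseteq> \<phi> ` ?C" using SC by (rule image_mono)
    show "card (\<phi> ` S) = card S" using \<phi>S by (rule card_image)
    show "fun_vs.independent (\<phi> ` S)"
    proof
      assume "fun_vs.dependent (\<phi> ` S)"
      then obtain u where u: "\<exists>w\<in>\<phi> ` S. u w \<noteq> 0" "(\<Sum>w\<in>\<phi> ` S. (\<lambda>x. u w * w x)) = 0"
        unfolding fun_vs.dependent_finite[OF finite_imageI[OF S(1)]] by (elim exE conjE) (rule that)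
      have "\<phi> (V.lincomb (u \<circ> \<phi>) S) = 0"
        unfolding lin[OF Sn S(1)] using u(2) by (simp add: sum.reindex[OF \<phi>S] o_def)
      moreover have "\<phi> (0\<^sub>v n) = 0" by (auto simp: \<phi>_def fun_eq_iff)
      moreover have "V.lincomb (u \<circ> \<phi>) S \<in> carrier_vec n" by (rule V.lincomb_closed[OF Sn])
      ultimately have "V.lincomb (u \<circ> \<phi>) S = 0\<^sub>v n"
        using inj_onD[OF \<phi>inj] by simp
      moreover obtain v where "v \<in> S" "(u \<circ> \<phi>) v \<noteq> 0" using u(1) by auto
      ultimately have "V.lin_dep S" by (intro V.lin_dep_crit[OF S(1) subset_refl]) auto
      then show False using ind by simp
    qed
    show "\<phi> ` ?C \<subseteq> fun_vs.span (\<phi> ` S)"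
    proof (rule image_subsetI)
      fix v assume v: "v \<in> ?C"
      show "\<phi> v \<in> fun_vs.span (\<phi> ` S)"
      proof (cases "v \<in> S")
        case True
        then show ?thesis by (intro fun_vs.span_base imageI)
      next
        case False
        have "V.lin_dep (S \<union> {v})"
        proof (rule ccontr)
          assume "\<not> ?thesis"
          then have "S \<union> {v} \<subseteq> ?C \<and> V.lin_indpt (S \<union> {v})" using SC v by simp
          then have "S \<union> {v} = S" using S(2) unfolding maximal_def by blast
          then show False using False by blast
        qed
        then have "v \<in> V.span S" using V.lin_dep_iff_in_span[OF Sn ind _ False] v C by blast
        then obtain a where a: "v = V.lincomb a S" unfolding V.finite_span[OF S(1) Sn] by auto
        show ?thesis
          unfolding a lin[OF Sn S(1)] by (intro fun_vs.span_sum fun_vs.span_scale fun_vs.span_base imageI)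
      qed
    qed
  qed
  moreover have "\<phi> ` ?C = row_on ?N (\<lambda>j i. of_int (A $$ (i, j))) ` ?N"
  proof -
    have "?C = col B ` ?N" using B by (auto simp: cols_def)
    moreover have "\<phi> (col B j) = row_on ?N (\<lambda>j i. of_int (A $$ (i, j))) j" if "j \<in> ?N" for j
      using that A by (auto simp: \<phi>_def row_on_def B_def)
    ultimately show ?thesis by (simp add: image_image)
  qed
  moreover have "V.rank B = card S" by (rule V.rank_card_indpt[OF B S(2)])
  ultimately have "V.rank B = rk K ?N ?N (\<lambda>j i. A $$ (i, j))"
    unfolding rk_def rank_on_def by simp
  also have "\<dots> = rk K ?N ?N (\<lambda>i j. A $$ (i, j))" by (rule rk_transpose) simp_all
  finally show ?thesis unfolding B_def .
qed

section \<open>Stars are exactly the transforms of \<open>D_mat n r\<close>\<close>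

lemma is_star_permute_rows:
  assumes "is_star I J r a" "p permutes I"
  shows "is_star I J r (\<lambda>i j. a (p i) j)"
  using assms(1)
proof (rule is_starE)
  fix s t F
  assume s: "\<And>i. i \<in> I \<Longrightarrow> s i = 1 \<or> s i = -1" and t: "\<And>j. j \<in> J \<Longrightarrow> t j = 1 \<or> t j = -1"
    and F: "F \<subseteq> I \<times> J" "card F = r" "inj_on fst F" "inj_on snd F"
    and a: "\<And>i j. i \<in> I \<Longrightarrow> j \<in> J \<Longrightarrow> a i j = s i * t j * flip F i j"
  define ip where "ip = inv_into UNIV p"
  define h where "h e = (ip (fst e), snd e)" for e :: "'a \<times> 'b"
  have pinv: "p (ip i) = i" "ip (p i) = i" for i
    using permutes_inverses[OF assms(2)] by (simp_all add: ip_def)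
  have pI: "p i \<in> I \<longleftrightarrow> i \<in> I" "ip i \<in> I \<longleftrightarrow> i \<in> I" for i
    using permutes_in_image[OF assms(2)] permutes_in_image[OF permutes_inv[OF assms(2)]] by (simp_all add: ip_def)
  have hinj: "inj_on h F"
  proof (rule inj_onI)
    fix e e' assume "h e = h e'"
    then have "p (ip (fst e)) = p (ip (fst e'))" "snd e = snd e'" by (simp_all add: h_def)
    then show "e = e'" by (simp add: pinv prod_eq_iff)
  qed
  have hF: "(i, j) \<in> h ` F \<longleftrightarrow> (p i, j) \<in> F" for i j
  proof
    assume "(i, j) \<in> h ` F"
    then show "(p i, j) \<in> F" by (auto simp: h_def pinv)
  next
    assume "(p i, j) \<in> F"
    then have "h (p i, j) \<in> h ` F" by (rule imageI)
    then show "(i, j) \<in> h ` F" by (simp add: h_def pinv)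
  qed
  show ?thesis
  proof (rule is_starI[where s = "\<lambda>i. s (p i)" and t = t and F = "h ` F"])
    show "s (p i) = 1 \<or> s (p i) = -1" if "i \<in> I" for i using s[of "p i"] that pI by simp
    show "h ` F \<subseteq> I \<times> J" using F(1) pI by (auto simp: h_def)
    show "card (h ` F) = r" using card_image[OF hinj] F(2) by simp
    show "inj_on fst (h ` F)" using F(3) unfolding inj_on_fst_iff hF by blast
    show "inj_on snd (h ` F)" unfolding inj_on_snd_iff hF
    proof (intro allI impI)
      fix i j l assume "(p i, l) \<in> F" "(p j, l) \<in> F"
      then have "p i = p j" using F(4) unfolding inj_on_snd_iff by blast
      then show "i = j" using pinv(2) by metis
    qed
    show "a (p i) j = s (p i) * t j * flip (h ` F) i j" if "i \<in> I" "j \<in> J" for i j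
      using a[of "p i" j] that pI by (simp add: flip_def hF)
  qed (rule t)
qed

definition star_mat :: "nat \<Rightarrow> nat \<Rightarrow> int mat \<Rightarrow> bool" where
  "star_mat n r A \<longleftrightarrow> A \<in> carrier_mat n n \<and> is_star {0..<n} {0..<n} r (\<lambda>i j. A $$ (i, j))"

lemma star_matI:
  assumes "B \<in> carrier_mat n n" "is_star {0..<n} {0..<n} r b"
    and "\<And>i j. i < n \<Longrightarrow> j < n \<Longrightarrow> B $$ (i, j) = b i j"
  shows "star_mat n r B"
  unfolding star_mat_def
proof
  show "is_star {0..<n} {0..<n} r (\<lambda>i j. B $$ (i, j))"
    by (rule is_star_cong[OF assms(2)]) (simp add: assms(3))
qed (rule assms(1))

lemma star_mat_signs:
  assumes "star_mat n r A" "B \<in> carrier_mat n n"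
    and "\<And>i. i < n \<Longrightarrow> s i = 1 \<or> s i = -1" "\<And>j. j < n \<Longrightarrow> t j = 1 \<or> t j = -1"
    and "\<And>i j. i < n \<Longrightarrow> j < n \<Longrightarrow> B $$ (i, j) = s i * t j * A $$ (i, j)"
  shows "star_mat n r B"
  unfolding star_mat_def
proof
  have "is_star {0..<n} {0..<n} r (\<lambda>i j. A $$ (i, j))" using assms(1) by (simp only: star_mat_def)
  then show "is_star {0..<n} {0..<n} r (\<lambda>i j. B $$ (i, j))"
    by (rule is_star_scale[where \<sigma> = s and \<tau> = t]) (simp_all add: assms(3-5))
qed (rule assms(2))

lemma star_mat_step:
  assumes "std_step A B" "star_mat n r A"
  shows "star_mat n r B"
proof -
  have Ac: "A \<in> carrier_mat n n" and st: "is_star {0..<n} {0..<n} r (\<lambda>i j. A $$ (i, j))"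
    using assms(2) by (simp_all only: star_mat_def)
  note d = carrier_matD[OF Ac]
  show ?thesis
    using assms(1)
  proof cases
    case (negate_row k)
    show ?thesis unfolding negate_row(1)
      by (rule star_mat_signs[OF assms(2), where s = "\<lambda>i. if k = i then -1 else 1" and t = "\<lambda>_. 1"])
        (simp_all add: mat_multrow_gen_def d)
  next
    case (negate_col k)
    show ?thesis unfolding negate_col(1)
      by (rule star_mat_signs[OF assms(2), where s = "\<lambda>_. 1" and t = "\<lambda>j. if k = j then -1 else 1"])
        (simp_all add: mat_multcol_def d)
  next
    case (permute_rows p)
    have p: "p permutes {0..<n}" using permute_rows(2) unfolding d(1) .
    show ?thesis unfolding permute_rows(1)
      by (rule star_matI[OF _ is_star_permute_rows[OF st p]]) (simp_all add: d)
  next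
    case (permute_cols p)
    have p: "p permutes {0..<n}" using permute_cols(2) unfolding d(2) .
    show ?thesis unfolding permute_cols(1)
      by (rule star_matI[OF _ is_star_transpose[OF is_star_permute_rows[OF is_star_transpose[OF st] p]]])
        (simp_all add: d)
  next
    case transpose
    show ?thesis unfolding transpose
      by (rule star_matI[OF _ is_star_transpose[OF st]]) (simp_all add: d Ac)
  qed
qed

lemma star_mat_transform:
  assumes "std_transform A B" "star_mat n r A"
  shows "star_mat n r B"
  using assms(1)[unfolded std_transform_def]
proof (induction rule: rtranclp_induct)
  case base
  show ?case by (rule assms(2))
next
  case (step B C)
  show ?case by (rule star_mat_step[OF step.hyps(2) step.IH])
qed

lemma star_mat_D_mat:
  assumes "r \<le> n"
  shows "star_mat n r (D_mat n r)"
proof -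
  have "is_star {0..<n} {0..<n} r (\<lambda>i j. D_mat n r $$ (i, j))"
  proof (rule is_starI[where s = "\<lambda>_. 1" and t = "\<lambda>_. 1" and F = "(\<lambda>k. (k, k)) ` {0..<r}"])
    show "card ((\<lambda>k. (k, k)) ` {0..<r}) = r" by (simp add: card_image inj_on_def)
    show "D_mat n r $$ (i, j) = 1 * 1 * flip ((\<lambda>k. (k, k)) ` {0..<r}) i j"
      if "i \<in> {0..<n}" "j \<in> {0..<n}" for i j
      using that by (auto simp: D_mat_def flip_def)
  qed (use assms in \<open>auto simp: inj_on_def\<close>)
  then show ?thesis by (simp add: star_mat_def D_mat_def)
qed

lemma std_transform_trans: "std_transform A B \<Longrightarrow> std_transform B C \<Longrightarrow> std_transform A C"
  unfolding std_transform_def by (rule rtranclp_trans)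

lemma std_transform_step: "std_step A B \<Longrightarrow> std_transform A B"
  unfolding std_transform_def by (rule r_into_rtranclp)

lemma std_transform_negate_rows:
  assumes "A \<in> carrier_mat n m" "finite X" "X \<subseteq> {0..<n}"
  shows "std_transform A (mat n m (\<lambda>(i, j). (if i \<in> X then -1 else 1) * A $$ (i, j)))"
  using assms(2,3)
proof (induction X rule: finite_induct)
  case empty
  have "mat n m (\<lambda>(i, j). (if i \<in> {} then -1 else 1) * A $$ (i, j)) = A"
    using assms(1) by (intro eq_matI) simp_all
  then show ?case by (simp add: std_transform_def)
next
  case (insert x X)
  let ?B = "mat n m (\<lambda>(i, j). (if i \<in> X then -1 else 1) * A $$ (i, j))"
  have step: "std_step ?B (multrow x (-1) ?B)"
    by (rule std_step.negate_row) (use insert.prems in simp)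
  have eq: "multrow x (-1) ?B = mat n m (\<lambda>(i, j). (if i \<in> insert x X then -1 else 1) * A $$ (i, j))"
  proof (rule eq_matI)
    fix i j assume "i < dim_row (mat n m (\<lambda>(i, j). (if i \<in> insert x X then -1 else 1) * A $$ (i, j)))"
      "j < dim_col (mat n m (\<lambda>(i, j). (if i \<in> insert x X then -1 else 1) * A $$ (i, j)))"
    then have "i < n" "j < m" by simp_all
    then show "multrow x (-1) ?B $$ (i, j) =
        mat n m (\<lambda>(i, j). (if i \<in> insert x X then -1 else 1) * A $$ (i, j)) $$ (i, j)"
      using insert.hyps(2) by (cases "i = x") (simp_all add: mat_multrow_gen_def)
  qed (simp_all add: mat_multrow_gen_def)
  have "std_transform A ?B" by (rule insert.IH) (use insert.prems in simp)
  from std_transform_trans[OF this std_transform_step[OF step]] show ?case unfolding eq .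
qed

lemma std_transform_negate_cols:
  assumes "A \<in> carrier_mat n m" "finite X" "X \<subseteq> {0..<m}"
  shows "std_transform A (mat n m (\<lambda>(i, j). (if j \<in> X then -1 else 1) * A $$ (i, j)))"
proof -
  let ?B = "mat m n (\<lambda>(j, i). (if j \<in> X then -1 else 1) * A\<^sup>T $$ (j, i))"
  have 1: "std_transform A (A\<^sup>T)" by (intro std_transform_step std_step.transpose)
  have 2: "std_transform (A\<^sup>T) ?B" by (rule std_transform_negate_rows) (use assms in auto)
  have 3: "std_transform ?B (?B\<^sup>T)" by (intro std_transform_step std_step.transpose)
  have eq: "?B\<^sup>T = mat n m (\<lambda>(i, j). (if j \<in> X then -1 else 1) * A $$ (i, j))"
    using assms(1) by (intro eq_matI) simp_all
  from std_transform_trans[OF std_transform_trans[OF 1 2] 3] show ?thesis unfolding eq .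
qed

text \<open>Indices outside \<open>S\<close> are sent to \<open>r\<close> or above, where the
  diagonal of \<open>D_mat n r\<close> has no entry -1.\<close>

lemma extend_to_permutation:
  assumes "bij_betw f S {0..<r}" "S \<subseteq> {0..<n}" "r \<le> (n :: nat)"
  shows "\<exists>p. p permutes {0..<n} \<and> (\<forall>x\<in>S. p x = f x) \<and> (\<forall>x\<in>{0..<n} - S. p x \<ge> r)"
proof -
  have "card S = r" using bij_betw_same_card[OF assms(1)] by simp
  moreover have "finite S" using assms(2) finite_subset by blast
  ultimately have "card ({0..<n} - S) = card {r..<n}" using assms(2) by (simp add: card_Diff_subset)
  then obtain g where g: "bij_betw g ({0..<n} - S) {r..<n}"
    using finite_same_card_bij[of "{0..<n} - S" "{r..<n}"] by auto
  define p where "p x = (if x \<in> S then f x else if x \<in> {0..<n} then g x else x)" for x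
  have "bij_betw p S {0..<r}"
    using assms(1) by (rule bij_betw_cong[THEN iffD1, rotated]) (simp add: p_def)
  moreover have "bij_betw p ({0..<n} - S) {r..<n}"
    using g by (rule bij_betw_cong[THEN iffD1, rotated]) (simp add: p_def)
  ultimately have "bij_betw p (S \<union> ({0..<n} - S)) ({0..<r} \<union> {r..<n})"
    by (rule bij_betw_combine) auto
  moreover have "S \<union> ({0..<n} - S) = {0..<n}" "{0..<r} \<union> {r..<n} = {0..<n}" using assms(2,3) by auto
  ultimately have "bij_betw p {0..<n} {0..<n}" by simp
  then have "p permutes {0..<n}"
    by (rule bij_imp_permutes) (use assms(2) in \<open>auto simp: p_def\<close>)
  moreover have "p x \<ge> r" if "x \<in> {0..<n} - S" for x
    using bij_betwE[OF g] that by (simp add: p_def)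
  moreover have "p x = f x" if "x \<in> S" for x using that by (simp add: p_def)
  ultimately show ?thesis by blast
qed

text \<open>The flips are numbered from 0 to \<open>r - 1\<close> by \<open>h\<close>. Permutations
  match the row and the column of each flip with the diagonal position of its number; then rows and
  columns are negated.\<close>

lemma std_transform_of_star_mat:
  assumes "star_mat n r A"
  shows "std_transform (D_mat n r) A"
proof -
  let ?N = "{0..<n}"
  have A: "A \<in> carrier_mat n n" and st: "is_star ?N ?N r (\<lambda>i j. A $$ (i, j))"
    using assms by (simp_all add: star_mat_def)
  from st show ?thesis
  proof (rule is_starE)
    fix s t F
    assume s: "\<And>i. i \<in> ?N \<Longrightarrow> s i = 1 \<or> s i = -1" and t: "\<And>j. j \<in> ?N \<Longrightarrow> t j = 1 \<or> t j = -1"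
      and F: "F \<subseteq> ?N \<times> ?N" "card F = r" "inj_on fst F" "inj_on snd F"
      and a: "\<And>i j. i \<in> ?N \<Longrightarrow> j \<in> ?N \<Longrightarrow> A $$ (i, j) = s i * t j * flip F i j"
    have finF: "finite F" by (rule finite_subset[OF F(1)]) simp
    obtain h where h: "bij_betw h F {0..<r}" using ex_bij_betw_finite_nat[OF finF] F(2) by auto
    have sub: "fst ` F \<subseteq> ?N" "snd ` F \<subseteq> ?N" using F(1) by auto
    have rn: "r \<le> n" using card_mono[OF _ sub(1)] card_image[OF F(3)] F(2) by simp
    have "bij_betw (h \<circ> inv_into F fst) (fst ` F) {0..<r}"
      by (rule bij_betw_trans[OF bij_betw_inv_into[OF inj_on_imp_bij_betw[OF F(3)]] h])
    from extend_to_permutation[OF this sub(1) rn] obtain p where p: "p permutes ?N"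
      "\<forall>x\<in>fst ` F. p x = (h \<circ> inv_into F fst) x" "\<forall>x\<in>?N - fst ` F. p x \<ge> r" by (elim exE conjE) (rule that)
    have "bij_betw (h \<circ> inv_into F snd) (snd ` F) {0..<r}"
      by (rule bij_betw_trans[OF bij_betw_inv_into[OF inj_on_imp_bij_betw[OF F(4)]] h])
    from extend_to_permutation[OF this sub(2) rn] obtain q where q: "q permutes ?N"
      "\<forall>x\<in>snd ` F. q x = (h \<circ> inv_into F snd) x" "\<forall>x\<in>?N - snd ` F. q x \<ge> r" by (elim exE conjE) (rule that)
    have pe: "p (fst e) = h e" and qe: "q (snd e) = h e" if "e \<in> F" for e
      using bspec[OF p(2), of "fst e"] bspec[OF q(2), of "snd e"] that F(3,4) by simp_all
    \<comment> \<open>A diagonal -1 of \<open>D_mat n r\<close> reaches \<open>(i, j)\<close>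
      exactly if row \<open>i\<close> and column \<open>j\<close> carry the number of one and the
      same flip.\<close>
    have key: "(p i = q j \<and> p i < r) \<longleftrightarrow> (i, j) \<in> F" if ij: "i \<in> ?N" "j \<in> ?N" for i j
    proof
      assume *: "p i = q j \<and> p i < r"
      then have "i \<in> fst ` F" "j \<in> snd ` F" using bspec[OF p(3), of i] bspec[OF q(3), of j] ij by auto
      then obtain e e' where e: "e \<in> F" "fst e = i" and e': "e' \<in> F" "snd e' = j" by auto
      have "h e = h e'" using pe[OF e(1)] qe[OF e'(1)] e(2) e'(2) * by simp
      then have "e = e'" using h e(1) e'(1) by (simp add: bij_betw_def inj_on_def)
      then show "(i, j) \<in> F" using e e' by (metis prod.collapse)
    next
      assume ijF: "(i, j) \<in> F"
      then show "p i = q j \<and> p i < r" using pe[OF ijF] qe[OF ijF] bij_betwE[OF h] by auto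
    qed
    define D1 where "D1 = mat n n (\<lambda>(i, j). D_mat n r $$ (p i, j))"
    define D2 where "D2 = mat n n (\<lambda>(i, j). D1 $$ (i, q j))"
    have pq: "p i < n" "q i < n" if "i < n" for i
      using permutes_in_image[OF p(1), of i] permutes_in_image[OF q(1), of i] that by simp_all
    have D: "dim_row (D_mat n r) = n" "dim_col (D_mat n r) = n" by (simp_all add: D_mat_def)
    have "std_transform (D_mat n r) D1"
      using std_step.permute_rows[of p "D_mat n r"] p(1) D unfolding D1_def by (intro std_transform_step) simp
    moreover have "std_transform D1 D2"
      using std_step.permute_cols[of q D1] q(1) unfolding D2_def by (intro std_transform_step) (simp add: D1_def)
    ultimately have tr: "std_transform (D_mat n r) D2" by (rule std_transform_trans)
    have D2: "D2 $$ (i, j) = flip F i j" if "i < n" "j < n" for i j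
      using key[of i j] that pq by (auto simp: D2_def D1_def D_mat_def flip_def)
    have D2c: "D2 \<in> carrier_mat n n" by (simp add: D2_def)
    define X where "X = {i \<in> ?N. s i = -1}"
    define Y where "Y = {j \<in> ?N. t j = -1}"
    define D3 where "D3 = mat n n (\<lambda>(i, j). (if i \<in> X then -1 else 1) * D2 $$ (i, j))"
    have tr3: "std_transform D2 D3" unfolding D3_def by (rule std_transform_negate_rows[OF D2c]) (auto simp: X_def)
    have tr4: "std_transform D3 (mat n n (\<lambda>(i, j). (if j \<in> Y then -1 else 1) * D3 $$ (i, j)))"
      by (rule std_transform_negate_cols) (auto simp: Y_def D3_def)
    have eq: "mat n n (\<lambda>(i, j). (if j \<in> Y then -1 else 1) * D3 $$ (i, j)) = A"
    proof (rule eq_matI)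
      fix i j assume "i < dim_row A" "j < dim_col A"
      then have ij: "i < n" "j < n" using A by simp_all
      have "(if i \<in> X then -1 else 1) = s i" using s[of i] ij by (auto simp: X_def)
      moreover have "(if j \<in> Y then -1 else 1) = t j" using t[of j] ij by (auto simp: Y_def)
      ultimately show "mat n n (\<lambda>(i, j). (if j \<in> Y then -1 else 1) * D3 $$ (i, j)) $$ (i, j) = A $$ (i, j)"
        using ij a[of i j] D2[OF ij] by (simp add: D3_def mult.commute mult.left_commute)
    qed (use A in auto)
    from std_transform_trans[OF std_transform_trans[OF tr tr3] tr4] show ?thesis unfolding eq .
  qed
qed

lemma std_transform_iff_star_mat:
  assumes "r \<le> n"
  shows "std_transform (D_mat n r) A \<longleftrightarrow> star_mat n r A"
  using std_transform_of_star_mat star_mat_transform star_mat_D_mat[OF assms] by blast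

lemma permanent_D_mat:
  assumes "r \<le> n"
  shows "permanent (D_mat n r) = dper n r"
proof -
  let ?F = "(\<lambda>k. (k, k)) ` {0..<r}"
  have "permanent (D_mat n r) = per_on {0..<n} {0..<n} (\<lambda>i j. D_mat n r $$ (i, j))"
    by (rule permanent_eq_per_on) (simp add: D_mat_def)
  also have "\<dots> = per_on {0..<n} {0..<n} (flip ?F)"
    by (rule per_on_cong) (auto simp: D_mat_def flip_def)
  also have "\<dots> = dper (card {0..<n}) (card ?F)"
    by (rule per_on_flip) (use assms in \<open>auto simp: inj_on_def\<close>)
  also have "\<dots> = dper n r" by (simp add: card_image inj_on_def)
  finally show ?thesis .
qed

theorem corollary8p9:
  fixes n r :: nat
    and A :: "int mat"
  assumes "n \<ge> 2"
    and "A \<in> pm1_mats n"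
    and "r \<le> n - 1"
    and "vec_space.rank n (map_mat of_int A :: 'k :: field_char_0 mat) = r + 1"
  shows "((n, r) \<noteq> (4, 3) \<longrightarrow> \<bar>permanent A\<bar> \<le> permanent (D_mat n r)) \<and>
    ((n, r) = (4, 3) \<longrightarrow>
      (\<not> \<bar>permanent A\<bar> \<le> permanent (D_mat 4 3) \<longleftrightarrow> std_transform (D_mat 4 4) A)) \<and>
    (\<bar>permanent A\<bar> = permanent (D_mat n r) \<longleftrightarrow> std_transform (D_mat n r) A) \<and>
    (n \<ge> 5 \<longrightarrow>
      \<bar>permanent A\<bar> \<le> permanent (D_mat n r) \<and>
      (\<bar>permanent A\<bar> = permanent (D_mat n r) \<longleftrightarrow> std_transform (D_mat n r) A))"
proof -
  let ?N = "{0..<n}" and ?a = "\<lambda>i j. A $$ (i, j)"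
  have A: "A \<in> carrier_mat n n" and el: "elements_mat A \<subseteq> {-1, 1}"
    using assms(2) by (simp_all add: pm1_mats_def)
  have "pm_on ?N ?N ?a"
    unfolding pm_on_def
  proof (intro ballI)
    fix i j assume "i \<in> ?N" "j \<in> ?N"
    then have "A $$ (i, j) \<in> elements_mat A" by (intro elements_matI[OF A]) simp_all
    then have "A $$ (i, j) \<in> {-1, 1}" using el by (rule rev_subsetD)
    then have "A $$ (i, j) = -1 \<or> A $$ (i, j) = 1" by simp
    then show "A $$ (i, j) = 1 \<or> A $$ (i, j) = -1" by (elim disjE) simp_all
  qed
  then have sq: "sq n ?N ?N ?a" by (simp add: sq_def)
  have rk: "rk TYPE('k) ?N ?N ?a = Suc r"
    using rank_eq_rk[OF A, of "TYPE('k)"] assms(4) by simp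
  have rn: "r < n" using assms(1,3) by simp
  have K: "kraeuter TYPE('k) n r" by (rule kraeuter_all) (use assms(1) in simp)
  have per: "permanent A = per_on ?N ?N ?a" by (rule permanent_eq_per_on[OF A])
  have D: "permanent (D_mat n r) = dper n r" by (rule permanent_D_mat) (use rn in simp)
  have D43: "permanent (D_mat 4 3) = dper 4 3" by (rule permanent_D_mat) simp
  have star: "star_mat n m A \<longleftrightarrow> is_star ?N ?N m ?a" for m using A by (simp add: star_mat_def)
  have bound: "(n, r) \<noteq> (4, 3) \<Longrightarrow> \<bar>per_on ?N ?N ?a\<bar> \<le> dper n r"
    by (rule kraeuterD(1)[OF K sq rk])
  \<comment> \<open>A star with four flips has absolute permanent 8, above the bound 4; every other
    matrix satisfies the bound by \<open>kraeuter\<close>.\<close>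
  have except: "\<not> \<bar>per_on ?N ?N ?a\<bar> \<le> dper 4 3 \<longleftrightarrow> std_transform (D_mat 4 4) A" if nr: "(n, r) = (4, 3)"
  proof -
    have n4: "n = 4" using nr by simp
    have "std_transform (D_mat 4 4) A \<longleftrightarrow> is_star ?N ?N 4 ?a"
      using std_transform_iff_star_mat[of 4 4 A] star[of 4] n4 by simp
    moreover have "\<bar>per_on ?N ?N ?a\<bar> = 8" if "is_star ?N ?N 4 ?a"
      using abs_per_on_star[OF _ _ _ that] n4 dper_4_4 by simp
    ultimately show ?thesis using kraeuterD(2)[OF K sq rk nr] dper_4_3 by auto
  qed
  have eq: "\<bar>per_on ?N ?N ?a\<bar> = dper n r \<longleftrightarrow> std_transform (D_mat n r) A"
  proof -
    have "std_transform (D_mat n r) A \<longleftrightarrow> is_star ?N ?N r ?a"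
      using std_transform_iff_star_mat[of r n A] star[of r] rn by simp
    moreover have "\<bar>per_on ?N ?N ?a\<bar> = dper n r" if "is_star ?N ?N r ?a"
      using abs_per_on_star[OF _ _ _ that] dper_nonneg[OF rn] by simp
    ultimately show ?thesis using kraeuterD(3)[OF K sq rk] by blast
  qed
  show ?thesis unfolding per D D43 using bound except eq by auto
qed

end
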